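(* For $n\ge 1$ let $G_n$ be the Heisenberg group mod $n+2$, i.e. the group of matrices $\begin{pmatrix}1&i&k\\0&1&j\\0&0&1\end{pmatrix}$ with $i,j,k\in\mathbb{Z}_{n+2}$ under matrix multiplication, let $E_n\subset G_n$ be the set consisting of the five matrices $$I,\ \begin{pmatrix}1&1&0\\0&1&0\\0&0&1\end{pmatrix},\ \begin{pmatrix}1&-1&0\\0&1&0\\0&0&1\end{pmatrix},\ \begin{pmatrix}1&0&0\\0&1&1\\0&0&1\end{pmatrix},\ \begin{pmatrix}1&0&0\\0&1&-1\\0&0&1\end{pmatrix},$$ let $Q_n$ be the uniform probability on $E_n$, and let $U_n$ be the uniform probability on $G_n$. Let $\mathcal{G}=(G_n,Q_n,U_n)_{n=1}^\infty$, let $\gamma>0$ and $\mathcal{P}=(p_n)_{n=1}^\infty$ with $p_n=n^2\exp\{-n^{\gamma}\}$. Then the family $\mathcal{G}^{\mathcal{P}}$ has a total variation cutoff if and only if $0<\gamma<1$.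
   Context: A (discrete time) random walk $(G,Q,U)$ on a finite group $G$ driven by a probability $Q$ is the Markov chain on $G$ with transition matrix $K(x,y)=Q(x^{-1}y)$; $U$ is the uniform distribution on $G$. Its total variation is $d_{\mathrm{TV}}(m)=\max_{E\subset G}\{Q^{(m)}(E)-U(E)\}$, where $Q^{(m)}$ is the $m$-fold convolution $Q*\cdots*Q$, $f*g(x)=\sum_{z\in G}f(z)g(z^{-1}x)$ (the distance does not depend on the starting point). Its mixing time is $T_{\mathrm{TV}}(\epsilon)=\min\{m\ge 0: d_{\mathrm{TV}}(m)\le\epsilon\}$. Products: given random walks $(G_i,Q_i,U_i)_{i=1}^n$ and a probability vector $(r_1,\dots,r_n)$, their product with respect to $(r_1,\dots,r_n)$ is the random walk on $G_1\times\cdots\times G_n$ which at each step chooses coordinate $i$ with probability $r_i$ and moves that coordinate according to $Q_i$, leaving the others fixed. (That is, it is driven by $Q=\sum_{i=1}^n r_i\check Q_i$, where $\check Q_i$ is the image of $Q_i$ under the embedding of $G_i$ as the $i$th factor.) Given $\mathcal{G}=(G_n,Q_n,U_n)_{n=1}^\infty$ and positive reals $\mathcal{P}=(p_n)_{n=1}^\infty$, put $q_n=\sum_{i=1}^n p_i$; $\mathcal{G}^{\mathcal{P}}$ is the family whose $n$th random walk is the product of $(G_i,Q_i,U_i)_{i=1}^n$ with respect to $(p_1/q_n,\dots,p_n/q_n)$. Cutoff: let a family of discrete time random walks have total variations $d_{n,\mathrm{TV}}$ and mixing times $T_{n,\mathrm{TV}}$, with $T_{n,\mathrm{TV}}(\epsilon_0)\to\infty$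 for some $\epsilon_0\in(0,1)$. It has a total variation cutoff if $\lim_{n\to\infty}T_{n,\mathrm{TV}}(\epsilon)/T_{n,\mathrm{TV}}(\delta)=1$ for all $\epsilon,\delta\in(0,1)$; equivalently, there are $t_n>0$ with $d_{n,\mathrm{TV}}(\lceil at_n\rceil)\to0$ for all $a>1$ and $d_{n,\mathrm{TV}}(\lfloor at_n\rfloor)\to1$ for all $a\in(0,1)$. *)

theory Defs
  imports "HOL-Analysis.Analysis" "HOL-Algebra.Product_Groups"
begin

text \<open>A random walk \<open>(G, Q, U)\<close> is given by the pair \<open>(G, Q)\<close>; the uniform distribution \<open>U\<close> is
  determined by \<open>G\<close>. The values of \<open>Q\<close> outside \<open>carrier G\<close> are irrelevant.\<close>

type_synonym 'a random_walk = "'a monoid \<times> ('a \<Rightarrow> real)"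

definition uniform_prob :: "'a set \<Rightarrow> 'a \<Rightarrow> real" where
  "uniform_prob A x = (if x \<in> A then 1 / real (card A) else 0)"

definition convolve :: "'a monoid \<Rightarrow> ('a \<Rightarrow> real) \<Rightarrow> ('a \<Rightarrow> real) \<Rightarrow> 'a \<Rightarrow> real" where
  "convolve G f g x = (\<Sum>z\<in>carrier G. f z * g (inv\<^bsub>G\<^esub> z \<otimes>\<^bsub>G\<^esub> x))"

primrec convolve_power :: "'a monoid \<Rightarrow> ('a \<Rightarrow> real) \<Rightarrow> nat \<Rightarrow> 'a \<Rightarrow> real" where
  "convolve_power G Q 0 = (\<lambda>x. if x = \<one>\<^bsub>G\<^esub> then 1 else 0)"
| "convolve_power G Q (Suc m) = convolve G (convolve_power G Q m) Q"

definition tv_dist :: "'a random_walk \<Rightarrow> nat \<Rightarrow> real" where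
  "tv_dist = (\<lambda>(G, Q) m.
     Max ((\<lambda>E. (\<Sum>x\<in>E. convolve_power G Q m x) - (\<Sum>x\<in>E. uniform_prob (carrier G) x))
            ` Pow (carrier G)))"

text \<open>Meaningful only if the distance reaches \<open>\<epsilon>\<close> at some time, as it does for the ergodic walks
  and \<open>\<epsilon> > 0\<close> considered here.\<close>

definition tv_mixing_time :: "'a random_walk \<Rightarrow> real \<Rightarrow> nat" where
  "tv_mixing_time W \<epsilon> = (LEAST m. tv_dist W m \<le> \<epsilon>)"

text \<open>The first conjunct is the standing assumption under which the notion of cutoff is considered;
  families are indexed by \<open>n \<ge> 1\<close>, and the value at \<open>0\<close> plays no role.\<close>

definition has_tv_cutoff :: "(nat \<Rightarrow> 'a random_walk) \<Rightarrow> bool" where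
  "has_tv_cutoff F \<longleftrightarrow>
     (\<exists>\<epsilon>\<^sub>0\<in>{0<..<1}. filterlim (\<lambda>n. tv_mixing_time (F n) \<epsilon>\<^sub>0) at_top sequentially) \<and>
     (\<forall>\<epsilon>\<in>{0<..<1}. \<forall>\<delta>\<in>{0<..<1}.
        (\<lambda>n. real (tv_mixing_time (F n) \<epsilon>) / real (tv_mixing_time (F n) \<delta>)) \<longlonglongrightarrow> 1)"

definition coord_embed :: "'i set \<Rightarrow> ('i \<Rightarrow> 'a monoid) \<Rightarrow> 'i \<Rightarrow> 'a \<Rightarrow> 'i \<Rightarrow> 'a" where
  "coord_embed I G i x = (\<lambda>j\<in>I. if j = i then x else \<one>\<^bsub>G j\<^esub>)"

definition product_walk ::
  "'i set \<Rightarrow> ('i \<Rightarrow> 'a random_walk) \<Rightarrow> ('i \<Rightarrow> real) \<Rightarrow> ('i \<Rightarrow> 'a) random_walk" where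
  "product_walk I W r =
     (let G = \<lambda>i. fst (W i); Q = \<lambda>i. snd (W i) in
       (product_group I G,
        \<lambda>y. \<Sum>i\<in>I. r i * (\<Sum>x | x \<in> carrier (G i) \<and> coord_embed I G i x = y. Q i x)))"

definition product_family ::
  "(nat \<Rightarrow> 'a random_walk) \<Rightarrow> (nat \<Rightarrow> real) \<Rightarrow> nat \<Rightarrow> (nat \<Rightarrow> 'a) random_walk" where
  "product_family W p n = product_walk {1..n} W (\<lambda>i. p i / (\<Sum>j=1..n. p j))"

definition heis_matrix :: "int \<Rightarrow> int \<Rightarrow> int \<Rightarrow> int^3^3" where
  "heis_matrix i j k = vector [vector [1, i, k], vector [0, 1, j], vector [0, 0, 1]]"

text \<open>Matrices over \<open>\<int>\<^sub>m\<close> are represented by integer matrices with entries in \<open>{0..<m}\<close>.\<close>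

definition reduce_matrix :: "nat \<Rightarrow> int^3^3 \<Rightarrow> int^3^3" where
  "reduce_matrix m = map_matrix (\<lambda>a. a mod int m)"

definition heisenberg_group :: "nat \<Rightarrow> (int^3^3) monoid" where
  "heisenberg_group m =
     \<lparr>carrier = {heis_matrix i j k | i j k.
                   i \<in> {0..<int m} \<and> j \<in> {0..<int m} \<and> k \<in> {0..<int m}},
      monoid.mult = (\<lambda>A B. reduce_matrix m (A ** B)),
      one = reduce_matrix m (mat 1)\<rparr>"

definition heisenberg_steps :: "nat \<Rightarrow> (int^3^3) set" where
  "heisenberg_steps m = reduce_matrix m `
     {mat 1, heis_matrix 1 0 0, heis_matrix (-1) 0 0, heis_matrix 0 1 0, heis_matrix 0 (-1) 0}"

definition heisenberg_walk :: "nat \<Rightarrow> (int^3^3) random_walk" where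
  "heisenberg_walk m = (heisenberg_group m, uniform_prob (heisenberg_steps m))"

end

theory Submission
  imports Defs "HOL-Real_Asymp.Real_Asymp"
begin

text \<open>Coordinate \<open>i\<close> of the \<open>n\<close>th product is the walk on the Heisenberg group mod \<open>i + 2\<close>, chosen with
  probability \<open>p\<^sub>i / q\<^sub>n\<close>. The slowest mode of that walk decays at a rate of order \<open>1 / i\<^sup>2\<close>, and the \<open>q\<^sub>n\<close>
  are bounded because the \<open>p\<^sub>i\<close> are summable, so in the product coordinate \<open>i\<close> relaxes on the time scale
  \<open>i\<^sup>2 / p\<^sub>i = exp (i powr \<gamma>)\<close>, up to bounded factors. The question is how many coordinates compete for
  the largest time scale \<open>exp (n powr \<gamma>)\<close>. If \<open>\<gamma> < 1\<close>, then \<open>n powr \<gamma> - (n - k) powr \<gamma>\<close> tends to \<open>0\<close> for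
  every \<open>k\<close>: more and more coordinates share it, and a product of many comparable walks has a cutoff.
  If \<open>\<gamma> \<ge> 1\<close>, the time scales grow at least geometrically, the last coordinates alone decide, and the
  distance decays gradually over multiples of \<open>exp (n powr \<gamma>)\<close>.

  The upper bounds condition on the numbers of moves made by the coordinates
  (\<open>convolve_power_product\<close>). Given these numbers, the coordinates are independent and the squared
  \<open>L\<^sup>2\<close> distances to uniformity multiply; by Chebyshev's inequality no coordinate moves much less than
  expected (\<open>tv_dist_product_le\<close>). The lower bounds test the distribution with eigenfunctions of the
  coordinate walks, one of them (\<open>tv_dist_product_ge_coordinate\<close>) or a combination of all
  (\<open>tv_dist_product_ge_second_moment\<close>).

  A Heisenberg walk is analysed by a Fourier transform along the center. A nontrivial central character
  turns it into a walk on a discrete torus whose two shifts commute up to a root of unity only; an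
  uncertainty principle (\<open>uncertainty\<close>) makes this walk contract at a rate of order \<open>1 / m\<close>, which is
  negligible at the times of order \<open>m\<^sup>2\<close> that matter. The trivial character gives an abelian walk with
  explicit eigenvalues. The result is \<open>l2_excess_le_crude\<close>, and for large \<open>m\<close> the bound
  \<open>l2_excess_le_sharp\<close>, which has the decay rate of the eigenfunction used for the lower bound.

  For \<open>\<gamma> < 1\<close> both bounds are governed by the sum of the squared modes \<open>exp (- (2 * decay n i * t))\<close>, and
  the cutoff time \<open>t\<close> is where this sum equals \<open>1\<close>. Replacing \<open>t\<close> by \<open>a * t\<close> changes each summand by a
  factor at least as extreme as \<open>exp (- (2 * (a - 1) * d * t))\<close>, with \<open>d\<close> the smallest of the decay
  rates, and \<open>d * t\<close> tends to infinity because the competing coordinates force \<open>t\<close> to be much larger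
  than \<open>exp (n powr \<gamma>)\<close> (\<open>cutoff_ratio_at_top\<close>). For \<open>\<gamma> \<ge> 1\<close> the distance at time \<open>c * exp (n powr \<gamma>)\<close> is
  small uniformly in \<open>n\<close> when \<open>c\<close> is large, but it is bounded below by a positive constant for each
  fixed \<open>c\<close>, so mixing times at different levels have a ratio that stays away from \<open>1\<close>
  (\<open>no_cutoff_separated\<close>).\<close>

section \<open>Random walks on finite groups\<close>

definition prob_on :: "'a set \<Rightarrow> ('a \<Rightarrow> real) \<Rightarrow> bool" where
  "prob_on A p \<longleftrightarrow> (\<forall>x\<in>A. 0 \<le> p x) \<and> sum p A = 1"

text \<open>The squared \<open>L\<^sup>2\<close> distance of the density with respect to the uniform distribution from the
  constant \<open>1\<close>. Adding \<open>1\<close> to it gives a quantity that is multiplicative for product measures.\<close>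

definition l2_excess :: "'a random_walk \<Rightarrow> nat \<Rightarrow> real" where
  "l2_excess W m =
     real (card (carrier (fst W))) * (\<Sum>x\<in>carrier (fst W). (convolve_power (fst W) (snd W) m x)\<^sup>2) - 1"

lemma convolve_eq_sum_right:
  assumes "group G" and x: "x \<in> carrier G"
  shows "convolve G P Q x = (\<Sum>y\<in>carrier G. Q y * P (x \<otimes>\<^bsub>G\<^esub> inv\<^bsub>G\<^esub> y))"
proof -
  interpret group G by fact
  have a: "inv\<^bsub>G\<^esub> (x \<otimes>\<^bsub>G\<^esub> inv\<^bsub>G\<^esub> y) \<otimes>\<^bsub>G\<^esub> x = y" if "y \<in> carrier G" for y
    using x that by (simp add: inv_mult_group m_assoc)
  have b: "x \<otimes>\<^bsub>G\<^esub> inv\<^bsub>G\<^esub> (inv\<^bsub>G\<^esub> z \<otimes>\<^bsub>G\<^esub> x) = z" if "z \<in> carrier G" for z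
    using x that by (simp add: inv_mult_group m_assoc[symmetric])
  show ?thesis unfolding convolve_def
    by (rule sum.reindex_bij_witness[where i = "\<lambda>y. x \<otimes>\<^bsub>G\<^esub> inv\<^bsub>G\<^esub> y" and j = "\<lambda>z. inv\<^bsub>G\<^esub> z \<otimes>\<^bsub>G\<^esub> x"])
      (auto simp: x a b mult.commute)
qed

lemma convolve_power_expectation_Suc:
  assumes "group G"
  shows "(\<Sum>x\<in>carrier G. convolve_power G Q (Suc m) x * f x)
       = (\<Sum>x\<in>carrier G. convolve_power G Q m x * (\<Sum>y\<in>carrier G. Q y * f (x \<otimes>\<^bsub>G\<^esub> y)))"
proof -
  interpret group G by fact
  have "(\<Sum>x\<in>carrier G. convolve_power G Q (Suc m) x * f x)
      = (\<Sum>x\<in>carrier G. \<Sum>z\<in>carrier G. convolve_power G Q m z * (Q (inv\<^bsub>G\<^esub> z \<otimes>\<^bsub>G\<^esub> x) * f x))"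
    by (simp add: convolve_def sum_distrib_right mult.assoc)
  also have "\<dots> = (\<Sum>z\<in>carrier G. convolve_power G Q m z * (\<Sum>x\<in>carrier G. Q (inv\<^bsub>G\<^esub> z \<otimes>\<^bsub>G\<^esub> x) * f x))"
    by (subst sum.swap) (simp add: sum_distrib_left)
  also have "\<dots> = (\<Sum>z\<in>carrier G. convolve_power G Q m z * (\<Sum>y\<in>carrier G. Q y * f (z \<otimes>\<^bsub>G\<^esub> y)))"
  proof (rule sum.cong[OF refl])
    fix z assume z: "z \<in> carrier G"
    have "(\<Sum>x\<in>carrier G. Q (inv\<^bsub>G\<^esub> z \<otimes>\<^bsub>G\<^esub> x) * f x) = (\<Sum>y\<in>carrier G. Q y * f (z \<otimes>\<^bsub>G\<^esub> y))"
      by (rule sum.reindex_bij_witness[where i = "\<lambda>y. z \<otimes>\<^bsub>G\<^esub> y" and j = "\<lambda>x. inv\<^bsub>G\<^esub> z \<otimes>\<^bsub>G\<^esub> x"])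
        (use z in \<open>auto simp: m_assoc[symmetric]\<close>)
    then show "convolve_power G Q m z * (\<Sum>x\<in>carrier G. Q (inv\<^bsub>G\<^esub> z \<otimes>\<^bsub>G\<^esub> x) * f x)
        = convolve_power G Q m z * (\<Sum>y\<in>carrier G. Q y * f (z \<otimes>\<^bsub>G\<^esub> y))"
      by simp
  qed
  finally show ?thesis .
qed

lemma prob_on_convolve_power:
  assumes "group G" "finite (carrier G)" "prob_on (carrier G) Q"
  shows "prob_on (carrier G) (convolve_power G Q m)"
proof (induction m)
  interpret group G by fact
  case 0
  show ?case using assms(2) by (simp add: prob_on_def)
next
  interpret group G by fact
  case (Suc m)
  have "(\<Sum>x\<in>carrier G. convolve_power G Q (Suc m) x * 1) = 1"
    using Suc assms(3) unfolding convolve_power_expectation_Suc[OF assms(1)]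
    by (simp add: prob_on_def)
  moreover have "0 \<le> convolve_power G Q (Suc m) x" if "x \<in> carrier G" for x
    using Suc assms(3) that
    by (auto simp: prob_on_def convolve_def intro!: sum_nonneg mult_nonneg_nonneg)
  ultimately show ?case by (simp add: prob_on_def)
qed

lemma eigenfunction_expectation:
  assumes "group G" "finite (carrier G)"
    and eig: "\<And>x. x \<in> carrier G \<Longrightarrow> (\<Sum>y\<in>carrier G. Q y * f (x \<otimes>\<^bsub>G\<^esub> y)) = b * f x"
  shows "(\<Sum>x\<in>carrier G. convolve_power G Q m x * f x) = b ^ m * f \<one>\<^bsub>G\<^esub>"
proof (induction m)
  interpret group G by fact
  case 0
  have "(\<Sum>x\<in>carrier G. convolve_power G Q 0 x * f x)
      = (\<Sum>x\<in>carrier G. if x = \<one>\<^bsub>G\<^esub> then f x else 0)"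
    by (intro sum.cong) auto
  also have "\<dots> = f \<one>\<^bsub>G\<^esub>" using assms(2) by simp
  finally show ?case by simp
next
  case (Suc m)
  have "(\<Sum>x\<in>carrier G. convolve_power G Q (Suc m) x * f x)
      = (\<Sum>x\<in>carrier G. b * (convolve_power G Q m x * f x))"
    unfolding convolve_power_expectation_Suc[OF assms(1)] by (intro sum.cong) (auto simp: eig)
  then show ?case using Suc by (simp flip: sum_distrib_left)
qed

text \<open>The uniform distribution is stationary, so it integrates an eigenfunction and its image under
  the walk to the same value.\<close>

lemma eigenfunction_sum_zero:
  assumes "group G" "finite (carrier G)" "prob_on (carrier G) Q"
    and eig: "\<And>x. x \<in> carrier G \<Longrightarrow> (\<Sum>y\<in>carrier G. Q y * f (x \<otimes>\<^bsub>G\<^esub> y)) = b * f x"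
    and b: "b \<noteq> 1"
  shows "(\<Sum>x\<in>carrier G. f x) = 0"
proof -
  interpret group G by fact
  have shift: "(\<Sum>x\<in>carrier G. f (x \<otimes>\<^bsub>G\<^esub> y)) = (\<Sum>x\<in>carrier G. f x)" if y: "y \<in> carrier G" for y
    by (rule sum.reindex_bij_witness[where i = "\<lambda>x. x \<otimes>\<^bsub>G\<^esub> inv\<^bsub>G\<^esub> y" and j = "\<lambda>x. x \<otimes>\<^bsub>G\<^esub> y"])
      (use y in \<open>auto simp: m_assoc\<close>)
  have "b * (\<Sum>x\<in>carrier G. f x) = (\<Sum>x\<in>carrier G. \<Sum>y\<in>carrier G. Q y * f (x \<otimes>\<^bsub>G\<^esub> y))"
    by (simp add: eig sum_distrib_left)
  also have "\<dots> = (\<Sum>y\<in>carrier G. Q y * (\<Sum>x\<in>carrier G. f (x \<otimes>\<^bsub>G\<^esub> y)))"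
    by (subst sum.swap) (simp add: sum_distrib_left)
  also have "\<dots> = (\<Sum>y\<in>carrier G. Q y) * (\<Sum>x\<in>carrier G. f x)"
    by (simp add: shift sum_distrib_right)
  also have "\<dots> = (\<Sum>x\<in>carrier G. f x)" using assms(3) by (simp add: prob_on_def)
  finally show ?thesis using b by simp
qed

lemma prob_on_sum_subset:
  assumes "prob_on A p" "finite A" "B \<subseteq> A"
  shows "0 \<le> sum p B" "sum p B \<le> 1"
  using assms sum_mono2[of A B p] by (auto simp: prob_on_def intro!: sum_nonneg)

lemma prob_on_uniform:
  "finite A \<Longrightarrow> A \<noteq> {} \<Longrightarrow> prob_on A (uniform_prob A)"
  by (simp add: prob_on_def uniform_prob_def)

lemma tv_dist_ge_event:
  assumes "finite (carrier G)" "B \<subseteq> carrier G"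
  shows "(\<Sum>x\<in>B. convolve_power G Q m x) - (\<Sum>x\<in>B. uniform_prob (carrier G) x) \<le> tv_dist (G, Q) m"
  unfolding tv_dist_def using assms by (auto intro!: Max_ge)

lemma tv_dist_le:
  assumes "finite (carrier G)"
    and "\<And>B. B \<subseteq> carrier G \<Longrightarrow>
      (\<Sum>x\<in>B. convolve_power G Q m x) - (\<Sum>x\<in>B. uniform_prob (carrier G) x) \<le> c"
  shows "tv_dist (G, Q) m \<le> c"
  unfolding tv_dist_def using assms by (auto intro!: Max.boundedI)

text \<open>For a test function with values in \<open>[-1, 1]\<close> the extreme cases are the differences of the
  indicators of an event and of its complement; hence the factor \<open>2\<close>.\<close>

lemma tv_dist_ge_test:
  assumes "group G" "finite (carrier G)" "prob_on (carrier G) Q"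
    and f: "\<And>x. x \<in> carrier G \<Longrightarrow> \<bar>f x\<bar> \<le> 1"
    and zero: "(\<Sum>x\<in>carrier G. f x) = 0"
  shows "(\<Sum>x\<in>carrier G. convolve_power G Q m x * f x) \<le> 2 * tv_dist (G, Q) m"
proof -
  interpret group G by fact
  define P U where "P = convolve_power G Q m" and "U = uniform_prob (carrier G)"
  define B where "B = {x\<in>carrier G. P x \<ge> U x}"
  have B: "B \<subseteq> carrier G" by (auto simp: B_def)
  have P1: "sum P (carrier G) = 1"
    using prob_on_convolve_power[OF assms(1-3)] by (simp add: P_def prob_on_def)
  have U1: "sum U (carrier G) = 1"
    using prob_on_uniform[of "carrier G"] assms(2) one_closed by (auto simp: U_def prob_on_def)
  have "(\<Sum>x\<in>carrier G. U x * f x) = (\<Sum>x\<in>carrier G. f x / card (carrier G))"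
    by (intro sum.cong) (auto simp: U_def uniform_prob_def)
  then have U0: "(\<Sum>x\<in>carrier G. U x * f x) = 0"
    using zero by (simp flip: sum_divide_distrib)
  have "(\<Sum>x\<in>carrier G. P x * f x) = (\<Sum>x\<in>carrier G. (P x - U x) * f x)"
    using U0 by (simp add: left_diff_distrib sum_subtractf)
  also have "\<dots> \<le> (\<Sum>x\<in>carrier G. \<bar>P x - U x\<bar>)"
  proof (intro sum_mono)
    fix x assume "x \<in> carrier G"
    then have "\<bar>P x - U x\<bar> * \<bar>f x\<bar> \<le> \<bar>P x - U x\<bar> * 1" by (intro mult_left_mono f) auto
    then show "(P x - U x) * f x \<le> \<bar>P x - U x\<bar>" by (simp flip: abs_mult)
  qed
  also have "\<dots> = (\<Sum>x\<in>B. P x - U x) + (\<Sum>x\<in>carrier G - B. U x - P x)"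
  proof -
    have "(\<Sum>x\<in>carrier G. \<bar>P x - U x\<bar>) = (\<Sum>x\<in>carrier G - B. \<bar>P x - U x\<bar>) + (\<Sum>x\<in>B. \<bar>P x - U x\<bar>)"
      by (rule sum.subset_diff[OF B assms(2)])
    also have "(\<Sum>x\<in>carrier G - B. \<bar>P x - U x\<bar>) = (\<Sum>x\<in>carrier G - B. U x - P x)"
      by (rule sum.cong) (auto simp: B_def)
    also have "(\<Sum>x\<in>B. \<bar>P x - U x\<bar>) = (\<Sum>x\<in>B. P x - U x)"
      by (rule sum.cong) (auto simp: B_def)
    finally show ?thesis by simp
  qed
  also have "(\<Sum>x\<in>carrier G - B. U x - P x) = (\<Sum>x\<in>B. P x - U x)"
    using P1 U1 sum.subset_diff[OF B assms(2), of P] sum.subset_diff[OF B assms(2), of U]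
    by (simp add: sum_subtractf)
  also have "(\<Sum>x\<in>B. P x - U x) + (\<Sum>x\<in>B. P x - U x) \<le> 2 * tv_dist (G, Q) m"
    using tv_dist_ge_event[OF assms(2) B, of Q m] by (simp add: sum_subtractf P_def U_def)
  finally show ?thesis by (simp add: P_def)
qed

lemma chebyshev_sum:
  fixes p F :: "'a \<Rightarrow> real"
  assumes "finite A" "prob_on A p"
    and mean: "(\<Sum>x\<in>A. p x * F x) = \<mu>"
    and second: "(\<Sum>x\<in>A. p x * (F x)\<^sup>2) \<le> \<mu>\<^sup>2 + V"
    and d: "d > 0" and B: "B \<subseteq> A" "\<And>x. x \<in> B \<Longrightarrow> d \<le> \<bar>F x - \<mu>\<bar>"
  shows "sum p B \<le> V / d\<^sup>2"
proof -
  have "d\<^sup>2 * sum p B = (\<Sum>x\<in>B. p x * d\<^sup>2)" by (simp add: sum_distrib_right mult.commute[of "d\<^sup>2"])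
  also have "\<dots> \<le> (\<Sum>x\<in>B. p x * (F x - \<mu>)\<^sup>2)"
  proof (intro sum_mono mult_left_mono)
    fix x assume x: "x \<in> B"
    show "d\<^sup>2 \<le> (F x - \<mu>)\<^sup>2" using B(2)[OF x] d by (metis abs_le_square_iff abs_of_pos)
    show "0 \<le> p x" using x B(1) assms(2) by (auto simp: prob_on_def)
  qed
  also have "\<dots> \<le> (\<Sum>x\<in>A. p x * (F x - \<mu>)\<^sup>2)"
    using assms(1,2) B(1) by (intro sum_mono2) (auto simp: prob_on_def)
  also have "\<dots> = (\<Sum>x\<in>A. p x * (F x)\<^sup>2 + \<mu>\<^sup>2 * p x - 2 * \<mu> * (p x * F x))"
    by (intro sum.cong) (auto simp: power2_eq_square algebra_simps)
  also have "\<dots> = (\<Sum>x\<in>A. p x * (F x)\<^sup>2) + \<mu>\<^sup>2 * (\<Sum>x\<in>A. p x) - 2 * \<mu> * (\<Sum>x\<in>A. p x * F x)"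
    by (simp add: sum.distrib sum_subtractf sum_distrib_left)
  also have "\<dots> \<le> V" using second mean assms(2) by (simp add: prob_on_def power2_eq_square)
  finally show ?thesis using d by (simp add: field_simps)
qed

text \<open>Cauchy--Schwarz against the indicator of the event.\<close>

lemma event_excess_le_l2:
  fixes p :: "'a \<Rightarrow> real"
  assumes "finite A" "A \<noteq> {}" "prob_on A p" "B \<subseteq> A"
  shows "(\<Sum>x\<in>B. p x - 1 / card A) \<le> sqrt (card A * (\<Sum>x\<in>A. (p x)\<^sup>2) - 1)"
proof -
  define n where "n = real (card A)"
  have n: "n > 0" using assms(1,2) by (auto simp: n_def card_gt_0_iff)
  have fB: "finite B" using assms(1,4) finite_subset by auto
  have "(\<Sum>x\<in>B. p x - 1 / n)\<^sup>2 \<le> card B * (\<Sum>x\<in>B. (p x - 1 / n)\<^sup>2)"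
    using Cauchy_Schwarz_ineq_sum[of "\<lambda>_. 1" "\<lambda>x. p x - 1 / n" B] by simp
  also have "\<dots> \<le> n * (\<Sum>x\<in>A. (p x - 1 / n)\<^sup>2)"
    using assms(1,4) n by (intro mult_mono sum_mono2) (auto simp: n_def card_mono sum_nonneg)
  also have "(\<Sum>x\<in>A. (p x - 1 / n)\<^sup>2) = (\<Sum>x\<in>A. (p x)\<^sup>2 + (1 / n)\<^sup>2 - 2 / n * p x)"
    by (intro sum.cong) (auto simp: power2_eq_square algebra_simps)
  also have "\<dots> = (\<Sum>x\<in>A. (p x)\<^sup>2) + n * (1 / n)\<^sup>2 - 2 / n * (\<Sum>x\<in>A. p x)"
    by (simp add: sum.distrib sum_subtractf sum_distrib_left n_def)
  also have "n * \<dots> = n * (\<Sum>x\<in>A. (p x)\<^sup>2) - 1"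
    using n assms(3) by (simp add: prob_on_def field_simps power2_eq_square)
  finally show ?thesis by (simp add: n_def real_le_rsqrt)
qed

section \<open>Products of random walks\<close>

text \<open>The expectation of a function of multinomial counts: \<open>N i\<close> is the number of times that \<open>i\<close> has been
  drawn in \<open>m\<close> independent draws from \<open>r\<close>. Defining the functional directly by conditioning on one draw
  reduces its properties to short inductions that avoid multinomial coefficients.\<close>

primrec multinomial_mean :: "'i set \<Rightarrow> ('i \<Rightarrow> real) \<Rightarrow> nat \<Rightarrow> (('i \<Rightarrow> nat) \<Rightarrow> real) \<Rightarrow> real" where
  "multinomial_mean I r 0 g = g (\<lambda>_. 0)"
| "multinomial_mean I r (Suc m) g =
     (\<Sum>i\<in>I. r i * multinomial_mean I r m (\<lambda>N. g (N(i := Suc (N i)))))"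

lemma multinomial_mean_const:
  "sum r I = 1 \<Longrightarrow> multinomial_mean I r m (\<lambda>_. c) = c"
  by (induction m) (auto simp flip: sum_distrib_right)

lemma multinomial_mean_sum:
  "multinomial_mean I r m (\<lambda>N. \<Sum>a\<in>A. c a * g a N) = (\<Sum>a\<in>A. c a * multinomial_mean I r m (g a))"
proof (induction m arbitrary: g)
  case (Suc m)
  show ?case
    by (simp add: Suc sum_distrib_left mult.left_commute) (rule sum.swap)
qed simp

lemma multinomial_mean_add:
  "multinomial_mean I r m (\<lambda>N. f N + g N) = multinomial_mean I r m f + multinomial_mean I r m g"
  by (induction m arbitrary: f g) (simp_all add: sum.distrib distrib_left)

lemma multinomial_mean_mono:
  assumes "\<And>i. i \<in> I \<Longrightarrow> 0 \<le> r i" "\<And>N. f N \<le> g N"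
  shows "multinomial_mean I r m f \<le> multinomial_mean I r m g"
  using assms(2)
  by (induction m arbitrary: f g) (auto intro!: sum_mono mult_left_mono assms(1))

text \<open>The centre \<open>c\<close> is arbitrary because a draw of \<open>k\<close> shifts it by one in the induction. The mean of
  \<open>N k\<close> is \<open>m * r k\<close>, and this centre leaves the variance.\<close>

lemma multinomial_mean_coord_variance:
  assumes "finite I" "sum r I = 1" "k \<in> I"
  shows "multinomial_mean I r m (\<lambda>N. (real (N k) - c)\<^sup>2) = m * r k * (1 - r k) + (m * r k - c)\<^sup>2"
proof (induction m arbitrary: c)
  case (Suc m)
  let ?M = "\<lambda>c. multinomial_mean I r m (\<lambda>N. (real (N k) - c)\<^sup>2)"
  have rest: "sum r (I - {k}) = 1 - r k"
    using assms by (simp add: sum_diff1)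
  have "multinomial_mean I r (Suc m) (\<lambda>N. (real (N k) - c)\<^sup>2)
      = r k * multinomial_mean I r m (\<lambda>N. (real (Suc (N k)) - c)\<^sup>2)
        + (\<Sum>i\<in>I - {k}. r i * multinomial_mean I r m (\<lambda>N. (real ((N(i := Suc (N i))) k) - c)\<^sup>2))"
    using assms by (simp add: sum.remove[OF assms(1,3)])
  also have "(\<Sum>i\<in>I - {k}. r i * multinomial_mean I r m (\<lambda>N. (real ((N(i := Suc (N i))) k) - c)\<^sup>2))
      = (\<Sum>i\<in>I - {k}. r i * ?M c)"
    by (intro sum.cong) auto
  also have "\<dots> = (1 - r k) * ?M c" by (simp add: rest flip: sum_distrib_right)
  also have "multinomial_mean I r m (\<lambda>N. (real (Suc (N k)) - c)\<^sup>2) = ?M (c - 1)"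
    by (simp add: algebra_simps)
  finally show ?case unfolding Suc by (simp add: power2_eq_square algebra_simps)
qed simp

locale walk_product =
  fixes I :: "'i set" and W :: "'i \<Rightarrow> 'a random_walk" and r :: "'i \<Rightarrow> real"
  assumes finite_I: "finite I"
    and group_G: "i \<in> I \<Longrightarrow> group (fst (W i))"
    and finite_G: "i \<in> I \<Longrightarrow> finite (carrier (fst (W i)))"
    and prob_Q: "i \<in> I \<Longrightarrow> prob_on (carrier (fst (W i))) (snd (W i))"
    and r_pos: "i \<in> I \<Longrightarrow> 0 < r i"
    and sum_r: "sum r I = 1"
begin

abbreviation "G i \<equiv> fst (W i)"
abbreviation "Q i \<equiv> snd (W i)"
abbreviation "PG \<equiv> product_group I G"
abbreviation "PQ \<equiv> snd (product_walk I W r)"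
abbreviation "emb \<equiv> coord_embed I G"

lemma product_walk_eq: "product_walk I W r = (PG, PQ)"
  by (simp add: product_walk_def Let_def)

lemma PQ_eq: "PQ y = (\<Sum>i\<in>I. r i * (\<Sum>x | x \<in> carrier (G i) \<and> emb i x = y. Q i x))"
  by (simp add: product_walk_def Let_def)

lemma group_PG: "group PG"
  using group_G by simp

lemma finite_PG: "finite (carrier PG)"
  using finite_I finite_G by (simp add: finite_PiE)

lemma card_PG: "card (carrier PG) = (\<Prod>i\<in>I. card (carrier (G i)))"
  using finite_I by (simp add: card_PiE)

lemma emb_carrier: "i \<in> I \<Longrightarrow> x \<in> carrier (G i) \<Longrightarrow> emb i x \<in> carrier PG"
  using group_G by (auto simp: coord_embed_def group.is_monoid)

text \<open>One step of the product walk: choose a coordinate, then move it.\<close>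

lemma sum_PQ:
  "(\<Sum>y\<in>carrier PG. PQ y * f y) = (\<Sum>i\<in>I. r i * (\<Sum>x\<in>carrier (G i). Q i x * f (emb i x)))"
proof -
  have "(\<Sum>y\<in>carrier PG. PQ y * f y)
      = (\<Sum>y\<in>carrier PG. \<Sum>i\<in>I. r i * (\<Sum>x | x \<in> carrier (G i) \<and> emb i x = y. Q i x * f (emb i x)))"
    by (simp add: PQ_eq sum_distrib_right mult.assoc)
  also have "\<dots> = (\<Sum>i\<in>I. r i * (\<Sum>y\<in>carrier PG. \<Sum>x | x \<in> carrier (G i) \<and> emb i x = y. Q i x * f (emb i x)))"
    by (subst sum.swap) (simp add: sum_distrib_left)
  also have "\<dots> = (\<Sum>i\<in>I. r i * (\<Sum>x\<in>carrier (G i). Q i x * f (emb i x)))"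
  proof (rule sum.cong[OF refl])
    fix i assume i: "i \<in> I"
    have "(\<Sum>y\<in>carrier PG. \<Sum>x | x \<in> carrier (G i) \<and> emb i x = y. Q i x * f (emb i x))
        = (\<Sum>x\<in>carrier (G i). Q i x * f (emb i x))"
      using emb_carrier[OF i] by (intro sum.group finite_G[OF i] finite_PG) blast
    then show "r i * (\<Sum>y\<in>carrier PG. \<Sum>x | x \<in> carrier (G i) \<and> emb i x = y. Q i x * f (emb i x))
        = r i * (\<Sum>x\<in>carrier (G i). Q i x * f (emb i x))" by (simp only:)
  qed
  finally show ?thesis .
qed

lemma prob_PQ: "prob_on (carrier PG) PQ"
proof -
  have "(\<Sum>y\<in>carrier PG. PQ y * 1) = 1"
    using prob_Q sum_r unfolding sum_PQ by (simp add: prob_on_def)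
  moreover have "0 \<le> PQ y" for y
    unfolding PQ_eq using prob_Q r_pos
    by (auto simp: prob_on_def less_imp_le intro!: sum_nonneg mult_nonneg_nonneg)
  ultimately show ?thesis by (simp add: prob_on_def)
qed

lemma PG_mult_emb:
  assumes "i \<in> I" "x \<in> carrier PG" "g \<in> carrier (G i)"
  shows "x \<otimes>\<^bsub>PG\<^esub> emb i g = x(i := x i \<otimes>\<^bsub>G i\<^esub> g)"
proof
  fix j
  show "(x \<otimes>\<^bsub>PG\<^esub> emb i g) j = (x(i := x i \<otimes>\<^bsub>G i\<^esub> g)) j"
  proof (cases "j \<in> I")
    case True
    interpret group "G j" using group_G True .
    show ?thesis using assms True by (auto simp: coord_embed_def PiE_iff)
  next
    case False
    then show ?thesis using assms by (auto simp: PiE_iff extensional_def)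
  qed
qed

lemma inv_emb:
  assumes "i \<in> I" "g \<in> carrier (G i)"
  shows "inv\<^bsub>PG\<^esub> (emb i g) = emb i (inv\<^bsub>G i\<^esub> g)"
proof -
  have "inv\<^bsub>PG\<^esub> (emb i g) = (\<lambda>j\<in>I. inv\<^bsub>G j\<^esub> (emb i g j))"
    using emb_carrier[OF assms] group_G by (intro inv_product_group) auto
  also have "\<dots> = emb i (inv\<^bsub>G i\<^esub> g)"
    using group_G by (auto simp: coord_embed_def fun_eq_iff group.is_monoid monoid.inv_one)
  finally show ?thesis .
qed

text \<open>The coordinates move independently once it is known how often each of them has been chosen,
  and these numbers have a multinomial distribution.\<close>

lemma convolve_power_product:
  assumes "x \<in> carrier PG"
  shows "convolve_power PG PQ m x
    = multinomial_mean I r m (\<lambda>N. \<Prod>i\<in>I. convolve_power (G i) (Q i) (N i) (x i))"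
  using assms
proof (induction m arbitrary: x)
  case 0
  have "x = \<one>\<^bsub>PG\<^esub> \<longleftrightarrow> (\<forall>i\<in>I. x i = \<one>\<^bsub>G i\<^esub>)"
    using 0 by (auto simp: PiE_iff fun_eq_iff extensional_def)
  moreover have "(\<Prod>i\<in>I. if x i = \<one>\<^bsub>G i\<^esub> then 1 else 0 :: real) = (if \<forall>i\<in>I. x i = \<one>\<^bsub>G i\<^esub> then 1 else 0)"
    using finite_I by (auto intro!: prod_zero)
  ultimately show ?case by simp
next
  case (Suc m)
  let ?P = "\<lambda>i k. convolve_power (G i) (Q i) k"
  have "convolve_power PG PQ (Suc m) x
      = (\<Sum>y\<in>carrier PG. PQ y * convolve_power PG PQ m (x \<otimes>\<^bsub>PG\<^esub> inv\<^bsub>PG\<^esub> y))"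
    using convolve_eq_sum_right[OF group_PG Suc.prems] by simp
  also have "\<dots> = (\<Sum>i\<in>I. r i * (\<Sum>g\<in>carrier (G i). Q i g * convolve_power PG PQ m (x \<otimes>\<^bsub>PG\<^esub> inv\<^bsub>PG\<^esub> (emb i g))))"
    by (rule sum_PQ)
  also have "\<dots> = (\<Sum>i\<in>I. r i * multinomial_mean I r m
                 (\<lambda>N. \<Prod>j\<in>I. ?P j ((N(i := Suc (N i))) j) (x j)))"
  proof (rule sum.cong[OF refl])
    fix i assume i: "i \<in> I"
    interpret Gi: group "G i" using group_G i .
    have xi: "x i \<in> carrier (G i)" using Suc.prems i by auto
    have "(\<Sum>g\<in>carrier (G i). Q i g * convolve_power PG PQ m (x \<otimes>\<^bsub>PG\<^esub> inv\<^bsub>PG\<^esub> (emb i g)))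
        = (\<Sum>g\<in>carrier (G i). Q i g * multinomial_mean I r m
            (\<lambda>N. \<Prod>j\<in>I. ?P j (N j) ((x(i := x i \<otimes>\<^bsub>G i\<^esub> inv\<^bsub>G i\<^esub> g)) j)))"
    proof (rule sum.cong[OF refl])
      fix g assume g: "g \<in> carrier (G i)"
      have "x \<otimes>\<^bsub>PG\<^esub> inv\<^bsub>PG\<^esub> (emb i g) = x(i := x i \<otimes>\<^bsub>G i\<^esub> inv\<^bsub>G i\<^esub> g)"
        using PG_mult_emb[OF i Suc.prems] g i by (simp add: inv_emb del: mult_product_group)
      moreover have "x(i := x i \<otimes>\<^bsub>G i\<^esub> inv\<^bsub>G i\<^esub> g) \<in> carrier PG"
        using Suc.prems i g xi by (auto simp: PiE_iff extensional_def)
      ultimately have "convolve_power PG PQ m (x \<otimes>\<^bsub>PG\<^esub> inv\<^bsub>PG\<^esub> (emb i g)) = multinomial_mean I r m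
            (\<lambda>N. \<Prod>j\<in>I. ?P j (N j) ((x(i := x i \<otimes>\<^bsub>G i\<^esub> inv\<^bsub>G i\<^esub> g)) j))"
        by (simp only: Suc.IH)
      then show "Q i g * convolve_power PG PQ m (x \<otimes>\<^bsub>PG\<^esub> inv\<^bsub>PG\<^esub> (emb i g))
        = Q i g * multinomial_mean I r m
            (\<lambda>N. \<Prod>j\<in>I. ?P j (N j) ((x(i := x i \<otimes>\<^bsub>G i\<^esub> inv\<^bsub>G i\<^esub> g)) j))"
        by (simp only:)
    qed
    also have "\<dots> = multinomial_mean I r m (\<lambda>N. \<Sum>g\<in>carrier (G i). Q i g *
            (\<Prod>j\<in>I. ?P j (N j) ((x(i := x i \<otimes>\<^bsub>G i\<^esub> inv\<^bsub>G i\<^esub> g)) j)))"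
      by (rule multinomial_mean_sum[symmetric])
    also have "\<dots> = multinomial_mean I r m (\<lambda>N. \<Prod>j\<in>I. ?P j ((N(i := Suc (N i))) j) (x j))"
    proof (rule arg_cong[where f = "multinomial_mean I r m"], rule ext)
      fix N :: "'i \<Rightarrow> nat"
      have *: "(\<Prod>j\<in>I - {i}. ?P j (N j) ((x(i := y)) j)) = (\<Prod>j\<in>I - {i}. ?P j (N j) (x j))" for y
        by (rule prod.cong) auto
      have **: "(\<Prod>j\<in>I - {i}. ?P j ((N(i := k)) j) (x j)) = (\<Prod>j\<in>I - {i}. ?P j (N j) (x j))" for k
        by (rule prod.cong) auto
      have "(\<Prod>j\<in>I. ?P j ((N(i := Suc (N i))) j) (x j))
          = ?P i (Suc (N i)) (x i) * (\<Prod>j\<in>I - {i}. ?P j (N j) (x j))"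
        unfolding prod.remove[OF finite_I i] ** by (simp only: fun_upd_same)
      also have "?P i (Suc (N i)) (x i)
          = (\<Sum>g\<in>carrier (G i). Q i g * ?P i (N i) (x i \<otimes>\<^bsub>G i\<^esub> inv\<^bsub>G i\<^esub> g))"
        unfolding convolve_power.simps by (rule convolve_eq_sum_right[OF Gi.is_group xi])
      also have "\<dots> * (\<Prod>j\<in>I - {i}. ?P j (N j) (x j))
          = (\<Sum>g\<in>carrier (G i). Q i g * (\<Prod>j\<in>I. ?P j (N j) ((x(i := x i \<otimes>\<^bsub>G i\<^esub> inv\<^bsub>G i\<^esub> g)) j)))"
        unfolding prod.remove[OF finite_I i] * by (simp add: sum_distrib_right mult.assoc)
      finally show "(\<Sum>g\<in>carrier (G i). Q i g * (\<Prod>j\<in>I. ?P j (N j) ((x(i := x i \<otimes>\<^bsub>G i\<^esub> inv\<^bsub>G i\<^esub> g)) j)))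
          = (\<Prod>j\<in>I. ?P j ((N(i := Suc (N i))) j) (x j))" by simp
    qed
    finally show "r i * (\<Sum>g\<in>carrier (G i). Q i g * convolve_power PG PQ m (x \<otimes>\<^bsub>PG\<^esub> inv\<^bsub>PG\<^esub> (emb i g)))
        = r i * multinomial_mean I r m (\<lambda>N. \<Prod>j\<in>I. ?P j ((N(i := Suc (N i))) j) (x j))" by simp
  qed
  finally show ?case by simp
qed

lemma l2_excess_nonneg:
  assumes "i \<in> I" shows "0 \<le> l2_excess (W i) k"
proof -
  interpret group "G i" using group_G assms .
  have "0 \<le> sqrt (l2_excess (W i) k)"
    using event_excess_le_l2[of "carrier (G i)" "convolve_power (G i) (Q i) k" "{}"]
      prob_on_convolve_power[OF group_G finite_G prob_Q, OF assms assms assms] finite_G[OF assms]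
      one_closed
    unfolding l2_excess_def by auto
  then show ?thesis by simp
qed

text \<open>Given the numbers of moves \<open>N\<close>, the law is a product measure: its squared \<open>L\<^sup>2\<close> norm is a product,
  and \<open>1 + a \<le> exp a\<close> turns it into the exponential of a sum. The trivial bound \<open>1\<close> serves for
  those \<open>N\<close> for which no bound on the \<open>L\<^sup>2\<close> distances is available.\<close>

lemma conditional_event_excess:
  assumes B: "B \<subseteq> carrier PG"
  shows "(\<Sum>x\<in>B. (\<Prod>i\<in>I. convolve_power (G i) (Q i) (N i) (x i)) - 1 / card (carrier PG)) \<le> 1"
    and "(\<And>i. i \<in> I \<Longrightarrow> l2_excess (W i) (N i) \<le> A i) \<Longrightarrow>
      (\<Sum>x\<in>B. (\<Prod>i\<in>I. convolve_power (G i) (Q i) (N i) (x i)) - 1 / card (carrier PG))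
        \<le> sqrt (exp (sum A I) - 1)"
proof -
  interpret group PG by (rule group_PG)
  define p where "p x = (\<Prod>i\<in>I. convolve_power (G i) (Q i) (N i) (x i))" for x
  have pr: "prob_on (carrier (G i)) (convolve_power (G i) (Q i) (N i))" if "i \<in> I" for i
    using prob_on_convolve_power[OF group_G finite_G prob_Q, OF that that that] .
  have "sum p (carrier PG) = (\<Prod>i\<in>I. \<Sum>y\<in>carrier (G i). convolve_power (G i) (Q i) (N i) y)"
    unfolding p_def using finite_I finite_G by (simp add: prod_sum_PiE)
  also have "\<dots> = 1" using pr by (simp add: prob_on_def)
  finally have p1: "sum p (carrier PG) = 1" .
  have prp: "prob_on (carrier PG) p"
    unfolding prob_on_def p1 using pr
    by (auto simp: p_def prob_on_def PiE_iff intro!: prod_nonneg)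
  have "(\<Sum>x\<in>B. p x - 1 / card (carrier PG)) \<le> sum p B" by (intro sum_mono) simp
  also have "\<dots> \<le> 1" by (rule prob_on_sum_subset(2)[OF prp finite_PG B])
  finally show "(\<Sum>x\<in>B. p x - 1 / card (carrier PG)) \<le> 1" .
  assume A: "\<And>i. i \<in> I \<Longrightarrow> l2_excess (W i) (N i) \<le> A i"
  have "card (carrier PG) * (\<Sum>x\<in>carrier PG. (p x)\<^sup>2)
      = (\<Prod>i\<in>I. 1 + l2_excess (W i) (N i))"
    unfolding card_PG p_def carrier_product_group prod_power_distrib
    using finite_I finite_G
    by (subst prod_sum_PiE[symmetric]) (auto simp: l2_excess_def prod.distrib card_PiE)
  also have "\<dots> \<le> (\<Prod>i\<in>I. exp (A i))"
  proof (intro prod_mono conjI)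
    fix i assume i: "i \<in> I"
    show "0 \<le> 1 + l2_excess (W i) (N i)" using l2_excess_nonneg[OF i, of "N i"] by simp
    show "1 + l2_excess (W i) (N i) \<le> exp (A i)"
      using A[OF i] exp_ge_add_one_self[of "A i"] by linarith
  qed
  also have "\<dots> = exp (sum A I)" using finite_I by (simp add: exp_sum)
  finally have le: "card (carrier PG) * (\<Sum>x\<in>carrier PG. (p x)\<^sup>2) \<le> exp (sum A I)" .
  have "(\<Sum>x\<in>B. p x - 1 / card (carrier PG))
      \<le> sqrt (card (carrier PG) * (\<Sum>x\<in>carrier PG. (p x)\<^sup>2) - 1)"
    using one_closed by (intro event_excess_le_l2[OF finite_PG _ prp B]) blast
  also have "\<dots> \<le> sqrt (exp (sum A I) - 1)" using le by simp
  finally show "(\<Sum>x\<in>B. p x - 1 / card (carrier PG)) \<le> sqrt (exp (sum A I) - 1)" .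
qed

text \<open>The first sum bounds, by Chebyshev's inequality, the probability that some coordinate has made less
  than \<open>1 - \<eta>\<close> times its expected number of moves; the second term is the distance when none has.\<close>

theorem tv_dist_product_le:
  assumes \<eta>: "0 < \<eta>" and m: "0 < m" and A0: "\<And>i. i \<in> I \<Longrightarrow> 0 \<le> A i"
    and A: "\<And>i k. i \<in> I \<Longrightarrow> (1 - \<eta>) * r i * real m \<le> real k \<Longrightarrow> l2_excess (W i) k \<le> A i"
  shows "tv_dist (product_walk I W r) m
    \<le> (\<Sum>i\<in>I. 1 / (\<eta>\<^sup>2 * r i * real m)) + sqrt (exp (sum A I) - 1)"
proof (subst product_walk_eq, rule tv_dist_le[OF finite_PG])
  fix B assume B: "B \<subseteq> carrier PG"
  let ?p = "\<lambda>N x. \<Prod>i\<in>I. convolve_power (G i) (Q i) (N i) (x i)"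
  let ?c = "1 / real (card (carrier PG))"
  let ?s = "sqrt (exp (sum A I) - 1)"
  let ?q = "\<lambda>i. 1 / (\<eta> * r i * real m)\<^sup>2"
  have s0: "0 \<le> ?s" using sum_nonneg[of I A] A0 by simp
  have "(\<Sum>x\<in>B. convolve_power PG PQ m x) - (\<Sum>x\<in>B. uniform_prob (carrier PG) x)
      = (\<Sum>x\<in>B. convolve_power PG PQ m x - uniform_prob (carrier PG) x)"
    by (rule sum_subtractf[symmetric])
  also have "\<dots> = (\<Sum>x\<in>B. 1 * multinomial_mean I r m (\<lambda>N. ?p N x - ?c))"
  proof (rule sum.cong[OF refl])
    fix x assume "x \<in> B"
    then have x: "x \<in> carrier PG" using B by blast
    have "multinomial_mean I r m (\<lambda>N. ?p N x - ?c) = multinomial_mean I r m (\<lambda>N. ?p N x) - ?c"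
      using multinomial_mean_add[of I r m "\<lambda>N. ?p N x" "\<lambda>_. - ?c"]
      by (simp only: multinomial_mean_const[OF sum_r] diff_conv_add_uminus)
    moreover have "uniform_prob (carrier PG) x = ?c" using x by (simp only: uniform_prob_def if_True)
    ultimately show "convolve_power PG PQ m x - uniform_prob (carrier PG) x
        = 1 * multinomial_mean I r m (\<lambda>N. ?p N x - ?c)"
      by (simp only: convolve_power_product[OF x] mult_1)
  qed
  also have "\<dots> = multinomial_mean I r m (\<lambda>N. \<Sum>x\<in>B. 1 * (?p N x - ?c))"
    by (rule multinomial_mean_sum[symmetric])
  also have "\<dots> \<le> multinomial_mean I r m (\<lambda>N. (\<Sum>i\<in>I. ?q i * (real (N i) - m * r i)\<^sup>2) + ?s)"
  proof (rule multinomial_mean_mono)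
    fix N :: "'i \<Rightarrow> nat"
    show "(\<Sum>x\<in>B. 1 * (?p N x - ?c)) \<le> (\<Sum>i\<in>I. ?q i * (real (N i) - m * r i)\<^sup>2) + ?s"
    proof (cases "\<forall>i\<in>I. (1 - \<eta>) * r i * real m \<le> real (N i)")
      case True
      then have "(\<Sum>x\<in>B. 1 * (?p N x - ?c)) \<le> ?s"
        using conditional_event_excess(2)[OF B, of N A] A by simp
      moreover have "0 \<le> (\<Sum>i\<in>I. ?q i * (real (N i) - m * r i)\<^sup>2)" by (intro sum_nonneg) auto
      ultimately show ?thesis by linarith
    next
      case False
      then obtain i where i: "i \<in> I" and less: "real (N i) < (1 - \<eta>) * r i * real m" by auto
      have pos: "0 < \<eta> * r i * m" using r_pos[OF i] \<eta> m by simp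
      have "\<eta> * r i * m \<le> m * r i - real (N i)" using less by (simp add: algebra_simps)
      then have "(\<eta> * r i * m)\<^sup>2 \<le> (m * r i - real (N i))\<^sup>2" using pos by (intro power_mono) auto
      then have "1 \<le> ?q i * (real (N i) - m * r i)\<^sup>2"
        using pos r_pos[OF i] \<eta> m by (simp add: power2_commute divide_simps)
      also have "\<dots> \<le> (\<Sum>i\<in>I. ?q i * (real (N i) - m * r i)\<^sup>2)"
        using finite_I i by (intro member_le_sum) auto
      finally have "1 \<le> (\<Sum>i\<in>I. ?q i * (real (N i) - m * r i)\<^sup>2)" .
      moreover have "(\<Sum>x\<in>B. 1 * (?p N x - ?c)) \<le> 1"
        using conditional_event_excess(1)[OF B, of N] by simp
      ultimately show ?thesis using s0 by linarith
    qed
  qed (use r_pos in \<open>auto intro: less_imp_le\<close>)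
  also have "\<dots> = (\<Sum>i\<in>I. ?q i * (m * r i * (1 - r i))) + ?s"
    unfolding multinomial_mean_add multinomial_mean_sum multinomial_mean_const[OF sum_r]
    using finite_I sum_r by (simp add: multinomial_mean_coord_variance)
  also have "(\<Sum>i\<in>I. ?q i * (m * r i * (1 - r i))) \<le> (\<Sum>i\<in>I. 1 / (\<eta>\<^sup>2 * r i * real m))"
  proof (rule sum_mono)
    fix i assume i: "i \<in> I"
    have "?q i * (m * r i * (1 - r i)) \<le> ?q i * (m * r i * 1)"
      using r_pos[OF i] by (intro mult_left_mono) auto
    also have "\<dots> = 1 / (\<eta>\<^sup>2 * r i * real m)"
      using r_pos[OF i] \<eta> m by (simp add: field_simps power2_eq_square)
    finally show "?q i * (m * r i * (1 - r i)) \<le> 1 / (\<eta>\<^sup>2 * r i * real m)" .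
  qed
  finally show "(\<Sum>x\<in>B. convolve_power PG PQ m x) - (\<Sum>x\<in>B. uniform_prob (carrier PG) x)
      \<le> (\<Sum>i\<in>I. 1 / (\<eta>\<^sup>2 * r i * real m)) + ?s" by simp
qed


text \<open>A product of eigenfunctions in distinct coordinates is an eigenfunction of the product walk. Only
  one coordinate moves at a time, so the rates \<open>r j * l j\<close> add up and the eigenvalues do not multiply.\<close>

lemma step_coordinate_product:
  assumes J: "J \<subseteq> I"
    and eig: "\<And>i x. i \<in> J \<Longrightarrow> x \<in> carrier (G i) \<Longrightarrow>
      (\<Sum>y\<in>carrier (G i). Q i y * \<phi> i (x \<otimes>\<^bsub>G i\<^esub> y)) = (1 - l i) * \<phi> i x"
    and x: "x \<in> carrier PG"
  shows "(\<Sum>y\<in>carrier PG. PQ y * (\<Prod>j\<in>J. \<phi> j ((x \<otimes>\<^bsub>PG\<^esub> y) j)))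
    = (1 - (\<Sum>j\<in>J. r j * l j)) * (\<Prod>j\<in>J. \<phi> j (x j))"
proof -
  have fJ: "finite J" using J finite_I finite_subset by blast
  let ?F = "\<lambda>x. \<Prod>j\<in>J. \<phi> j (x j)"
  have "(\<Sum>y\<in>carrier PG. PQ y * ?F (x \<otimes>\<^bsub>PG\<^esub> y))
      = (\<Sum>i\<in>I. r i * (\<Sum>g\<in>carrier (G i). Q i g * ?F (x \<otimes>\<^bsub>PG\<^esub> emb i g)))"
    by (rule sum_PQ)
  also have "\<dots> = (\<Sum>i\<in>I. r i * ((1 - (if i \<in> J then l i else 0)) * ?F x))"
  proof (rule sum.cong[OF refl])
    fix i assume i: "i \<in> I"
    have xi: "x i \<in> carrier (G i)" using x i by auto
    have "(\<Sum>g\<in>carrier (G i). Q i g * ?F (x \<otimes>\<^bsub>PG\<^esub> emb i g))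
        = (\<Sum>g\<in>carrier (G i). Q i g * ?F (x(i := x i \<otimes>\<^bsub>G i\<^esub> g)))"
      by (rule sum.cong[OF refl]) (simp only: PG_mult_emb[OF i x])
    also have "\<dots> = (1 - (if i \<in> J then l i else 0)) * ?F x"
    proof (cases "i \<in> J")
      case True
      have *: "(\<Prod>j\<in>J - {i}. \<phi> j ((x(i := y)) j)) = (\<Prod>j\<in>J - {i}. \<phi> j (x j))" for y
        by (rule prod.cong) auto
      have "(\<Sum>g\<in>carrier (G i). Q i g * ?F (x(i := x i \<otimes>\<^bsub>G i\<^esub> g)))
          = (\<Sum>g\<in>carrier (G i). Q i g * \<phi> i (x i \<otimes>\<^bsub>G i\<^esub> g)) * (\<Prod>j\<in>J - {i}. \<phi> j (x j))"
        unfolding prod.remove[OF fJ True] * by (simp add: sum_distrib_right mult.assoc)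
      also have "\<dots> = (1 - l i) * \<phi> i (x i) * (\<Prod>j\<in>J - {i}. \<phi> j (x j))"
        by (simp only: eig[OF True xi])
      finally show ?thesis unfolding prod.remove[OF fJ True] using True by simp
    next
      case False
      have "?F (x(i := y)) = ?F x" for y
        using False by (intro prod.cong) auto
      then show ?thesis using False prob_Q[OF i] by (simp add: prob_on_def flip: sum_distrib_right)
    qed
    finally show "r i * (\<Sum>g\<in>carrier (G i). Q i g * ?F (x \<otimes>\<^bsub>PG\<^esub> emb i g))
        = r i * ((1 - (if i \<in> J then l i else 0)) * ?F x)" by (simp only:)
  qed
  also have "\<dots> = (\<Sum>i\<in>I. r i * ?F x - (if i \<in> J then r i * l i * ?F x else 0))"
    by (intro sum.cong) (auto simp: algebra_simps)
  also have "\<dots> = (\<Sum>i\<in>I. r i) * ?F x - (\<Sum>j\<in>J. r j * l j * ?F x)"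
    using J finite_I by (simp add: sum_subtractf sum_distrib_right sum.inter_restrict[symmetric] Int_absorb1)
  also have "\<dots> = (1 - (\<Sum>j\<in>J. r j * l j)) * ?F x"
    by (simp add: sum_r left_diff_distrib sum_distrib_right)
  finally show ?thesis .
qed

context
  fixes \<phi> :: "'i \<Rightarrow> 'a \<Rightarrow> real" and l :: "'i \<Rightarrow> real"
  assumes eig: "\<And>i x. i \<in> I \<Longrightarrow> x \<in> carrier (G i) \<Longrightarrow>
      (\<Sum>y\<in>carrier (G i). Q i y * \<phi> i (x \<otimes>\<^bsub>G i\<^esub> y)) = (1 - l i) * \<phi> i x"
    and \<phi>_one: "\<And>i. i \<in> I \<Longrightarrow> \<phi> i \<one>\<^bsub>G i\<^esub> = 1"
    and \<phi>_bound: "\<And>i x. i \<in> I \<Longrightarrow> x \<in> carrier (G i) \<Longrightarrow> \<bar>\<phi> i x\<bar> \<le> 1"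
    and l_pos: "\<And>i. i \<in> I \<Longrightarrow> 0 < l i" and l_less: "\<And>i. i \<in> I \<Longrightarrow> l i < 1"
begin

lemma coordinate_product_expectation:
  assumes "J \<subseteq> I"
  shows "(\<Sum>x\<in>carrier PG. convolve_power PG PQ m x * (\<Prod>j\<in>J. \<phi> j (x j)))
    = (1 - (\<Sum>j\<in>J. r j * l j)) ^ m"
proof -
  have "(\<Sum>x\<in>carrier PG. convolve_power PG PQ m x * (\<Prod>j\<in>J. \<phi> j (x j)))
      = (1 - (\<Sum>j\<in>J. r j * l j)) ^ m * (\<Prod>j\<in>J. \<phi> j (\<one>\<^bsub>PG\<^esub> j))"
    by (rule eigenfunction_expectation[OF group_PG finite_PG step_coordinate_product])
      (use assms eig in auto)
  also have "(\<Prod>j\<in>J. \<phi> j (\<one>\<^bsub>PG\<^esub> j)) = 1"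
    using assms \<phi>_one by (intro prod.neutral) auto
  finally show ?thesis by simp
qed

lemma coordinate_product_sum_zero:
  assumes "J \<subseteq> I" "J \<noteq> {}"
  shows "(\<Sum>x\<in>carrier PG. \<Prod>j\<in>J. \<phi> j (x j)) = 0"
proof -
  have "0 < (\<Sum>j\<in>J. r j * l j)"
    using assms finite_I finite_subset r_pos l_pos by (intro sum_pos) auto
  then show ?thesis
    by (intro eigenfunction_sum_zero[OF group_PG finite_PG prob_PQ step_coordinate_product])
      (use assms eig in auto)
qed

theorem tv_dist_product_ge_coordinate:
  assumes i: "i \<in> I"
  shows "(1 - r i * l i) ^ m / 2 \<le> tv_dist (product_walk I W r) m"
proof -
  have "(\<Sum>x\<in>carrier PG. convolve_power PG PQ m x * \<phi> i (x i)) \<le> 2 * tv_dist (PG, PQ) m"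
  proof (rule tv_dist_ge_test[OF group_PG finite_PG prob_PQ])
    show "\<bar>\<phi> i (x i)\<bar> \<le> 1" if "x \<in> carrier PG" for x
      using that i by (intro \<phi>_bound) auto
    show "(\<Sum>x\<in>carrier PG. \<phi> i (x i)) = 0"
      using coordinate_product_sum_zero[of "{i}"] i by simp
  qed
  moreover have "(\<Sum>x\<in>carrier PG. convolve_power PG PQ m x * \<phi> i (x i)) = (1 - r i * l i) ^ m"
    using coordinate_product_expectation[of "{i}" m] i by simp
  ultimately show ?thesis by (subst product_walk_eq) simp
qed

text \<open>The test function is the combination \<open>F\<close> of the eigenfunctions weighted by their own decayed values
  \<open>c i\<close>, which makes the mean of \<open>F\<close> equal to \<open>S m\<close> while its variance is at most \<open>S m\<close>, both for the
  walk and (with mean \<open>0\<close>) under the uniform distribution. So \<open>F > S m / 2\<close> separates the two laws as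
  soon as \<open>S m\<close> is large.\<close>

theorem tv_dist_product_ge_second_moment:
  defines "S m \<equiv> \<Sum>i\<in>I. (1 - r i * l i) ^ (2 * m)"
  assumes ne: "I \<noteq> {}"
  shows "1 - 8 / S m \<le> tv_dist (product_walk I W r) m"
proof -
  define c where "c i = (1 - r i * l i) ^ m" for i
  define F where "F x = (\<Sum>i\<in>I. c i * \<phi> i (x i))" for x
  let ?P = "convolve_power PG PQ m" and ?U = "uniform_prob (carrier PG)"
  interpret PG: group PG by (rule group_PG)
  have PG_ne: "carrier PG \<noteq> {}" using PG.one_closed by blast
  have r_le: "r i \<le> 1" if "i \<in> I" for i
    using member_le_sum[OF that, of r] r_pos sum_r finite_I by (auto intro: less_imp_le)
  have rl: "r i * l i < 1" "0 < r i * l i" if "i \<in> I" for i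
    using mult_le_less_imp_less[of "r i" 1 "l i" 1] that r_le r_pos l_pos l_less
    by (auto intro: less_imp_le)
  have S_eq: "S m = (\<Sum>i\<in>I. c i * c i)" by (simp add: S_def c_def mult_2 power_add)
  have c_pos: "0 < c i" if "i \<in> I" for i using rl[OF that] by (simp add: c_def)
  have S_pos: "0 < S m" unfolding S_eq
    using ne finite_I c_pos by (intro sum_pos) auto
  have square: "(F x)\<^sup>2 = (\<Sum>i\<in>I. \<Sum>j\<in>I. c i * c j * (\<phi> i (x i) * \<phi> j (x j)))" for x
    by (simp add: F_def power2_eq_square sum_product mult_ac)
  have pair: "(\<Prod>k\<in>{i, j}. \<phi> k (x k)) = \<phi> i (x i) * \<phi> j (x j)" if "i \<noteq> j" for i j x
    using that by simp
  have swap: "(\<Sum>x\<in>carrier PG. p x * (F x)\<^sup>2)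
      = (\<Sum>i\<in>I. \<Sum>j\<in>I. c i * c j * (\<Sum>x\<in>carrier PG. p x * (\<phi> i (x i) * \<phi> j (x j))))" for p
  proof -
    have "(\<Sum>x\<in>carrier PG. p x * (F x)\<^sup>2)
      = (\<Sum>x\<in>carrier PG. \<Sum>i\<in>I. \<Sum>j\<in>I. c i * c j * (p x * (\<phi> i (x i) * \<phi> j (x j))))"
      by (simp add: square sum_distrib_left mult_ac)
    also have "\<dots> = (\<Sum>i\<in>I. \<Sum>j\<in>I. \<Sum>x\<in>carrier PG. c i * c j * (p x * (\<phi> i (x i) * \<phi> j (x j))))"
      by (subst sum.swap, intro sum.cong refl) (rule sum.swap)
    finally show ?thesis by (simp only: sum_distrib_left)
  qed
  have mean_swap: "(\<Sum>x\<in>carrier PG. p x * F x) = (\<Sum>i\<in>I. c i * (\<Sum>x\<in>carrier PG. p x * \<phi> i (x i)))" for p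
  proof -
    have "(\<Sum>x\<in>carrier PG. p x * F x) = (\<Sum>x\<in>carrier PG. \<Sum>i\<in>I. c i * (p x * \<phi> i (x i)))"
      by (simp add: F_def sum_distrib_left mult_ac)
    then show ?thesis by (subst (asm) sum.swap) (simp only: sum_distrib_left)
  qed
  have diag: "(\<Sum>x\<in>carrier PG. p x * (\<phi> i (x i) * \<phi> i (x i))) \<le> 1"
    if p: "prob_on (carrier PG) p" and i: "i \<in> I" for p i
  proof -
    have "(\<Sum>x\<in>carrier PG. p x * (\<phi> i (x i) * \<phi> i (x i))) \<le> (\<Sum>x\<in>carrier PG. p x * 1)"
    proof (intro sum_mono mult_left_mono)
      fix x assume x: "x \<in> carrier PG"
      then have "\<bar>\<phi> i (x i)\<bar> * \<bar>\<phi> i (x i)\<bar> \<le> 1 * 1"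
        using i by (intro mult_mono \<phi>_bound) auto
      then show "\<phi> i (x i) * \<phi> i (x i) \<le> 1" by simp
      show "0 \<le> p x" using p x by (simp only: prob_on_def)
    qed
    then show ?thesis using p by (simp only: prob_on_def mult_1_right)
  qed
  \<comment> \<open>Choosing a coordinate excludes the others, which correlates the coordinates negatively.\<close>
  have off: "(\<Sum>x\<in>carrier PG. ?P x * (\<phi> i (x i) * \<phi> j (x j))) \<le> c i * c j"
    if ij: "i \<in> I" "j \<in> I" "i \<noteq> j" for i j
  proof -
    have "r i + r j \<le> 1"
      using ij sum_mono2[OF finite_I, of "{i, j}" r] r_pos sum_r by (auto intro: less_imp_le)
    moreover have "r i * l i \<le> r i * 1" "r j * l j \<le> r j * 1"
      using ij r_pos l_less by (auto intro!: mult_left_mono less_imp_le)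
    ultimately have "0 \<le> 1 - (r i * l i + r j * l j)" by simp
    moreover have "1 - (r i * l i + r j * l j) \<le> (1 - r i * l i) * (1 - r j * l j)"
      using mult_pos_pos[OF rl(2)[OF ij(1)] rl(2)[OF ij(2)]] by (simp add: algebra_simps)
    ultimately have "(1 - (r i * l i + r j * l j)) ^ m \<le> c i * c j"
      unfolding c_def power_mult_distrib[symmetric] by (intro power_mono)
    then show ?thesis
      using coordinate_product_expectation[of "{i, j}" m] ij by (simp add: pair)
  qed
  have probP: "prob_on (carrier PG) ?P"
    by (rule prob_on_convolve_power[OF group_PG finite_PG prob_PQ])
  have probU: "prob_on (carrier PG) ?U"
    by (rule prob_on_uniform[OF finite_PG PG_ne])
  have meanP: "(\<Sum>x\<in>carrier PG. ?P x * F x) = S m"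
    unfolding mean_swap S_eq
    using coordinate_product_expectation[of "{_}" m] by (intro sum.cong) (auto simp: c_def)
  have U_eq: "(\<Sum>x\<in>carrier PG. ?U x * f x) = (\<Sum>x\<in>carrier PG. f x) / card (carrier PG)" for f
  proof -
    have "(\<Sum>x\<in>carrier PG. ?U x * f x) = (\<Sum>x\<in>carrier PG. f x / card (carrier PG))"
      by (rule sum.cong[OF refl]) (simp add: uniform_prob_def)
    then show ?thesis by (simp only: sum_divide_distrib)
  qed
  have meanU: "(\<Sum>x\<in>carrier PG. ?U x * F x) = 0"
    unfolding mean_swap U_eq
    using coordinate_product_sum_zero[of "{_}"] by (intro sum.neutral) auto
  have secondP: "(\<Sum>x\<in>carrier PG. ?P x * (F x)\<^sup>2) \<le> (S m)\<^sup>2 + S m"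
  proof -
    have "(\<Sum>x\<in>carrier PG. ?P x * (F x)\<^sup>2)
        \<le> (\<Sum>i\<in>I. \<Sum>j\<in>I. c i * c j * (c i * c j) + (if i = j then c i * c i else 0))"
      unfolding swap
    proof (intro sum_mono)
      fix i j assume ij: "i \<in> I" "j \<in> I"
      have cc: "0 \<le> c i * c j" using c_pos ij by (simp add: less_imp_le)
      show "c i * c j * (\<Sum>x\<in>carrier PG. ?P x * (\<phi> i (x i) * \<phi> j (x j)))
          \<le> c i * c j * (c i * c j) + (if i = j then c i * c i else 0)"
      proof (cases "i = j")
        case True
        have "c i * c j * (\<Sum>x\<in>carrier PG. ?P x * (\<phi> i (x i) * \<phi> j (x j))) \<le> c i * c j * 1"
          using diag[OF probP ij(1)] True by (intro mult_left_mono cc) auto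
        also have "\<dots> \<le> c i * c j * (c i * c j) + c i * c j"
          using mult_nonneg_nonneg[OF cc cc] by linarith
        finally show ?thesis using True by simp
      next
        case False
        then show ?thesis using mult_left_mono[OF off[OF ij False] cc] by simp
      qed
    qed
    also have "\<dots> = (\<Sum>i\<in>I. \<Sum>j\<in>I. c i * c i * (c j * c j)) + S m"
      using finite_I by (simp add: sum.distrib S_eq mult_ac)
    also have "(\<Sum>i\<in>I. \<Sum>j\<in>I. c i * c i * (c j * c j)) = (S m)\<^sup>2"
      by (simp only: S_eq power2_eq_square sum_product)
    finally show ?thesis by simp
  qed
  have secondU: "(\<Sum>x\<in>carrier PG. ?U x * (F x)\<^sup>2) \<le> 0\<^sup>2 + S m"
  proof -
    have "(\<Sum>x\<in>carrier PG. ?U x * (F x)\<^sup>2) \<le> (\<Sum>i\<in>I. \<Sum>j\<in>I. if i = j then c i * c i else 0)"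
      unfolding swap
    proof (intro sum_mono)
      fix i j assume ij: "i \<in> I" "j \<in> I"
      have cc: "0 \<le> c i * c j" using c_pos ij by (simp add: less_imp_le)
      show "c i * c j * (\<Sum>x\<in>carrier PG. ?U x * (\<phi> i (x i) * \<phi> j (x j)))
          \<le> (if i = j then c i * c i else 0)"
      proof (cases "i = j")
        case True
        have "c i * c j * (\<Sum>x\<in>carrier PG. ?U x * (\<phi> i (x i) * \<phi> j (x j))) \<le> c i * c j * 1"
          using diag[OF probU ij(1)] True by (intro mult_left_mono cc) auto
        then show ?thesis using True by simp
      next
        case False
        have "(\<Sum>x\<in>carrier PG. \<phi> i (x i) * \<phi> j (x j)) = 0"
          using coordinate_product_sum_zero[of "{i, j}"] ij False by (simp add: pair)
        then show ?thesis unfolding U_eq using False by simp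
      qed
    qed
    also have "\<dots> = S m" using finite_I by (simp add: S_eq)
    finally show ?thesis by simp
  qed
  define B where "B = {x \<in> carrier PG. S m / 2 < F x}"
  have B: "B \<subseteq> carrier PG" "carrier PG - B \<subseteq> carrier PG" by (auto simp only: B_def)
  have quarter: "S m / (S m / 2)\<^sup>2 = 4 / S m" using S_pos by (simp add: field_simps power2_eq_square)
  have "sum ?P (carrier PG - B) \<le> 4 / S m"
  proof (rule chebyshev_sum[OF finite_PG probP meanP secondP _ B(2), of "S m / 2", unfolded quarter])
    fix x assume "x \<in> carrier PG - B"
    then have "F x \<le> S m / 2" by (auto simp only: B_def)
    then show "S m / 2 \<le> \<bar>F x - S m\<bar>" using S_pos by linarith
  qed (use S_pos in simp)
  moreover have "sum ?P (carrier PG) = sum ?P (carrier PG - B) + sum ?P B"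
    by (rule sum.subset_diff[OF B(1) finite_PG])
  moreover have "sum ?P (carrier PG) = 1" using probP by (simp only: prob_on_def)
  moreover have "sum ?U B \<le> 4 / S m"
  proof (rule chebyshev_sum[OF finite_PG probU meanU secondU _ B(1), of "S m / 2", unfolded quarter])
    fix x assume "x \<in> B"
    then have "S m / 2 < F x" by (auto simp only: B_def)
    then show "S m / 2 \<le> \<bar>F x - 0\<bar>" by linarith
  qed (use S_pos in simp)
  ultimately have "1 - 8 / S m \<le> sum ?P B - sum ?U B" by simp
  also have "\<dots> \<le> tv_dist (PG, PQ) m"
    by (rule tv_dist_ge_event[OF finite_PG B(1)])
  finally show ?thesis by (subst product_walk_eq)
qed

end

end

section \<open>Fourier analysis on cyclic groups\<close>

text \<open>A sum over one period does not depend on where the period starts.\<close>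

lemma sum_interval_shift:
  fixes g :: "int \<Rightarrow> 'a :: comm_monoid_add"
  assumes per: "\<And>k. g (k + int m) = g k"
  shows "(\<Sum>k\<in>{0..<int m}. g (k + c)) = (\<Sum>k\<in>{0..<int m}. g k)"
proof (cases "m = 0")
  case False
  then have m: "0 < int m" by simp
  have up: "g (k + int m * int n) = g k" for k n
  proof (induction n)
    case (Suc n)
    have "g (k + int m * int (Suc n)) = g ((k + int m * int n) + int m)" by (simp add: algebra_simps)
    then show ?case using Suc per by simp
  qed simp
  have per': "g (k + int m * q) = g k" for k q
  proof (cases "0 \<le> q")
    case True
    then show ?thesis using up[of k "nat q"] by simp
  next
    case False
    then show ?thesis using up[of "k + int m * q" "nat (- q)"] by simp
  qed
  have mod: "g (k mod int m) = g k" for k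
    using per'[of "k mod int m" "k div int m"] by simp
  show ?thesis
    by (rule sum.reindex_bij_witness[where i = "\<lambda>k. (k - c) mod int m" and j = "\<lambda>k. (k + c) mod int m"])
      (use m in \<open>auto simp: mod mod_simps\<close>)
qed simp

definition char_mod :: "nat \<Rightarrow> int \<Rightarrow> complex" where
  "char_mod m a = cis (2 * pi * of_int a / of_nat m)"

lemma char_mod_0 [simp]: "char_mod m 0 = 1"
  by (simp add: char_mod_def)

lemma char_mod_add: "char_mod m (a + b) = char_mod m a * char_mod m b"
  by (simp add: char_mod_def cis_mult add_divide_distrib distrib_left)

lemma norm_char_mod [simp]: "cmod (char_mod m a) = 1"
  by (simp add: char_mod_def)

lemma char_mod_uminus: "char_mod m (- a) = cnj (char_mod m a)"
  by (simp add: char_mod_def cis_cnj)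

lemma char_mod_mult_m: "m > 0 \<Longrightarrow> char_mod m (a * int m) = 1"
proof -
  assume "m > 0"
  then have "2 * pi * of_int (a * int m) / of_nat m = 2 * pi * real_of_int a" by simp
  then show ?thesis unfolding char_mod_def by (metis cis_multiple_2pi Ints_of_int)
qed

lemma char_mod_eq_1_iff:
  assumes "m > 0" shows "char_mod m a = 1 \<longleftrightarrow> int m dvd a"
proof
  assume "char_mod m a = 1"
  then have "cos (2 * pi * of_int a / of_nat m) = 1" by (simp add: char_mod_def complex_eq_iff)
  then obtain n :: int where "2 * pi * of_int a / of_nat m = of_int n * 2 * pi"
    unfolding cos_one_2pi_int by auto
  then have "real_of_int a = real_of_int (n * int m)" using assms by (simp add: field_simps)
  then have "a = n * int m" by linarith
  then show "int m dvd a" by simp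
next
  assume "int m dvd a"
  then show "char_mod m a = 1" using char_mod_mult_m[OF assms] by (auto simp: mult.commute)
qed

text \<open>Orthogonality: multiplication by a value \<open>\<noteq> 1\<close> of the character permutes the summands.\<close>

lemma sum_char_mod:
  assumes m: "m > 0"
  shows "(\<Sum>k\<in>{0..<int m}. char_mod m (k * a)) = (if int m dvd a then of_nat m else 0)"
proof (cases "int m dvd a")
  case True
  then have "char_mod m (k * a) = 1" for k using char_mod_eq_1_iff[OF m] by simp
  then show ?thesis using True by simp
next
  case False
  let ?S = "\<Sum>k\<in>{0..<int m}. char_mod m (k * a)"
  have "(\<Sum>k\<in>{0..<int m}. char_mod m ((k + 1) * a)) = ?S"
    by (rule sum_interval_shift)
      (simp add: distrib_right char_mod_add char_mod_mult_m[OF m] mult.commute[of "int m"])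
  moreover have "char_mod m ((k + 1) * a) = char_mod m a * char_mod m (k * a)" for k
    by (simp add: distrib_right char_mod_add)
  ultimately have "char_mod m a * ?S = ?S" by (simp only: sum_distrib_left)
  then show ?thesis using False char_mod_eq_1_iff[OF m, of a] by simp
qed

lemma parseval_mod:
  fixes f :: "int \<Rightarrow> complex"
  assumes m: "m > 0"
  shows "(\<Sum>a\<in>{0..<int m}. (cmod (\<Sum>k\<in>{0..<int m}. f k * char_mod m (a * k)))\<^sup>2)
       = m * (\<Sum>k\<in>{0..<int m}. (cmod (f k))\<^sup>2)"
proof -
  let ?Z = "{0..<int m}"
  have dvd: "int m dvd (k - l) \<longleftrightarrow> k = l" if "k \<in> ?Z" "l \<in> ?Z" for k l
    using that by (auto simp: mod_eq_dvd_iff[symmetric])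
  have "complex_of_real (\<Sum>a\<in>?Z. (cmod (\<Sum>k\<in>?Z. f k * char_mod m (a * k)))\<^sup>2)
      = (\<Sum>a\<in>?Z. (\<Sum>k\<in>?Z. f k * char_mod m (a * k)) * (\<Sum>l\<in>?Z. cnj (f l) * char_mod m (a * - l)))"
    by (simp only: of_real_sum complex_norm_square cnj_sum complex_cnj_mult char_mod_uminus mult_minus_right)
  also have "\<dots> = (\<Sum>a\<in>?Z. \<Sum>k\<in>?Z. \<Sum>l\<in>?Z. f k * cnj (f l) * char_mod m (a * (k - l)))"
    unfolding sum_product by (simp add: diff_conv_add_uminus distrib_left char_mod_add mult_ac del: add_uminus_conv_diff)
  also have "\<dots> = (\<Sum>k\<in>?Z. \<Sum>l\<in>?Z. \<Sum>a\<in>?Z. f k * cnj (f l) * char_mod m (a * (k - l)))"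
    by (subst sum.swap, rule sum.cong[OF refl], rule sum.swap)
  also have "\<dots> = (\<Sum>k\<in>?Z. \<Sum>l\<in>?Z. if k = l then of_nat m * (f k * cnj (f k)) else 0)"
    by (intro sum.cong refl) (simp add: sum_distrib_left[symmetric] sum_char_mod[OF m] dvd)
  also have "\<dots> = complex_of_real (m * (\<Sum>k\<in>?Z. (cmod (f k))\<^sup>2))"
    by (simp add: complex_norm_square[symmetric] sum_distrib_left)
  finally show ?thesis by (simp only: of_real_eq_iff)
qed

text \<open>The powers of a nontrivial \<open>m\<close>-th root of unity \<open>z\<close> sum to zero, so the numbers
  \<open>1 - z ^ k\<close>, which are at most \<open>k * \<bar>1 - z\<bar>\<close>, sum to \<open>m\<close>.\<close>

lemma norm_char_mod_minus_1_ge: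
  assumes m: "m > 0" and a: "\<not> int m dvd a"
  shows "2 / m \<le> cmod (char_mod m a - 1)"
proof -
  let ?Z = "{0..<int m}" and ?d = "cmod (char_mod m a - 1)"
  have pow: "cmod (1 - char_mod m (int k * a)) \<le> k * ?d" for k :: nat
  proof (induction k)
    case (Suc k)
    have "1 - char_mod m (int (Suc k) * a)
        = (1 - char_mod m (int k * a)) + char_mod m (int k * a) * (1 - char_mod m a)"
      by (simp add: distrib_right char_mod_add algebra_simps)
    also have "cmod \<dots> \<le> cmod (1 - char_mod m (int k * a)) + cmod (1 - char_mod m a)"
      using norm_triangle_ineq[of "1 - char_mod m (int k * a)" "char_mod m (int k * a) * (1 - char_mod m a)"]
      by (simp add: norm_mult)
    finally show ?case using Suc by (simp add: norm_minus_commute algebra_simps)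
  qed simp
  have Z: "?Z = int ` {0..<m}" by (simp add: image_int_atLeastLessThan)
  have "real m = cmod (\<Sum>k\<in>?Z. 1 - char_mod m (k * a))"
    using a by (simp add: sum_subtractf sum_char_mod[OF m])
  also have "\<dots> \<le> (\<Sum>k\<in>?Z. cmod (1 - char_mod m (k * a)))" by (rule norm_sum)
  also have "\<dots> = (\<Sum>k\<in>{0..<m}. cmod (1 - char_mod m (int k * a)))"
    unfolding Z by (subst sum.reindex) auto
  also have "\<dots> \<le> (\<Sum>k\<in>{0..<m}. k * ?d)" by (intro sum_mono pow)
  also have "\<dots> = real (\<Sum>k\<in>{0..<m}. k) * ?d" by (simp add: sum_distrib_right)
  also have "\<dots> \<le> real m * real m / 2 * ?d"
  proof (rule mult_right_mono)
    show "real (\<Sum>k\<in>{0..<m}. k) \<le> real m * real m / 2"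
      by (induction m) (simp_all add: algebra_simps)
  qed simp
  finally show ?thesis using m by (simp add: field_simps)
qed


section \<open>Simple random walk twisted by a central character\<close>

text \<open>Doubly periodic functions are summed over one period.\<close>

definition grid_sum :: "nat \<Rightarrow> (int \<Rightarrow> int \<Rightarrow> 'a::comm_monoid_add) \<Rightarrow> 'a" where
  "grid_sum m g = (\<Sum>i\<in>{0..<int m}. \<Sum>j\<in>{0..<int m}. g i j)"

definition biperiodic :: "nat \<Rightarrow> (int \<Rightarrow> int \<Rightarrow> 'a) \<Rightarrow> bool" where
  "biperiodic m g \<longleftrightarrow> (\<forall>i j. g (i + int m) j = g i j \<and> g i (j + int m) = g i j)"

lemma biperiodicD:
  assumes "biperiodic m g"
  shows "g (i + int m) j = g i j" "g i (j + int m) = g i j"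
    "g (i + int m + c) j = g (i + c) j" "g (i + int m - c) j = g (i - c) j"
    "g i (j + int m + c) = g i (j + c)" "g i (j + int m - c) = g i (j - c)"
proof -
  show "g (i + int m) j = g i j" "g i (j + int m) = g i j" for i j
    using assms by (auto simp: biperiodic_def)
  note * = this
  show "g (i + int m + c) j = g (i + c) j" "g (i + int m - c) j = g (i - c) j"
    "g i (j + int m + c) = g i (j + c)" "g i (j + int m - c) = g i (j - c)"
    using *(1)[of "i + c" j] *(1)[of "i - c" j] *(2)[of i "j + c"] *(2)[of i "j - c"]
    by (simp_all add: algebra_simps)
qed

lemma grid_sum_shift:
  assumes "biperiodic m g"
  shows "grid_sum m (\<lambda>i j. g (i + c) j) = grid_sum m g" "grid_sum m (\<lambda>i j. g i (j + c)) = grid_sum m g"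
    "grid_sum m (\<lambda>i j. g (i - c) j) = grid_sum m g" "grid_sum m (\<lambda>i j. g i (j - c)) = grid_sum m g"
proof -
  show 1: "grid_sum m (\<lambda>i j. g (i + c) j) = grid_sum m g" for c
    unfolding grid_sum_def using biperiodicD[OF assms]
    by (intro sum_interval_shift[where g = "\<lambda>i. \<Sum>j\<in>{0..<int m}. g i j"]) simp
  show 2: "grid_sum m (\<lambda>i j. g i (j + c)) = grid_sum m g" for c
    unfolding grid_sum_def using biperiodicD[OF assms]
    by (intro sum.cong refl sum_interval_shift) simp
  show "grid_sum m (\<lambda>i j. g (i - c) j) = grid_sum m g" "grid_sum m (\<lambda>i j. g i (j - c)) = grid_sum m g"
    using 1[of "- c"] 2[of "- c"] by simp_all
qed

lemma grid_sum_algebra: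
  "grid_sum m (\<lambda>i j. f i j + g i j) = grid_sum m f + grid_sum m g"
  "grid_sum m (\<lambda>i j. c * h i j) = c * grid_sum m (h :: int \<Rightarrow> int \<Rightarrow> 'a::semiring_0)"
  by (simp_all add: grid_sum_def sum.distrib sum_distrib_left)

lemma grid_sum_diff:
  "grid_sum m (\<lambda>i j. f i j - g i j) = grid_sum m f - grid_sum m (g :: int \<Rightarrow> int \<Rightarrow> 'a::ab_group_add)"
  by (simp add: grid_sum_def sum_subtractf)

lemma grid_sum_mono:
  "(\<And>i j. f i j \<le> g i j) \<Longrightarrow> grid_sum m f \<le> grid_sum m (g :: int \<Rightarrow> int \<Rightarrow> real)"
  by (simp add: grid_sum_def sum_mono)

lemma norm_grid_sum: "cmod (grid_sum m f) \<le> grid_sum m (\<lambda>i j. cmod (f i j))"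
  unfolding grid_sum_def by (intro order.trans[OF norm_sum] sum_mono norm_sum)

lemma norm_mult_cnj_le: "cmod (z * cnj w) \<le> ((cmod z)\<^sup>2 + (cmod w)\<^sup>2) / 2"
  using sum_squares_bound[of "cmod z" "cmod w"] by (simp add: norm_mult)

definition energy :: "nat \<Rightarrow> (int \<Rightarrow> int \<Rightarrow> complex) \<Rightarrow> real" where
  "energy m f = grid_sum m (\<lambda>i j. (cmod (f i j))\<^sup>2)"

lemma energy_nonneg: "0 \<le> energy m f"
  by (simp add: energy_def grid_sum_def sum_nonneg)

lemma grid_sum_mult_cnj_bound:
  "cmod (grid_sum m (\<lambda>i j. f i j * cnj (g i j))) \<le> (energy m f + energy m g) / 2"
proof -
  have "cmod (grid_sum m (\<lambda>i j. f i j * cnj (g i j)))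
      \<le> grid_sum m (\<lambda>i j. (1/2) * ((cmod (f i j))\<^sup>2 + (cmod (g i j))\<^sup>2))"
    by (rule order.trans[OF norm_grid_sum grid_sum_mono])
      (use norm_mult_cnj_le in \<open>simp add: mult.commute\<close>)
  then show ?thesis by (simp only: grid_sum_algebra energy_def)
qed

lemma energy_shift:
  assumes "biperiodic m f"
  shows "energy m (\<lambda>i j. f (i + c) j) = energy m f" "energy m (\<lambda>i j. f i (j + c)) = energy m f"
    "energy m (\<lambda>i j. f (i - c) j) = energy m f" "energy m (\<lambda>i j. f i (j - c)) = energy m f"
  using grid_sum_shift[of m "\<lambda>i j. (cmod (f i j))\<^sup>2" c] assms
  by (simp_all add: energy_def biperiodic_def)

text \<open>On the component of a central character \<open>a\<close>, right multiplication by the second generator acts as a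
  shift in \<open>j\<close> together with the phase \<open>char_mod m (a * i)\<close>, since it moves the central coordinate by \<open>i\<close>.\<close>

definition twisted_shift :: "nat \<Rightarrow> int \<Rightarrow> (int \<Rightarrow> int \<Rightarrow> complex) \<Rightarrow> int \<Rightarrow> int \<Rightarrow> complex" where
  "twisted_shift m a f = (\<lambda>i j. char_mod m (a * i) * f i (j - 1))"

definition twisted_step :: "nat \<Rightarrow> int \<Rightarrow> (int \<Rightarrow> int \<Rightarrow> complex) \<Rightarrow> int \<Rightarrow> int \<Rightarrow> complex" where
  "twisted_step m a f = (\<lambda>i j. (f i j + f (i - 1) j + f (i + 1) j
     + char_mod m (a * i) * f i (j - 1) + char_mod m (- (a * i)) * f i (j + 1)) / 5)"

text \<open>How far \<open>f\<close> is from being invariant under the plain shift in \<open>i\<close> and the twisted shift in \<open>j\<close>.\<close>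

definition step_energy :: "nat \<Rightarrow> int \<Rightarrow> (int \<Rightarrow> int \<Rightarrow> complex) \<Rightarrow> real" where
  "step_energy m a f = energy m (\<lambda>i j. f i j - f (i - 1) j) + energy m (\<lambda>i j. f i j - twisted_shift m a f i j)"

context
  fixes m :: nat and a :: int and f :: "int \<Rightarrow> int \<Rightarrow> complex"
  assumes m: "0 < m" and f: "biperiodic m f"
begin

lemma char_mod_mult_periodic: "char_mod m (a * (i + int m)) = char_mod m (a * i)"
  by (simp add: distrib_left char_mod_add char_mod_mult_m[OF m])

lemma biperiodic_parts:
  "biperiodic m (\<lambda>i j. f i j - f (i - 1) j)"
  "biperiodic m (twisted_shift m a f)"
  "biperiodic m (\<lambda>i j. f i j - twisted_shift m a f i j)"
  unfolding biperiodic_def twisted_shift_def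
  by (simp_all add: biperiodicD[OF f] char_mod_mult_periodic)

lemma energy_twisted_shift: "energy m (twisted_shift m a f) = energy m f"
proof -
  have "energy m (twisted_shift m a f) = energy m (\<lambda>i j. f i (j - 1))"
    by (simp add: energy_def twisted_shift_def norm_mult)
  then show ?thesis by (simp add: energy_shift[OF f])
qed

text \<open>An uncertainty principle: the two shifts commute up to the scalar \<open>char_mod m (- a)\<close>, so a
  function cannot be nearly invariant under both. The commutator is quadratic in the increments
  along the two shifts, and on a nearly invariant function it has norm about
  \<open>\<bar>char_mod m (- a) - 1\<bar>\<close>.\<close>

lemma uncertainty:
  "cmod (char_mod m (- a) - 1) * (energy m f - step_energy m a f) \<le> step_energy m a f"
proof -
  let ?e = "\<lambda>i. char_mod m (a * i)"
  define A where "A i j = f i j - f (i - 1) j" for i j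
  define B where "B i j = f i j - twisted_shift m a f i j" for i j
  define X where "X = step_energy m a f"
  have X: "X = energy m A + energy m B" by (simp add: X_def step_energy_def A_def[abs_def] B_def[abs_def])
  have bA: "biperiodic m A" and bB: "biperiodic m B"
    using biperiodic_parts by (simp_all add: A_def[abs_def] B_def[abs_def])
  define w where "w i j = ?e i * f (i - 1) (j - 1)" for i j
  have bw: "biperiodic m w"
    unfolding biperiodic_def w_def by (simp add: biperiodicD[OF f] char_mod_mult_periodic)
  define J where "J = grid_sum m (\<lambda>i j. w i j * cnj (f i j))"
  have e_inv: "?e i * char_mod m (- (a * i)) = 1" for i
    using char_mod_add[of m "a * i" "- (a * i)"] by simp
  have e_inv': "cnj (?e i) * ?e i = 1" for i
    using e_inv[of i] by (simp add: char_mod_uminus mult.commute)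
  have comm: "(char_mod m (- a) - 1) * w i j = (B i j - B (i - 1) j) - (A i j - ?e i * A i (j - 1))" for i j
  proof -
    have "?e (i - 1) = char_mod m (- a) * ?e i"
      using char_mod_add[of m "- a" "a * i"] by (simp add: algebra_simps)
    then show ?thesis by (simp add: w_def A_def B_def twisted_shift_def algebra_simps)
  qed
  have part1: "cmod (grid_sum m (\<lambda>i j. (B i j - B (i - 1) j) * cnj (f i j))) \<le> X / 2"
  proof -
    have "biperiodic m (\<lambda>i j. B (i - 1) j * cnj (f i j))"
      unfolding biperiodic_def by (simp add: biperiodicD[OF f] biperiodicD[OF bB])
    from grid_sum_shift(1)[OF this, of 1]
    have shift: "grid_sum m (\<lambda>i j. B (i - 1) j * cnj (f i j)) = grid_sum m (\<lambda>i j. B i j * cnj (f (i + 1) j))"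
      by simp
    have "grid_sum m (\<lambda>i j. (B i j - B (i - 1) j) * cnj (f i j))
        = grid_sum m (\<lambda>i j. B i j * cnj (f i j) - B (i - 1) j * cnj (f i j))"
      by (simp add: left_diff_distrib)
    also have "\<dots> = grid_sum m (\<lambda>i j. B i j * cnj (f i j) - B i j * cnj (f (i + 1) j))"
      by (simp only: grid_sum_diff shift)
    also have "\<dots> = grid_sum m (\<lambda>i j. (- 1) * (B i j * cnj (A (i + 1) j)))"
      by (simp add: A_def algebra_simps)
    also have "\<dots> = - grid_sum m (\<lambda>i j. B i j * cnj (A (i + 1) j))"
      by (subst grid_sum_algebra) simp
    also have "cmod \<dots> \<le> (energy m B + energy m (\<lambda>i j. A (i + 1) j)) / 2"
      using grid_sum_mult_cnj_bound[of m B "\<lambda>i j. A (i + 1) j"] by simp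
    finally show ?thesis by (simp add: energy_shift[OF bA] X add.commute)
  qed
  have part2: "cmod (grid_sum m (\<lambda>i j. (A i j - ?e i * A i (j - 1)) * cnj (f i j))) \<le> X / 2"
  proof -
    have "biperiodic m (\<lambda>i j. ?e i * A i (j - 1) * cnj (f i j))"
      unfolding biperiodic_def by (simp add: biperiodicD[OF f] biperiodicD[OF bA] char_mod_mult_periodic)
    from grid_sum_shift(2)[OF this, of 1]
    have shift: "grid_sum m (\<lambda>i j. ?e i * A i (j - 1) * cnj (f i j))
        = grid_sum m (\<lambda>i j. ?e i * A i j * cnj (f i (j + 1)))"
      by simp
    have "grid_sum m (\<lambda>i j. (A i j - ?e i * A i (j - 1)) * cnj (f i j))
        = grid_sum m (\<lambda>i j. A i j * cnj (f i j) - ?e i * A i (j - 1) * cnj (f i j))"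
      by (simp add: left_diff_distrib)
    also have "\<dots> = grid_sum m (\<lambda>i j. A i j * cnj (f i j) - ?e i * A i j * cnj (f i (j + 1)))"
      by (simp only: grid_sum_diff shift)
    also have "\<dots> = grid_sum m (\<lambda>i j. (- 1) * (A i j * cnj (cnj (?e i) * B i (j + 1))))"
    proof -
      have "A i j * cnj (f i j) - ?e i * A i j * cnj (f i (j + 1))
          = (- 1) * (A i j * cnj (cnj (?e i) * B i (j + 1)))" for i j
      proof -
        have "cnj (?e i) * B i (j + 1) = cnj (?e i) * f i (j + 1) - (cnj (?e i) * ?e i) * f i j"
          by (simp add: B_def twisted_shift_def algebra_simps)
        then have "cnj (?e i) * B i (j + 1) = cnj (?e i) * f i (j + 1) - f i j" by (simp only: e_inv' mult_1)
        then show ?thesis by (simp only:) (simp add: algebra_simps)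
      qed
      then show ?thesis by simp
    qed
    also have "\<dots> = - grid_sum m (\<lambda>i j. A i j * cnj (cnj (?e i) * B i (j + 1)))"
      by (subst grid_sum_algebra) simp
    also have "cmod \<dots> \<le> (energy m A + energy m (\<lambda>i j. cnj (?e i) * B i (j + 1))) / 2"
      using grid_sum_mult_cnj_bound[of m A "\<lambda>i j. cnj (?e i) * B i (j + 1)"] by (simp only: norm_minus_cancel)
    also have "energy m (\<lambda>i j. cnj (?e i) * B i (j + 1)) = energy m (\<lambda>i j. B i (j + 1))"
      by (simp add: energy_def norm_mult)
    finally show ?thesis by (simp add: energy_shift[OF bB] X)
  qed
  have "(char_mod m (- a) - 1) * J
      = grid_sum m (\<lambda>i j. (B i j - B (i - 1) j) * cnj (f i j) - (A i j - ?e i * A i (j - 1)) * cnj (f i j))"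
    unfolding J_def grid_sum_algebra(2)[symmetric] mult.assoc[symmetric] comm by (simp add: left_diff_distrib)
  also have "\<dots> = grid_sum m (\<lambda>i j. (B i j - B (i - 1) j) * cnj (f i j))
      - grid_sum m (\<lambda>i j. (A i j - ?e i * A i (j - 1)) * cnj (f i j))" by (rule grid_sum_diff)
  also have "cmod \<dots> \<le> X / 2 + X / 2"
    by (rule order.trans[OF norm_triangle_ineq4 add_mono[OF part1 part2]])
  finally have upper: "cmod (char_mod m (- a) - 1) * cmod J \<le> X" by (simp add: norm_mult)
  have lower: "energy m f - X \<le> Re J"
  proof -
    have par: "(cmod (u + v))\<^sup>2 \<le> 2 * (cmod u)\<^sup>2 + 2 * (cmod v)\<^sup>2" for u v
    proof -
      have "(cmod (u + v))\<^sup>2 \<le> (cmod u + cmod v)\<^sup>2" by (intro power_mono norm_triangle_ineq) auto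
      also have "\<dots> \<le> 2 * (cmod u)\<^sup>2 + 2 * (cmod v)\<^sup>2"
        using sum_squares_bound[of "cmod u" "cmod v"] by (simp add: power2_sum)
      finally show ?thesis .
    qed
    have polar: "(cmod z)\<^sup>2 + (cmod u)\<^sup>2 - 2 * Re (z * cnj u) = (cmod (z - u))\<^sup>2" for z u
      by (simp only: cmod_power2 minus_complex.simps times_complex.simps cnj.simps) (simp add: power2_eq_square algebra_simps)
    have "energy m w + energy m f - 2 * Re J
        = grid_sum m (\<lambda>i j. (cmod (w i j))\<^sup>2 + (cmod (f i j))\<^sup>2 - 2 * Re (w i j * cnj (f i j)))"
      by (simp only: grid_sum_algebra grid_sum_diff energy_def J_def) (simp add: grid_sum_def)
    also have "\<dots> = grid_sum m (\<lambda>i j. (cmod (w i j - f i j))\<^sup>2)" by (simp only: polar)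
    also have "\<dots> = grid_sum m (\<lambda>i j. (cmod (?e i * A i (j - 1) + B i j))\<^sup>2)"
    proof -
      have "w i j - f i j = - (?e i * A i (j - 1) + B i j)" for i j
        by (simp add: w_def A_def B_def twisted_shift_def algebra_simps)
      then show ?thesis by (simp only: norm_minus_cancel)
    qed
    also have "\<dots> \<le> grid_sum m (\<lambda>i j. 2 * (cmod (?e i * A i (j - 1)))\<^sup>2 + 2 * (cmod (B i j))\<^sup>2)"
      by (intro grid_sum_mono par)
    also have "\<dots> = 2 * energy m (\<lambda>i j. A i (j - 1)) + 2 * energy m B"
      by (simp only: grid_sum_algebra energy_def norm_mult norm_char_mod mult_1)
    also have "\<dots> = 2 * X" by (simp add: energy_shift[OF bA] X)
    finally have "energy m w + energy m f - 2 * Re J \<le> 2 * X" .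
    moreover have "energy m w = energy m f"
    proof -
      have "energy m w = energy m (\<lambda>i j. f (i - 1) (j - 1))"
        by (simp add: energy_def w_def norm_mult)
      also have "\<dots> = energy m (\<lambda>i j. f i (j - 1))"
        by (rule energy_shift(3)[where f = "\<lambda>i j. f i (j - 1)"])
          (simp add: biperiodic_def biperiodicD[OF f])
      finally show ?thesis by (simp add: energy_shift[OF f])
    qed
    ultimately show ?thesis by simp
  qed
  have "cmod (char_mod m (- a) - 1) * (energy m f - X) \<le> cmod (char_mod m (- a) - 1) * cmod J"
    using lower complex_Re_le_cmod[of J] by (intro mult_left_mono) auto
  with upper show ?thesis by (simp add: X_def)
qed

text \<open>Five vectors of equal length average to a shorter one, and the loss is the sum of their squared
  distances: \<open>\<bar>z\<^sub>0 + \<dots> + z\<^sub>4\<bar>\<^sup>2 = 5 * (\<bar>z\<^sub>0\<bar>\<^sup>2 + \<dots> + \<bar>z\<^sub>4\<bar>\<^sup>2) - (\<Sum>a<b. \<bar>z\<^sub>a - z\<^sub>b\<bar>\<^sup>2)\<close>. Keeping only the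
  distances from \<open>f\<close> to its four shifts bounds the norm of the step itself, so eigenvalues near \<open>1\<close> and
  near \<open>-1\<close> are treated alike.\<close>

lemma energy_twisted_step_le:
  "energy m (twisted_step m a f) \<le> energy m f - 2 / 25 * step_energy m a f"
proof -
  let ?V = "twisted_shift m a f"
  let ?V' = "\<lambda>i j. char_mod m (- (a * i)) * f i (j + 1)"
  let ?U = "\<lambda>i j. f (i - 1) j" and ?U' = "\<lambda>i j. f (i + 1) j"
  have sos: "(cmod ((z0 + z1 + z2 + z3 + z4) / 5))\<^sup>2
      \<le> (1/5) * ((cmod z0)\<^sup>2 + (cmod z1)\<^sup>2 + (cmod z2)\<^sup>2 + (cmod z3)\<^sup>2 + (cmod z4)\<^sup>2)
       - (1/25) * ((cmod (z0 - z1))\<^sup>2 + (cmod (z2 - z0))\<^sup>2 + (cmod (z0 - z3))\<^sup>2 + (cmod (z4 - z0))\<^sup>2)"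
    (is "?L \<le> ?R") for z0 z1 z2 z3 z4
  proof -
    have "?R - ?L = (1/25) * ((cmod (z1 - z2))\<^sup>2 + (cmod (z1 - z3))\<^sup>2 + (cmod (z1 - z4))\<^sup>2
        + (cmod (z2 - z3))\<^sup>2 + (cmod (z2 - z4))\<^sup>2 + (cmod (z3 - z4))\<^sup>2)"
      unfolding norm_divide power_divide
      by (simp add: cmod_power2) (simp add: power2_eq_square field_simps)
    moreover have "0 \<le> \<dots>" by simp
    ultimately show ?thesis by linarith
  qed
  have U': "energy m (\<lambda>i j. ?U' i j - f i j) = energy m (\<lambda>i j. f i j - ?U i j)"
    using energy_shift(1)[OF biperiodic_parts(1), of 1] by simp
  have V': "energy m (\<lambda>i j. ?V' i j - f i j) = energy m (\<lambda>i j. f i j - ?V i j)"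
  proof -
    have "?V' i j - f i j = char_mod m (- (a * i)) * (f i (j + 1) - ?V i (j + 1))" for i j
      using char_mod_add[of m "- (a * i)" "a * i"]
      by (simp add: twisted_shift_def right_diff_distrib mult.assoc[symmetric])
    then have "energy m (\<lambda>i j. ?V' i j - f i j) = energy m (\<lambda>i j. f i (j + 1) - ?V i (j + 1))"
      by (simp add: energy_def norm_mult)
    also have "\<dots> = energy m (\<lambda>i j. f i j - ?V i j)"
      by (rule energy_shift(2)[OF biperiodic_parts(3)])
    finally show ?thesis .
  qed
  have "energy m ?V' = energy m (\<lambda>i j. f i (j + 1))"
    by (simp add: energy_def norm_mult)
  then have en: "energy m ?U = energy m f" "energy m ?U' = energy m f" "energy m ?V = energy m f"
    "energy m ?V' = energy m f"
    by (simp_all add: energy_shift[OF f] energy_twisted_shift)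
  have "energy m (twisted_step m a f)
      \<le> grid_sum m (\<lambda>i j. (1/5) * ((cmod (f i j))\<^sup>2 + (cmod (?U i j))\<^sup>2 + (cmod (?U' i j))\<^sup>2
            + (cmod (?V i j))\<^sup>2 + (cmod (?V' i j))\<^sup>2)
         - (1/25) * ((cmod (f i j - ?U i j))\<^sup>2 + (cmod (?U' i j - f i j))\<^sup>2
            + (cmod (f i j - ?V i j))\<^sup>2 + (cmod (?V' i j - f i j))\<^sup>2))"
    unfolding energy_def twisted_step_def twisted_shift_def by (intro grid_sum_mono sos)
  also have "\<dots> = (1/5) * (energy m f + energy m ?U + energy m ?U' + energy m ?V + energy m ?V')
      - (1/25) * (energy m (\<lambda>i j. f i j - ?U i j) + energy m (\<lambda>i j. ?U' i j - f i j)
        + energy m (\<lambda>i j. f i j - ?V i j) + energy m (\<lambda>i j. ?V' i j - f i j))"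
    by (simp only: grid_sum_diff grid_sum_algebra energy_def)
  also have "\<dots> = energy m f - 2 / 25 * step_energy m a f"
    unfolding en U' V' step_energy_def by (simp add: field_simps)
  finally show ?thesis .
qed

text \<open>By the uncertainty principle and \<open>norm_char_mod_minus_1_ge\<close>, the step energy is at least the
  proportion \<open>2 / (m + 2)\<close> of the energy. The gap is thus of order \<open>1 / m\<close>, much larger than
  the gap of order \<open>1 / m\<^sup>2\<close> of the abelianized walk.\<close>

lemma energy_twisted_step_contract:
  assumes a: "\<not> int m dvd a"
  shows "energy m (twisted_step m a f) \<le> (1 - 4 / (25 * (m + 2))) * energy m f"
proof -
  let ?X = "step_energy m a f" and ?E = "energy m f"
  have "2 / m * (?E - ?X) \<le> ?X"
  proof (cases "?X \<le> ?E")
    case True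
    have "2 / m \<le> cmod (char_mod m (- a) - 1)"
      using a by (intro norm_char_mod_minus_1_ge[OF m]) auto
    then have "2 / m * (?E - ?X) \<le> cmod (char_mod m (- a) - 1) * (?E - ?X)"
      using True by (intro mult_right_mono) auto
    with uncertainty show ?thesis by linarith
  next
    case False
    have "0 \<le> ?X" by (simp add: step_energy_def energy_nonneg)
    moreover have "2 / m * (?E - ?X) \<le> 0" using False by (intro mult_nonneg_nonpos) auto
    ultimately show ?thesis by linarith
  qed
  then have "2 / (m + 2) * ?E \<le> ?X" using m by (simp add: field_simps)
  then have "energy m (twisted_step m a f) \<le> ?E - 2 / 25 * (2 / (m + 2) * ?E)"
    using energy_twisted_step_le by linarith
  also have "\<dots> = (1 - 4 / (25 * (m + 2))) * ?E" by (simp add: left_diff_distrib)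
  finally show ?thesis .
qed

end

section \<open>The Heisenberg walk\<close>

text \<open>Reduction mod \<open>m\<close> is a homomorphism from the integer Heisenberg group, so with this parametrization by
  all integers the group laws mod \<open>m\<close> follow from ring identities, and the probabilities of the walk
  become periodic functions of three integers.\<close>

definition heis :: "nat \<Rightarrow> int \<Rightarrow> int \<Rightarrow> int \<Rightarrow> int^3^3" where
  "heis m i j k = heis_matrix (i mod int m) (j mod int m) (k mod int m)"

lemma heis_matrix_entries:
  "heis_matrix i j k $ 1 $ 1 = 1" "heis_matrix i j k $ 1 $ 2 = i" "heis_matrix i j k $ 1 $ 3 = k"
  "heis_matrix i j k $ 2 $ 1 = 0" "heis_matrix i j k $ 2 $ 2 = 1" "heis_matrix i j k $ 2 $ 3 = j"
  "heis_matrix i j k $ 3 $ 1 = 0" "heis_matrix i j k $ 3 $ 2 = 0" "heis_matrix i j k $ 3 $ 3 = 1"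
  by (simp_all add: heis_matrix_def)

lemma heis_matrix_mult:
  "heis_matrix i j k ** heis_matrix i' j' k' = heis_matrix (i + i') (j + j') (k + k' + i * j')"
  by (simp add: vec_eq_iff forall_3 matrix_matrix_mult_def sum_3 heis_matrix_entries)

lemma heis_matrix_inject [simp]:
  "heis_matrix i j k = heis_matrix i' j' k' \<longleftrightarrow> i = i' \<and> j = j' \<and> k = k'"
  by (auto simp: vec_eq_iff forall_3 heis_matrix_entries)

lemma mat_1_eq_heis_matrix: "mat 1 = heis_matrix 0 0 0"
  by (simp add: vec_eq_iff forall_3 heis_matrix_entries mat_def)

text \<open>The character of the abelianization that gives the slowest mode of the walk for large \<open>m\<close>,
  and its rate of decay.\<close>

definition slow_mode :: "nat \<Rightarrow> int^3^3 \<Rightarrow> real" where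
  "slow_mode m x = cos (2 * pi * of_int (x $ 1 $ 2) / m)"

definition slow_gap :: "nat \<Rightarrow> real" where
  "slow_gap m = 2 / 5 * (1 - cos (2 * pi / m))"

locale heisenberg =
  fixes m :: nat
  assumes m3: "3 \<le> m"
begin

abbreviation "H \<equiv> heisenberg_group m"
abbreviation "Z \<equiv> {0..<int m}"
abbreviation "step \<equiv> uniform_prob (heisenberg_steps m)"

lemma m_pos: "0 < m"
  using m3 by simp

lemma reduce_heis_matrix: "reduce_matrix m (heis_matrix i j k) = heis m i j k"
  using m3 by (simp add: vec_eq_iff forall_3 heis_matrix_entries reduce_matrix_def heis_def map_matrix_def)

lemma heis_mult: "heis m i j k \<otimes>\<^bsub>H\<^esub> heis m i' j' k' = heis m (i + i') (j + j') (k + k' + i * j')"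
proof -
  have "heis m i j k \<otimes>\<^bsub>H\<^esub> heis m i' j' k' = reduce_matrix m (heis m i j k ** heis m i' j' k')"
    by (simp add: heisenberg_group_def)
  also have "\<dots> = heis m (i + i') (j + j') (k + k' + i * j')"
    unfolding heis_def heis_matrix_mult reduce_heis_matrix[unfolded heis_def] heis_matrix_inject
    by (intro conjI mod_add_cong mod_mult_cong mod_mod_trivial)
  finally show ?thesis .
qed

lemma heis_one: "\<one>\<^bsub>H\<^esub> = heis m 0 0 0"
  by (simp add: heisenberg_group_def mat_1_eq_heis_matrix reduce_heis_matrix)

lemma heis_eq_iff:
  "heis m i j k = heis m i' j' k' \<longleftrightarrow>
    i mod int m = i' mod int m \<and> j mod int m = j' mod int m \<and> k mod int m = k' mod int m"
  by (simp add: heis_def)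

lemma heis_periodic:
  "heis m (i + int m) j k = heis m i j k" "heis m i (j + int m) k = heis m i j k"
  "heis m i j (k + int m) = heis m i j k"
  by (simp_all add: heis_def)

lemma heis_carrier: "heis m i j k \<in> carrier H"
  using m_pos by (auto simp: heisenberg_group_def heis_def)

lemma carrier_heis: "carrier H = (\<lambda>(i, j, k). heis m i j k) ` (Z \<times> Z \<times> Z)"
  by (force simp: heisenberg_group_def heis_def image_iff)

lemma inj_heis: "inj_on (\<lambda>(i, j, k). heis m i j k) (Z \<times> Z \<times> Z)"
  by (auto simp: inj_on_def heis_def)

lemma carrier_cases:
  assumes "x \<in> carrier H" obtains i j k where "x = heis m i j k"
  using assms unfolding carrier_heis by auto

lemma finite_H: "finite (carrier H)"
  unfolding carrier_heis by simp

lemma card_H: "card (carrier H) = m ^ 3"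
  unfolding carrier_heis card_image[OF inj_heis] by (simp add: card_cartesian_product power3_eq_cube)

lemma sum_H: "(\<Sum>x\<in>carrier H. f x) = (\<Sum>i\<in>Z. \<Sum>j\<in>Z. \<Sum>k\<in>Z. f (heis m i j k))"
  unfolding carrier_heis sum.reindex[OF inj_heis]
  by (simp add: sum.cartesian_product case_prod_unfold comp_def)

lemma group_H: "group H"
proof (rule groupI)
  fix x y assume "x \<in> carrier H" "y \<in> carrier H"
  then show "x \<otimes>\<^bsub>H\<^esub> y \<in> carrier H"
    by (elim carrier_cases) (simp add: heis_mult heis_carrier)
next
  show "\<one>\<^bsub>H\<^esub> \<in> carrier H" by (simp add: heis_one heis_carrier)
next
  fix x y z assume "x \<in> carrier H" "y \<in> carrier H" "z \<in> carrier H"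
  then show "x \<otimes>\<^bsub>H\<^esub> y \<otimes>\<^bsub>H\<^esub> z = x \<otimes>\<^bsub>H\<^esub> (y \<otimes>\<^bsub>H\<^esub> z)"
    by (elim carrier_cases) (simp add: heis_mult algebra_simps)
next
  fix x assume "x \<in> carrier H"
  then show "\<one>\<^bsub>H\<^esub> \<otimes>\<^bsub>H\<^esub> x = x"
    by (elim carrier_cases) (simp add: heis_mult heis_one)
next
  fix x assume "x \<in> carrier H"
  then obtain i j k where x: "x = heis m i j k" by (elim carrier_cases)
  have "heis m (- i) (- j) (i * j - k) \<otimes>\<^bsub>H\<^esub> x = \<one>\<^bsub>H\<^esub>"
    by (simp add: x heis_mult heis_one)
  then show "\<exists>y\<in>carrier H. y \<otimes>\<^bsub>H\<^esub> x = \<one>\<^bsub>H\<^esub>" using heis_carrier by blast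
qed

lemma heis_inv: "inv\<^bsub>H\<^esub> (heis m i j k) = heis m (- i) (- j) (i * j - k)"
proof -
  interpret group H by (rule group_H)
  show ?thesis by (rule inv_equality) (simp_all add: heis_mult heis_one heis_carrier)
qed

lemma heisenberg_steps_eq:
  "heisenberg_steps m = {heis m 0 0 0, heis m 1 0 0, heis m (- 1) 0 0, heis m 0 1 0, heis m 0 (- 1) 0}"
  by (simp add: heisenberg_steps_def mat_1_eq_heis_matrix reduce_heis_matrix)

lemma steps_distinct:
  "distinct [heis m 0 0 0, heis m 1 0 0, heis m (- 1) 0 0, heis m 0 1 0, heis m 0 (- 1) 0]"
  using m3 by (auto simp: heis_eq_iff zmod_zminus1_eq_if)

lemma sum_step:
  "(\<Sum>y\<in>carrier H. step y * f y)
    = (f (heis m 0 0 0) + f (heis m 1 0 0) + f (heis m (- 1) 0 0) + f (heis m 0 1 0) + f (heis m 0 (- 1) 0)) / 5"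
proof -
  let ?E = "heisenberg_steps m"
  have card: "card ?E = 5"
    using distinct_card[OF steps_distinct] by (simp add: heisenberg_steps_eq)
  have sub: "?E \<subseteq> carrier H" by (auto simp: heisenberg_steps_eq heis_carrier)
  have "(\<Sum>y\<in>carrier H. step y * f y) = (\<Sum>y\<in>?E. f y / 5)"
    by (rule sum.mono_neutral_cong_right[OF finite_H sub]) (auto simp: uniform_prob_def card)
  also have "\<dots> = (f (heis m 0 0 0) + f (heis m 1 0 0) + f (heis m (- 1) 0 0) + f (heis m 0 1 0) + f (heis m 0 (- 1) 0)) / 5"
    unfolding heisenberg_steps_eq using steps_distinct
    by (simp add: add_divide_distrib)
  finally show ?thesis .
qed

lemma prob_step: "prob_on (carrier H) step"
  using sum_step[of "\<lambda>_. 1"] by (simp add: prob_on_def uniform_prob_def)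

definition walk_prob :: "nat \<Rightarrow> int \<Rightarrow> int \<Rightarrow> int \<Rightarrow> real" where
  "walk_prob N i j k = convolve_power H step N (heis m i j k)"

lemma walk_prob_0:
  "walk_prob 0 i j k = (if int m dvd i \<and> int m dvd j \<and> int m dvd k then 1 else 0)"
  by (simp add: walk_prob_def heis_one heis_eq_iff dvd_eq_mod_eq_0)

lemma walk_prob_Suc:
  "walk_prob (Suc N) i j k = (walk_prob N i j k + walk_prob N (i - 1) j k + walk_prob N (i + 1) j k
     + walk_prob N i (j - 1) (k - i) + walk_prob N i (j + 1) (k + i)) / 5"
proof -
  have "walk_prob (Suc N) i j k
      = (\<Sum>y\<in>carrier H. step y * convolve_power H step N (heis m i j k \<otimes>\<^bsub>H\<^esub> inv\<^bsub>H\<^esub> y))"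
    unfolding walk_prob_def convolve_power.simps by (rule convolve_eq_sum_right[OF group_H heis_carrier])
  then show ?thesis by (simp add: sum_step heis_inv heis_mult walk_prob_def)
qed

lemma walk_prob_periodic:
  "walk_prob N (i + int m) j k = walk_prob N i j k" "walk_prob N i (j + int m) k = walk_prob N i j k"
  "walk_prob N i j (k + int m) = walk_prob N i j k"
  by (simp_all add: walk_prob_def heis_periodic)

lemma slow_mode_heis: "slow_mode m (heis m i j k) = cos (2 * pi * of_int i / m)"
proof -
  have "char_mod m (i mod int m) = char_mod m i"
    using char_mod_add[of m "i mod int m" "i div int m * int m"]
    by (simp only: mod_div_mult_eq char_mod_mult_m[OF m_pos] mult_1_right)
  then show ?thesis
    by (simp add: slow_mode_def heis_def heis_matrix_entries char_mod_def complex_eq_iff)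
qed

lemma slow_mode_one: "slow_mode m \<one>\<^bsub>H\<^esub> = 1"
  by (simp add: heis_one slow_mode_heis)

lemma slow_mode_eigenfunction:
  assumes "x \<in> carrier H"
  shows "(\<Sum>y\<in>carrier H. step y * slow_mode m (x \<otimes>\<^bsub>H\<^esub> y)) = (1 - slow_gap m) * slow_mode m x"
proof -
  obtain i j k where x: "x = heis m i j k" using assms by (elim carrier_cases)
  have "cos (2 * pi * of_int (i + 1) / m) + cos (2 * pi * of_int (i - 1) / m)
      = 2 * cos (2 * pi / m) * cos (2 * pi * of_int i / m)"
    by (simp add: distrib_left add_divide_distrib right_diff_distrib diff_divide_distrib cos_add cos_diff)
  then show ?thesis
    by (simp add: x sum_step heis_mult slow_mode_heis slow_gap_def field_simps)
qed

subsection \<open>The Fourier transform of the walk\<close>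

text \<open>Fourier transform along the center, which is the third coordinate.\<close>

definition central_transform :: "int \<Rightarrow> nat \<Rightarrow> int \<Rightarrow> int \<Rightarrow> complex" where
  "central_transform a N i j = (\<Sum>k\<in>Z. walk_prob N i j k * char_mod m (a * k))"

lemma biperiodic_central_transform: "biperiodic m (central_transform a N)"
  by (simp add: biperiodic_def central_transform_def walk_prob_periodic)

lemma central_transform_shift:
  "(\<Sum>k\<in>Z. walk_prob N i j (k + c) * char_mod m (a * k)) = char_mod m (- (a * c)) * central_transform a N i j"
proof -
  let ?g = "\<lambda>k. walk_prob N i j k * char_mod m (a * (k - c))"
  have "(\<Sum>k\<in>Z. ?g (k + c)) = (\<Sum>k\<in>Z. ?g k)"
  proof (rule sum_interval_shift)
    fix k
    have "a * (k + int m - c) = a * (k - c) + a * int m" by (simp add: algebra_simps)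
    then show "?g (k + int m) = ?g k"
      by (simp add: walk_prob_periodic char_mod_add char_mod_mult_m[OF m_pos])
  qed
  also have "\<dots> = (\<Sum>k\<in>Z. char_mod m (- (a * c)) * (walk_prob N i j k * char_mod m (a * k)))"
  proof (rule sum.cong[OF refl])
    fix k
    have "a * (k - c) = - (a * c) + a * k" by (simp add: algebra_simps)
    then show "?g k = char_mod m (- (a * c)) * (walk_prob N i j k * char_mod m (a * k))"
      by (simp only: char_mod_add mult_ac)
  qed
  finally show ?thesis by (simp add: central_transform_def sum_distrib_left)
qed

lemma central_transform_Suc:
  "central_transform a (Suc N) = twisted_step m a (central_transform a N)"
proof (intro ext)
  fix i j
  have "central_transform a (Suc N) i j
      = (central_transform a N i j + central_transform a N (i - 1) j + central_transform a N (i + 1) j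
        + (\<Sum>k\<in>Z. walk_prob N i (j - 1) (k + (- i)) * char_mod m (a * k))
        + (\<Sum>k\<in>Z. walk_prob N i (j + 1) (k + i) * char_mod m (a * k))) / 5"
  proof -
    have "complex_of_real ((p + q + r + s + t) / 5) * x = (p * x + q * x + r * x + s * x + t * x) / 5" for p q r s t x
      by (simp add: distrib_right add_divide_distrib)
    then show ?thesis
      unfolding central_transform_def walk_prob_Suc
      by (simp only: sum.distrib sum_divide_distrib[symmetric] diff_conv_add_uminus)
  qed
  then show "central_transform a (Suc N) i j = twisted_step m a (central_transform a N) i j"
    unfolding central_transform_shift by (simp add: twisted_step_def)
qed

lemma Z_dvd: "k \<in> Z \<Longrightarrow> int m dvd k \<longleftrightarrow> k = 0"
  by (auto dest: zdvd_imp_le)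

lemma central_transform_0: "i \<in> Z \<Longrightarrow> j \<in> Z \<Longrightarrow> central_transform a 0 i j = (if i = 0 \<and> j = 0 then 1 else 0)"
proof -
  assume ij: "i \<in> Z" "j \<in> Z"
  have "central_transform a 0 i j = (\<Sum>k\<in>Z. if k = 0 then (if i = 0 \<and> j = 0 then 1 else 0) else 0)"
    unfolding central_transform_def walk_prob_0
    by (rule sum.cong) (use ij in \<open>auto simp: Z_dvd\<close>)
  then show ?thesis using m_pos by simp
qed

lemma energy_central_transform_0: "energy m (central_transform a 0) = 1"
proof -
  have "energy m (central_transform a 0) = (\<Sum>i\<in>Z. \<Sum>j\<in>Z. if j = 0 then (if i = 0 then 1 else 0) else 0)"
    unfolding energy_def grid_sum_def by (intro sum.cong refl) (simp add: central_transform_0)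
  then show ?thesis using m_pos by simp
qed

lemma energy_central_transform_le:
  assumes a: "a \<in> Z - {0}"
  shows "energy m (central_transform a N) \<le> (1 - 4 / (25 * (m + 2))) ^ N"
proof (induction N)
  case (Suc N)
  have nn: "0 \<le> 1 - 4 / (25 * (real m + 2))" by (simp add: field_simps)
  have "energy m (central_transform a (Suc N)) \<le> (1 - 4 / (25 * (m + 2))) * energy m (central_transform a N)"
    unfolding central_transform_Suc
    using energy_twisted_step_contract[OF m_pos biperiodic_central_transform] a Z_dvd by simp
  also have "\<dots> \<le> (1 - 4 / (25 * (m + 2))) * (1 - 4 / (25 * (m + 2))) ^ N"
    using nn by (intro mult_left_mono Suc) simp
  finally show ?case by simp
qed (simp add: energy_central_transform_0)

text \<open>The trivial central character leaves the lazy nearest-neighbour walk on the torus, which the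
  characters in \<open>i\<close> and \<open>j\<close> diagonalize.\<close>

definition abelian_eigenvalue :: "int \<Rightarrow> int \<Rightarrow> real" where
  "abelian_eigenvalue a b = (1 + 2 * cos (2 * pi * of_int a / m) + 2 * cos (2 * pi * of_int b / m)) / 5"

lemma char_mod_plus_cnj: "char_mod m a + char_mod m (- a) = complex_of_real (2 * cos (2 * pi * of_int a / m))"
  by (simp add: char_mod_uminus complex_add_cnj) (simp add: char_mod_def)

definition abelian_transform :: "nat \<Rightarrow> int \<Rightarrow> int \<Rightarrow> complex" where
  "abelian_transform N a b = grid_sum m (\<lambda>i j. central_transform 0 N i j * char_mod m (a * i) * char_mod m (b * j))"

lemma abelian_transform_eq: "abelian_transform N a b = abelian_eigenvalue a b ^ N"
proof (induction N)
  case 0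
  have "abelian_transform 0 a b = (\<Sum>i\<in>Z. \<Sum>j\<in>Z. if j = 0 then (if i = 0 then 1 else 0) else 0)"
    unfolding abelian_transform_def grid_sum_def by (intro sum.cong refl) (simp add: central_transform_0)
  then show ?case using m_pos by simp
next
  case (Suc N)
  let ?f = "central_transform 0 N"
  let ?g = "\<lambda>i j. ?f i j * char_mod m (a * i) * char_mod m (b * j)"
  have per: "biperiodic m ?g"
    by (simp add: biperiodic_def biperiodicD[OF biperiodic_central_transform] distrib_left char_mod_add
        char_mod_mult_m[OF m_pos])
  have ch: "char_mod m c * char_mod m (c * (i - 1)) = char_mod m (c * i)"
    "char_mod m (- c) * char_mod m (c * (i + 1)) = char_mod m (c * i)" for c i
    using char_mod_add[of m c "c * (i - 1)"] char_mod_add[of m "- c" "c * (i + 1)"]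
    by (simp_all add: algebra_simps)
  have aux: "x * (u * y * w) = u * z * w" and aux': "x * (u * w * y) = u * w * z"
    if "x * y = z" for x y z u w :: complex
    using that by (simp_all add: mult_ac flip: that)
  have g: "char_mod m a * ?g (i - 1) j = ?f (i - 1) j * char_mod m (a * i) * char_mod m (b * j)"
    "char_mod m (- a) * ?g (i + 1) j = ?f (i + 1) j * char_mod m (a * i) * char_mod m (b * j)"
    "char_mod m b * ?g i (j - 1) = ?f i (j - 1) * char_mod m (a * i) * char_mod m (b * j)"
    "char_mod m (- b) * ?g i (j + 1) = ?f i (j + 1) * char_mod m (a * i) * char_mod m (b * j)" for i j
    by (rule aux[OF ch(1)] aux[OF ch(2)] aux'[OF ch(1)] aux'[OF ch(2)])+
  have "abelian_transform (Suc N) a b = grid_sum m (\<lambda>i j. (1/5) * (?g i j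
      + char_mod m a * ?g (i - 1) j + char_mod m (- a) * ?g (i + 1) j
      + char_mod m b * ?g i (j - 1) + char_mod m (- b) * ?g i (j + 1)))"
    unfolding abelian_transform_def central_transform_Suc twisted_step_def
    by (rule arg_cong[where f = "grid_sum m"], intro ext, unfold g)
      (simp add: distrib_right add_divide_distrib)
  also have "\<dots> = (1/5) * (1 + char_mod m a + char_mod m (- a) + char_mod m b + char_mod m (- b)) * abelian_transform N a b"
    unfolding grid_sum_algebra grid_sum_shift[OF per] abelian_transform_def[symmetric] by (simp add: algebra_simps)
  also have "(1/5) * (1 + char_mod m a + char_mod m (- a) + char_mod m b + char_mod m (- b))
      = complex_of_real (abelian_eigenvalue a b)"
    using char_mod_plus_cnj[of a] char_mod_plus_cnj[of b] by (simp add: abelian_eigenvalue_def add.assoc)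
  finally show ?case by (simp add: Suc)
qed

lemma energy_abelian: "real m ^ 2 * energy m (central_transform 0 N) = (\<Sum>a\<in>Z. \<Sum>b\<in>Z. abelian_eigenvalue a b ^ (2 * N))"
proof -
  let ?f = "central_transform 0 N"
  have "(\<Sum>b\<in>Z. \<Sum>a\<in>Z. abelian_eigenvalue a b ^ (2 * N))
      = (\<Sum>b\<in>Z. \<Sum>a\<in>Z. (cmod (\<Sum>i\<in>Z. (\<Sum>j\<in>Z. ?f i j * char_mod m (b * j)) * char_mod m (a * i)))\<^sup>2)"
  proof (intro sum.cong refl)
    fix a b
    have "(\<Sum>i\<in>Z. (\<Sum>j\<in>Z. ?f i j * char_mod m (b * j)) * char_mod m (a * i)) = abelian_transform N a b"
      by (simp add: abelian_transform_def grid_sum_def sum_distrib_right sum_distrib_left mult_ac)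
    then show "abelian_eigenvalue a b ^ (2 * N)
        = (cmod (\<Sum>i\<in>Z. (\<Sum>j\<in>Z. ?f i j * char_mod m (b * j)) * char_mod m (a * i)))\<^sup>2"
      by (simp add: abelian_transform_eq norm_power power_even_abs flip: power_mult power_abs)
        (simp add: mult.commute power_mult power2_eq_square abs_mult_self_eq flip: power_mult_distrib)
  qed
  also have "\<dots> = (\<Sum>b\<in>Z. m * (\<Sum>i\<in>Z. (cmod (\<Sum>j\<in>Z. ?f i j * char_mod m (b * j)))\<^sup>2))"
    by (simp only: parseval_mod[OF m_pos])
  also have "\<dots> = m * (\<Sum>i\<in>Z. \<Sum>b\<in>Z. (cmod (\<Sum>j\<in>Z. ?f i j * char_mod m (b * j)))\<^sup>2)"
    by (subst sum.swap) (simp add: sum_distrib_left)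
  also have "\<dots> = m * (\<Sum>i\<in>Z. m * (\<Sum>j\<in>Z. (cmod (?f i j))\<^sup>2))"
    by (simp only: parseval_mod[OF m_pos])
  also have "\<dots> = real m ^ 2 * energy m ?f"
    by (simp add: energy_def grid_sum_def sum_distrib_left power2_eq_square mult.assoc)
  finally show ?thesis by (subst sum.swap) simp
qed

text \<open>Plancherel: the central characters split the walk into the walk on the abelianization and
  twisted walks, which contract at a rate of order \<open>1 / m\<close>.\<close>

lemma l2_excess_heisenberg:
  "l2_excess (heisenberg_walk m) N
    \<le> (\<Sum>(a, b)\<in>Z \<times> Z - {(0, 0)}. abelian_eigenvalue a b ^ (2 * N)) + m ^ 3 * (1 - 4 / (25 * (m + 2))) ^ N"
proof -
  let ?P = "\<lambda>a. energy m (central_transform a N)"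
  have "real m ^ 3 * (\<Sum>i\<in>Z. \<Sum>j\<in>Z. \<Sum>k\<in>Z. (walk_prob N i j k)\<^sup>2)
      = real m ^ 2 * (\<Sum>i\<in>Z. \<Sum>j\<in>Z. m * (\<Sum>k\<in>Z. (cmod (walk_prob N i j k))\<^sup>2))"
    by (simp add: sum_distrib_left[symmetric] power3_eq_cube power2_eq_square)
  also have "\<dots> = real m ^ 2 * (\<Sum>i\<in>Z. \<Sum>j\<in>Z. \<Sum>a\<in>Z. (cmod (central_transform a N i j))\<^sup>2)"
    by (simp only: parseval_mod[OF m_pos, symmetric] central_transform_def)
  also have "(\<Sum>i\<in>Z. \<Sum>j\<in>Z. \<Sum>a\<in>Z. (cmod (central_transform a N i j))\<^sup>2) = (\<Sum>a\<in>Z. ?P a)"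
  proof -
    have "(\<Sum>i\<in>Z. \<Sum>j\<in>Z. \<Sum>a\<in>Z. (cmod (central_transform a N i j))\<^sup>2)
        = (\<Sum>i\<in>Z. \<Sum>a\<in>Z. \<Sum>j\<in>Z. (cmod (central_transform a N i j))\<^sup>2)"
      by (rule sum.cong[OF refl], rule sum.swap)
    also have "\<dots> = (\<Sum>a\<in>Z. ?P a)" by (subst sum.swap) (simp add: energy_def grid_sum_def)
    finally show ?thesis .
  qed
  also have "\<dots> = ?P 0 + (\<Sum>a\<in>Z - {0}. ?P a)"
    using m_pos by (subst sum.remove[of _ 0]) auto
  also have "real m ^ 2 * (?P 0 + (\<Sum>a\<in>Z - {0}. ?P a))
      \<le> real m ^ 2 * (?P 0 + (\<Sum>a\<in>Z - {0}. (1 - 4 / (25 * (m + 2))) ^ N))"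
    by (intro mult_left_mono add_left_mono sum_mono energy_central_transform_le) auto
  also have "\<dots> = real m ^ 2 * ?P 0 + real m ^ 2 * (real (m - 1) * (1 - 4 / (25 * (m + 2))) ^ N)"
    using m_pos by (simp add: distrib_left)
  also have "\<dots> \<le> real m ^ 2 * ?P 0 + real m ^ 2 * (real m * (1 - 4 / (25 * (m + 2))) ^ N)"
    by (intro add_left_mono mult_left_mono mult_right_mono zero_le_power) (auto simp: field_simps)
  also have "real m ^ 2 * ?P 0 = 1 + (\<Sum>(a, b)\<in>Z \<times> Z - {(0, 0)}. abelian_eigenvalue a b ^ (2 * N))"
    unfolding energy_abelian sum.cartesian_product
    by (subst sum.remove[of _ "(0, 0)"]) (use m_pos in \<open>auto simp: abelian_eigenvalue_def\<close>)
  finally show ?thesis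
    by (simp add: l2_excess_def heisenberg_walk_def card_H sum_H walk_prob_def power3_eq_cube power2_eq_square mult_ac)
qed

end

subsection \<open>Decay of the distance to uniformity\<close>

lemma one_minus_cos_le: "1 - cos t \<le> t\<^sup>2 / 2" for t :: real
proof -
  obtain s where "cos t = (\<Sum>k<2. cos_coeff k * t ^ k) + cos (s + 1/2 * real 2 * pi) / fact 2 * t ^ 2"
    using Maclaurin_cos_expansion[of t 2] by blast
  then have "1 - cos t = cos s * t\<^sup>2 / 2"
    by (simp add: cos_coeff_def eval_nat_numeral)
  also have "\<dots> \<le> 1 * t\<^sup>2 / 2" by (intro divide_right_mono mult_right_mono) auto
  finally show ?thesis by simp
qed

lemma one_minus_cos_ge:
  fixes t :: real
  assumes "\<bar>t\<bar> \<le> pi" shows "t\<^sup>2 / 12 \<le> 1 - cos t"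
proof -
  obtain s where "cos t = (\<Sum>k<4. cos_coeff k * t ^ k) + cos (s + 1/2 * real 4 * pi) / fact 4 * t ^ 4"
    using Maclaurin_cos_expansion[of t 4] by blast
  then have "1 - cos t = t\<^sup>2 / 2 - cos s * t ^ 4 / 24"
    by (simp add: cos_coeff_def lessThan_nat_numeral fact_numeral)
  moreover have "cos s * t ^ 4 \<le> 1 * t ^ 4" by (intro mult_right_mono) auto
  moreover have "t ^ 4 \<le> 10 * t\<^sup>2"
  proof -
    have "\<bar>t\<bar> ^ 2 \<le> (3.15) ^ 2" using assms pi_approx(2) by (intro power_mono) auto
    then have "t\<^sup>2 * t\<^sup>2 \<le> 10 * t\<^sup>2" by (intro mult_right_mono) (auto simp: power2_eq_square)
    then show ?thesis by (simp add: eval_nat_numeral)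
  qed
  ultimately show ?thesis by simp
qed

lemma power_le_exp:
  fixes x :: real assumes "0 \<le> 1 - x" shows "(1 - x) ^ n \<le> exp (- (n * x))"
proof -
  have "(1 - x) ^ n \<le> exp (- x) ^ n"
    using assms exp_ge_add_one_self[of "- x"] by (intro power_mono) auto
  then show ?thesis by (simp add: exp_of_nat_mult[symmetric])
qed

text \<open>The nontrivial central characters contribute at most \<open>m ^ 3\<close> times a power of the contraction
  factor; at time \<open>m\<^sup>2\<close> this power is exponentially small in \<open>m\<close>. The constant is \<open>75 ^ 3\<close>.\<close>

lemma cube_exp_le:
  fixes x :: real assumes "0 \<le> x" shows "x ^ 3 * exp (- (x / 25)) \<le> 421875"
proof -
  have "(1 + (x / 25) / real 3) ^ 3 \<le> exp (x / 25)"
    by (rule exp_ge_one_plus_x_over_n_power_n) (use assms in auto)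
  moreover have "((x / 25) / real 3) ^ 3 \<le> (1 + (x / 25) / real 3) ^ 3"
    using assms by (intro power_mono) auto
  ultimately have "x ^ 3 / 421875 \<le> exp (x / 25)" by (simp add: power_divide)
  then show ?thesis by (simp add: exp_minus field_simps)
qed

lemma exp_le_one_minus:
  fixes x :: real
  assumes "0 \<le> x" "x \<le> 1 / 2" shows "exp (- (2 * x)) \<le> 1 - x"
proof -
  have "- x - 2 * x\<^sup>2 \<le> ln (1 - x)"
    using assms by (intro ln_one_minus_pos_lower_bound) auto
  moreover have "x * x \<le> x * (1 / 2)" using assms by (intro mult_left_mono) auto
  ultimately have "- (2 * x) \<le> ln (1 - x)" by (simp add: power2_eq_square)
  then have "exp (- (2 * x)) \<le> exp (ln (1 - x))" by (simp only: exp_le_cancel_iff)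
  then show ?thesis using assms by simp
qed

text \<open>A bound for the sum of the abelian modes at time \<open>m\<^sup>2\<close>: these decay at least like
  \<open>exp (- (\<bar>a\<bar> + \<bar>b\<bar>) / 4)\<close> in the representatives of \<open>a\<close> and \<open>b\<close> closest to \<open>0\<close>, and each of the two
  factors is dominated by two geometric series.\<close>

definition mode_bound :: real where
  "mode_bound = (2 / (1 - exp (- 1 / 4)))\<^sup>2"

lemma slow_gap_le: "slow_gap m \<le> 8 / real m ^ 2"
proof -
  have "(2 * pi / m)\<^sup>2 / 2 \<le> 20 / real m ^ 2"
  proof -
    have "pi\<^sup>2 \<le> (3.15)\<^sup>2" using pi_approx(2) by (intro power_mono) auto
    then have "pi\<^sup>2 \<le> 10" by (simp add: power2_eq_square)
    then show ?thesis by (simp add: power_divide power_mult_distrib divide_right_mono)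
  qed
  then show ?thesis using one_minus_cos_le[of "2 * pi / m"] by (simp add: slow_gap_def)
qed

context heisenberg begin

text \<open>The distance of \<open>a\<close> to the nearest multiple of \<open>m\<close>, for \<open>a\<close> in one period.\<close>

definition fold_mod :: "int \<Rightarrow> int" where
  "fold_mod a = min a (int m - a)"

lemma cos_fold_mod: "cos (2 * pi * of_int (fold_mod a) / m) = cos (2 * pi * of_int a / m)"
proof -
  have "cos (2 * pi * of_int (int m - a) / m) = cos (2 * pi - 2 * pi * of_int a / m)"
    using m_pos by (simp add: diff_divide_distrib right_diff_distrib)
  then show ?thesis by (simp add: fold_mod_def min_def cos_diff)
qed

lemma fold_mod_range:
  "a \<in> Z \<Longrightarrow> 0 \<le> fold_mod a" "2 * fold_mod a \<le> int m" "a \<in> Z - {0} \<Longrightarrow> 1 \<le> fold_mod a"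
  by (auto simp: fold_mod_def min_def)

lemma fold_angle:
  assumes "a \<in> Z"
  shows "0 \<le> 2 * pi * of_int (fold_mod a) / m" "2 * pi * of_int (fold_mod a) / m \<le> pi"
proof -
  have "pi * real_of_int (2 * fold_mod a) \<le> pi * real m"
  proof (rule mult_left_mono)
    show "real_of_int (2 * fold_mod a) \<le> real m"
      using fold_mod_range(2)[of a] by linarith
  qed simp
  then show "2 * pi * of_int (fold_mod a) / m \<le> pi" using m_pos by (simp add: field_simps)
  show "0 \<le> 2 * pi * of_int (fold_mod a) / m" using fold_mod_range(1)[OF assms] by simp
qed

lemma one_minus_cos_mod_ge:
  assumes "a \<in> Z"
  shows "3 * (real_of_int (fold_mod a))\<^sup>2 / real m ^ 2 \<le> 1 - cos (2 * pi * of_int a / m)"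
proof -
  have "36 \<le> (2 * pi)\<^sup>2"
    using power_mono[of 6 "2 * pi" 2] pi_gt3 by simp
  then have "36 * (real_of_int (fold_mod a) / m)\<^sup>2 \<le> (2 * pi)\<^sup>2 * (real_of_int (fold_mod a) / m)\<^sup>2"
    by (intro mult_right_mono) auto
  then have "3 * (real_of_int (fold_mod a) / m)\<^sup>2 \<le> (2 * pi)\<^sup>2 * (real_of_int (fold_mod a) / m)\<^sup>2 / 12"
    by linarith
  moreover have "3 * (real_of_int (fold_mod a) / m)\<^sup>2 = 3 * (real_of_int (fold_mod a))\<^sup>2 / real m ^ 2"
    by (simp add: power_divide)
  moreover have "(2 * pi)\<^sup>2 * (real_of_int (fold_mod a) / m)\<^sup>2 = (2 * pi * of_int (fold_mod a) / m)\<^sup>2"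
    by (simp add: power_divide power_mult_distrib)
  ultimately have "3 * (real_of_int (fold_mod a))\<^sup>2 / real m ^ 2 \<le> (2 * pi * of_int (fold_mod a) / m)\<^sup>2 / 12"
    by simp
  also have "\<dots> \<le> 1 - cos (2 * pi * of_int (fold_mod a) / m)"
    using fold_angle[OF assms] by (intro one_minus_cos_ge) auto
  finally show ?thesis by (simp only: cos_fold_mod)
qed

lemma slow_gap_ge: "1 / real m ^ 2 \<le> slow_gap m"
proof -
  have "fold_mod 1 = 1" using m3 by (simp add: fold_mod_def)
  then have "3 / real m ^ 2 \<le> 1 - cos (2 * pi / m)"
    using one_minus_cos_mod_ge[of 1] m3 by simp
  then have "2 / 5 * (3 / real m ^ 2) \<le> slow_gap m"
    unfolding slow_gap_def by (rule mult_left_mono) simp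
  moreover have "1 / real m ^ 2 \<le> 2 / 5 * (3 / real m ^ 2)" using m_pos by (simp add: field_simps)
  ultimately show ?thesis by (rule order.trans[rotated])
qed

lemma slow_gap_range: "0 < slow_gap m" "slow_gap m \<le> 4 / 5"
proof -
  have "0 < 1 / real m ^ 2" using m_pos by simp
  then show "0 < slow_gap m" using slow_gap_ge by linarith
  show "slow_gap m \<le> 4 / 5" unfolding slow_gap_def using cos_ge_minus_one[of "2 * pi / m"] by argo
qed

definition fold_norm :: "int \<Rightarrow> int \<Rightarrow> real" where
  "fold_norm a b = (real_of_int (fold_mod a))\<^sup>2 + (real_of_int (fold_mod b))\<^sup>2"

text \<open>With the eigenvalue written as \<open>1 - u\<close>, where \<open>0 \<le> u \<le> 8 / 5\<close>, the estimate \<open>\<bar>1 - u\<bar> \<le> 1 - u / 4\<close>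
  covers the negative eigenvalues as well; the holding probability \<open>1 / 5\<close> keeps them away from \<open>-1\<close>.\<close>

lemma abelian_eigenvalue_power_le:
  assumes ab: "a \<in> Z" "b \<in> Z"
  shows "abelian_eigenvalue a b ^ (2 * N) \<le> exp (- (real N / real m ^ 2 * fold_norm a b / 2))"
proof -
  define u where "u = 2 / 5 * ((1 - cos (2 * pi * of_int a / m)) + (1 - cos (2 * pi * of_int b / m)))"
  have eig: "abelian_eigenvalue a b = 1 - u" by (simp add: abelian_eigenvalue_def u_def field_simps)
  have u: "0 \<le> u" "u \<le> 8 / 5"
    unfolding u_def using cos_le_one[of "2 * pi * of_int a / m"] cos_le_one[of "2 * pi * of_int b / m"]
      cos_ge_minus_one[of "2 * pi * of_int a / m"] cos_ge_minus_one[of "2 * pi * of_int b / m"]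
    by argo+
  have u_ge: "6 / 5 * fold_norm a b / real m ^ 2 \<le> u"
  proof -
    have "6 / 5 * fold_norm a b / real m ^ 2
        = 2 / 5 * (3 * (real_of_int (fold_mod a))\<^sup>2 / real m ^ 2 + 3 * (real_of_int (fold_mod b))\<^sup>2 / real m ^ 2)"
      by (simp add: fold_norm_def add_divide_distrib distrib_left)
    also have "\<dots> \<le> u"
      unfolding u_def by (intro mult_left_mono add_mono one_minus_cos_mod_ge ab) simp
    finally show ?thesis .
  qed
  have "abelian_eigenvalue a b ^ (2 * N) = \<bar>1 - u\<bar> ^ (2 * N)"
    by (simp add: eig power_even_abs)
  also have "\<dots> \<le> (1 - u / 4) ^ (2 * N)" using u by (intro power_mono) auto
  also have "\<dots> \<le> exp (- (real (2 * N) * (u / 4)))" using u by (intro power_le_exp) auto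
  also have "\<dots> \<le> exp (- (real N / real m ^ 2 * fold_norm a b / 2))"
  proof -
    have "real N * (fold_norm a b / real m ^ 2) \<le> real N * u"
    proof (rule mult_left_mono)
      have "0 \<le> fold_norm a b / real m ^ 2" by (simp add: fold_norm_def)
      then show "fold_norm a b / real m ^ 2 \<le> u" using u_ge by simp
    qed simp
    then show ?thesis by (simp add: mult.commute)
  qed
  finally show ?thesis .
qed

lemma sum_exp_fold_mod_le: "(\<Sum>a\<in>Z. exp (- (real_of_int (fold_mod a) / 4))) \<le> 2 / (1 - exp (- 1 / 4))"
proof -
  let ?q = "exp (- 1 / 4) :: real"
  have q: "0 < ?q" "?q < 1" by simp_all
  have geo: "(\<Sum>k<n. ?q ^ k) \<le> 1 / (1 - ?q)" for n
    using q by (simp add: sum_gp_strict divide_right_mono)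
  have ex: "exp (- (real k / 4)) = ?q ^ k" for k by (simp add: exp_of_nat_mult[symmetric])
  have Z: "Z = int ` {..<m}" by (simp add: image_int_atLeastLessThan lessThan_atLeast0)
  have "(\<Sum>a\<in>Z. exp (- (real_of_int (fold_mod a) / 4)))
      = (\<Sum>k<m. exp (- (real_of_int (fold_mod (int k)) / 4)))"
    unfolding Z by (subst sum.reindex) auto
  also have "\<dots> \<le> (\<Sum>k<m. ?q ^ k + ?q ^ (m - Suc k))"
  proof (rule sum_mono)
    fix k assume k: "k \<in> {..<m}"
    have "exp (- (real_of_int (fold_mod (int k)) / 4)) \<le> max (?q ^ k) (?q ^ (m - k))"
    proof (cases "2 * k \<le> m")
      case True
      then have "fold_mod (int k) = int k" by (simp add: fold_mod_def)
      then show ?thesis using ex[of k] by simp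
    next
      case False
      then have "fold_mod (int k) = int (m - k)" using k by (simp add: fold_mod_def)
      then show ?thesis using ex[of "m - k"] by simp
    qed
    also have "max (?q ^ k) (?q ^ (m - k)) \<le> ?q ^ k + ?q ^ (m - Suc k)"
    proof -
      have "?q ^ (m - k) \<le> ?q ^ (m - Suc k)" using q by (intro power_decreasing) auto
      moreover have "0 \<le> ?q ^ k" "0 \<le> ?q ^ (m - Suc k)" by simp_all
      ultimately show ?thesis by argo
    qed
    finally show "exp (- (real_of_int (fold_mod (int k)) / 4)) \<le> ?q ^ k + ?q ^ (m - Suc k)" .
  qed
  also have "\<dots> = (\<Sum>k<m. ?q ^ k) + (\<Sum>k<m. ?q ^ k)"
    by (simp only: sum.distrib sum.nat_diff_reindex)
  also have "\<dots> \<le> 1 / (1 - ?q) + 1 / (1 - ?q)" by (intro add_mono geo)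
  finally show ?thesis by simp
qed

lemma abelian_sum_le:
  assumes N: "m ^ 2 \<le> N"
  shows "(\<Sum>(a, b)\<in>Z \<times> Z - {(0, 0)}. abelian_eigenvalue a b ^ (2 * N))
    \<le> mode_bound * exp (- (real N / (4 * real m ^ 2)))"
proof -
  define \<tau> where "\<tau> = real N / real m ^ 2"
  have "real m ^ 2 \<le> real N" using N by (metis of_nat_le_iff of_nat_power)
  then have \<tau>: "1 \<le> \<tau>" using m_pos by (simp add: \<tau>_def)
  let ?x = "\<lambda>a. exp (- (real_of_int (fold_mod a) / 4))"
  have "(\<Sum>(a, b)\<in>Z \<times> Z - {(0, 0)}. abelian_eigenvalue a b ^ (2 * N))
      \<le> (\<Sum>(a, b)\<in>Z \<times> Z - {(0, 0)}. exp (- (\<tau> / 4)) * (?x a * ?x b))"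
  proof (rule sum_mono)
    fix ab assume "ab \<in> Z \<times> Z - {(0, 0)}"
    then obtain a b where p: "ab = (a, b)" and ab: "a \<in> Z" "b \<in> Z" and ne: "\<not> (a = 0 \<and> b = 0)"
      by (cases ab) auto
    let ?s = "fold_norm a b"
    have sq: "real_of_int n \<le> (real_of_int n)\<^sup>2" for n
    proof -
      have "0 \<le> n * (n - 1)" by (cases "n \<le> 0") (auto simp: zero_le_mult_iff)
      then have "n \<le> n\<^sup>2" by (simp add: power2_eq_square algebra_simps)
      then show ?thesis by (metis of_int_le_iff of_int_power)
    qed
    have s: "real_of_int (fold_mod a) + real_of_int (fold_mod b) \<le> ?s"
      unfolding fold_norm_def by (intro add_mono sq)
    moreover have "1 \<le> fold_mod a + fold_mod b"
      using fold_mod_range(1)[of a] fold_mod_range(1)[of b] fold_mod_range(3)[of a] fold_mod_range(3)[of b] ab ne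
      by (cases "a = 0") auto
    then have "1 \<le> real_of_int (fold_mod a) + real_of_int (fold_mod b)" by linarith
    ultimately have s1: "1 \<le> ?s" by linarith
    have "0 \<le> (\<tau> - 1) * (?s - 1)" using s1 \<tau> by (intro mult_nonneg_nonneg) auto
    then have "\<tau> + ?s \<le> 2 * (\<tau> * ?s)"
      using mult_mono[OF \<tau> s1] \<tau> by (simp add: algebra_simps)
    then have "abelian_eigenvalue a b ^ (2 * N) \<le> exp (- (\<tau> / 4) + (- (?s / 4)))"
      by (intro order.trans[OF abelian_eigenvalue_power_le[OF ab]]) (simp add: \<tau>_def)
    also have "\<dots> \<le> exp (- (\<tau> / 4) + (- (real_of_int (fold_mod a) / 4) + - (real_of_int (fold_mod b) / 4)))"
      using s by simp
    finally have "abelian_eigenvalue a b ^ (2 * N) \<le> exp (- (\<tau> / 4)) * (?x a * ?x b)"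
      by (simp only: exp_add)
    then show "(case ab of (a, b) \<Rightarrow> abelian_eigenvalue a b ^ (2 * N)) \<le> (case ab of (a, b) \<Rightarrow> exp (- (\<tau> / 4)) * (?x a * ?x b))"
      by (simp only: p prod.case)
  qed
  also have "\<dots> \<le> (\<Sum>(a, b)\<in>Z \<times> Z. exp (- (\<tau> / 4)) * (?x a * ?x b))"
    by (rule sum_mono2) auto
  also have "\<dots> = exp (- (\<tau> / 4)) * ((\<Sum>a\<in>Z. ?x a) * (\<Sum>b\<in>Z. ?x b))"
  proof -
    have "(\<Sum>a\<in>Z. ?x a) * (\<Sum>b\<in>Z. ?x b) = (\<Sum>(a, b)\<in>Z \<times> Z. ?x a * ?x b)"
      by (simp only: sum_product sum.cartesian_product)
    then show ?thesis by (simp only: sum_distrib_left case_prod_unfold)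
  qed
  also have "\<dots> \<le> exp (- (\<tau> / 4)) * mode_bound"
    unfolding mode_bound_def power2_eq_square
    by (intro mult_left_mono mult_mono sum_exp_fold_mod_le sum_nonneg) auto
  finally show ?thesis by (simp add: \<tau>_def mult.commute)
qed

lemma nonabelian_bound:
  assumes N: "m ^ 2 \<le> N"
  shows "m ^ 3 * (1 - 4 / (25 * (m + 2))) ^ N \<le> 421875 * exp (- (real N / (25 * real m ^ 2)))"
proof -
  have mN: "real m ^ 2 \<le> real N" using N by (metis of_nat_le_iff of_nat_power)
  have "(1 - 4 / (25 * (real m + 2))) ^ N \<le> exp (- (real N * (4 / (25 * (real m + 2)))))"
    by (rule power_le_exp) (simp add: field_simps)
  also have "\<dots> \<le> exp (- (real m / 25) + - (real N / (25 * real m ^ 2)))"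
  proof -
    have "2 / real m \<le> 4 / (real m + 2)" using m3 by (simp add: field_simps)
    then have "real N * (2 / real m) \<le> real N * (4 / (real m + 2))" by (rule mult_left_mono) simp
    moreover have "real m \<le> real N / real m" using mN m_pos by (simp add: field_simps power2_eq_square)
    moreover have "real N / real m ^ 2 \<le> real N / real m"
      using m3 by (intro divide_left_mono) (auto simp: power2_eq_square)
    moreover have "real N * (2 / real m) = real N / real m + real N / real m" by simp
    ultimately have "real m + real N / real m ^ 2 \<le> real N * (4 / (real m + 2))" by linarith
    then have "(real m + real N / real m ^ 2) / 25 \<le> real N * (4 / (real m + 2)) / 25"
      by (rule divide_right_mono) simp
    moreover have "real N * (4 / (real m + 2)) / 25 = real N * (4 / (25 * (real m + 2)))" by simp
    moreover have "(real m + real N / real m ^ 2) / 25 = real m / 25 + real N / (25 * real m ^ 2)"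
      by (simp add: add_divide_distrib mult.commute)
    ultimately have "real m / 25 + real N / (25 * real m ^ 2) \<le> real N * (4 / (25 * (real m + 2)))"
      by (simp only:)
    moreover have "- c \<le> - a + - b" if "a + b \<le> c" for a b c :: real using that by simp
    ultimately show ?thesis unfolding exp_le_cancel_iff by blast
  qed
  also have "\<dots> = exp (- (real m / 25)) * exp (- (real N / (25 * real m ^ 2)))" by (rule exp_add)
  finally have "real m ^ 3 * (1 - 4 / (25 * (real m + 2))) ^ N
      \<le> real m ^ 3 * (exp (- (real m / 25)) * exp (- (real N / (25 * real m ^ 2))))"
    by (rule mult_left_mono) simp
  also have "\<dots> \<le> 421875 * exp (- (real N / (25 * real m ^ 2)))"
    unfolding mult.assoc[symmetric] by (intro mult_right_mono cube_exp_le) auto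
  finally show ?thesis by (simp add: add.commute)
qed

text \<open>Enough wherever the rate of decay matters only up to a constant factor: for separated time scales,
  and for the boundedly many coordinates with small modulus when the time scales cluster.\<close>

lemma l2_excess_le_crude:
  assumes N: "m ^ 2 \<le> N"
  shows "l2_excess (heisenberg_walk m) N \<le> (mode_bound + 421875) * exp (- (real N / (25 * real m ^ 2)))"
proof -
  have "exp (- (real N / (4 * real m ^ 2))) \<le> exp (- (real N / (25 * real m ^ 2)))"
    using m_pos by (simp add: field_simps)
  then have "mode_bound * exp (- (real N / (4 * real m ^ 2))) \<le> mode_bound * exp (- (real N / (25 * real m ^ 2)))"
    by (rule mult_left_mono) (simp add: mode_bound_def)
  then show ?thesis
    using l2_excess_heisenberg[of N] abelian_sum_le[OF N] nonabelian_bound[OF N]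
    by (simp add: distrib_right)
qed

text \<open>For \<open>m \<ge> 4\<close> the largest nontrivial eigenvalue \<open>1 - slow_gap m\<close> is at least \<open>3 / 5\<close>, which also dominates
  the negative eigenvalues.\<close>

lemma abs_abelian_eigenvalue_le:
  assumes m4: "4 \<le> m" and ab: "a \<in> Z" "b \<in> Z" "(a, b) \<noteq> (0, 0)"
  shows "\<bar>abelian_eigenvalue a b\<bar> \<le> 1 - slow_gap m"
proof -
  have mono: "cos (2 * pi * of_int c / m) \<le> cos (2 * pi / m)" if c: "c \<in> Z - {0}" for c
  proof -
    have "2 * pi / m * 1 \<le> 2 * pi / m * of_int (fold_mod c)"
      using fold_mod_range(3)[OF c] by (intro mult_left_mono) auto
    then have "cos (2 * pi * of_int (fold_mod c) / m) \<le> cos (2 * pi / m)"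
      using fold_angle[of c] c by (intro cos_monotone_0_pi_le) auto
    then show ?thesis by (simp only: cos_fold_mod)
  qed
  have "a \<in> Z - {0} \<or> b \<in> Z - {0}" using ab by auto
  then have up: "cos (2 * pi * of_int a / m) + cos (2 * pi * of_int b / m) \<le> 1 + cos (2 * pi / m)"
    using mono[of a] mono[of b] cos_le_one[of "2 * pi * of_int a / m"] cos_le_one[of "2 * pi * of_int b / m"]
    by linarith
  have "2 * pi / m \<le> pi / 2" using m4 by (simp add: field_simps)
  then have "0 \<le> cos (2 * pi / m)" using m_pos by (intro cos_ge_zero) (auto intro: order.trans[of _ 0])
  then show ?thesis
    unfolding abelian_eigenvalue_def slow_gap_def abs_le_iff
    using up cos_ge_minus_one[of "2 * pi * of_int a / m"] cos_ge_minus_one[of "2 * pi * of_int b / m"]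
    by (intro conjI) argo+
qed

lemma slow_power_ge:
  assumes "4 \<le> m"
  shows "exp (- 32) \<le> (1 - slow_gap m) ^ (2 * m ^ 2)"
proof -
  have half: "slow_gap m \<le> 1 / 2"
  proof -
    have "8 / real m ^ 2 \<le> 8 / 4 ^ 2" using assms by (intro divide_left_mono power_mono) auto
    then show ?thesis using slow_gap_le[of m] by simp
  qed
  have "real (2 * m ^ 2) * (2 * slow_gap m) \<le> real (2 * m ^ 2) * (2 * (8 / real m ^ 2))"
    using slow_gap_le[of m] by (intro mult_left_mono) auto
  then have "real (2 * m ^ 2) * (2 * slow_gap m) \<le> 32" using m_pos by simp
  then have "exp (- 32) \<le> exp (real (2 * m ^ 2) * - (2 * slow_gap m))"
    unfolding exp_le_cancel_iff by simp
  also have "\<dots> = exp (- (2 * slow_gap m)) ^ (2 * m ^ 2)" by (rule exp_of_nat_mult)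
  also have "\<dots> \<le> (1 - slow_gap m) ^ (2 * m ^ 2)"
    using slow_gap_range half by (intro power_mono exp_le_one_minus) auto
  finally show ?thesis .
qed

text \<open>From time \<open>m\<^sup>2\<close> on, every abelian mode decays at least as fast as the slowest one, so the bounded distance
  at time \<open>m\<^sup>2\<close> propagates with the exact rate; the constant \<open>exp 32\<close> makes up for the time \<open>m\<^sup>2\<close>. The
  nonabelian part has a gap of order \<open>1 / m\<close>, which exceeds the slow gap with room to spare once
  \<open>m \<ge> 400\<close>. The matching rate is what makes the upper and the lower bound for the cutoff time agree.\<close>

lemma l2_excess_le_sharp:
  assumes N: "m ^ 2 \<le> N" and m400: "400 \<le> m"
  shows "l2_excess (heisenberg_walk m) N \<le> (mode_bound * exp 32 + 421875) * (1 - slow_gap m) ^ (2 * N)"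
proof -
  let ?\<beta> = "1 - slow_gap m"
  have \<beta>: "0 \<le> ?\<beta>" using slow_gap_range by simp
  have m4: "4 \<le> m" using m400 by simp
  have split: "2 * N = 2 * m ^ 2 + 2 * (N - m ^ 2)" using N by simp
  have "(\<Sum>(a, b)\<in>Z \<times> Z - {(0, 0)}. abelian_eigenvalue a b ^ (2 * N))
      \<le> (\<Sum>(a, b)\<in>Z \<times> Z - {(0, 0)}. abelian_eigenvalue a b ^ (2 * m ^ 2) * ?\<beta> ^ (2 * (N - m ^ 2)))"
  proof (rule sum_mono)
    fix ab assume "ab \<in> Z \<times> Z - {(0, 0)}"
    then obtain a b where p: "ab = (a, b)" and ab: "a \<in> Z" "b \<in> Z" and ne: "\<not> (a = 0 \<and> b = 0)"
      by (cases ab) auto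
    have "abelian_eigenvalue a b ^ (2 * N) = \<bar>abelian_eigenvalue a b\<bar> ^ (2 * N)"
      by (simp add: power_even_abs)
    also have "\<dots> = \<bar>abelian_eigenvalue a b\<bar> ^ (2 * m ^ 2) * \<bar>abelian_eigenvalue a b\<bar> ^ (2 * (N - m ^ 2))"
      by (subst split) (rule power_add)
    also have "\<dots> \<le> \<bar>abelian_eigenvalue a b\<bar> ^ (2 * m ^ 2) * ?\<beta> ^ (2 * (N - m ^ 2))"
      using ab ne by (intro mult_left_mono power_mono abs_abelian_eigenvalue_le[OF m4]) auto
    finally have "abelian_eigenvalue a b ^ (2 * N) \<le> abelian_eigenvalue a b ^ (2 * m ^ 2) * ?\<beta> ^ (2 * (N - m ^ 2))"
      by (simp add: power_even_abs)
    then show "(case ab of (a, b) \<Rightarrow> abelian_eigenvalue a b ^ (2 * N)) \<le> (case ab of (a, b) \<Rightarrow> abelian_eigenvalue a b ^ (2 * m ^ 2) * ?\<beta> ^ (2 * (N - m ^ 2)))"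
      by (simp only: p prod.case)
  qed
  also have "\<dots> = (\<Sum>(a, b)\<in>Z \<times> Z - {(0, 0)}. abelian_eigenvalue a b ^ (2 * m ^ 2)) * ?\<beta> ^ (2 * (N - m ^ 2))"
    by (simp add: sum_distrib_right case_prod_unfold)
  also have "\<dots> \<le> mode_bound * ?\<beta> ^ (2 * (N - m ^ 2))"
  proof (rule mult_right_mono)
    have "(\<Sum>(a, b)\<in>Z \<times> Z - {(0, 0)}. abelian_eigenvalue a b ^ (2 * m ^ 2))
        \<le> mode_bound * exp (- (real (m ^ 2) / (4 * real m ^ 2)))"
      by (rule abelian_sum_le) simp
    also have "\<dots> \<le> mode_bound * 1" by (rule mult_left_mono) (auto simp: mode_bound_def)
    finally show "(\<Sum>(a, b)\<in>Z \<times> Z - {(0, 0)}. abelian_eigenvalue a b ^ (2 * m ^ 2)) \<le> mode_bound" by simp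
  qed (use \<beta> in simp)
  also have "\<dots> \<le> mode_bound * (exp 32 * ?\<beta> ^ (2 * N))"
  proof (rule mult_left_mono)
    have "exp (- 32) * ?\<beta> ^ (2 * (N - m ^ 2)) \<le> ?\<beta> ^ (2 * m ^ 2) * ?\<beta> ^ (2 * (N - m ^ 2))"
      using \<beta> by (intro mult_right_mono slow_power_ge[OF m4]) auto
    also have "\<dots> = ?\<beta> ^ (2 * N)" by (simp only: power_add[symmetric] split[symmetric])
    finally show "?\<beta> ^ (2 * (N - m ^ 2)) \<le> exp 32 * ?\<beta> ^ (2 * N)"
      by (simp add: exp_minus field_simps)
  qed (simp add: mode_bound_def)
  finally have abelian: "(\<Sum>(a, b)\<in>Z \<times> Z - {(0, 0)}. abelian_eigenvalue a b ^ (2 * N))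
      \<le> mode_bound * (exp 32 * ?\<beta> ^ (2 * N))" .
  have nonabelian: "real m ^ 3 * (1 - 4 / (25 * (real m + 2))) ^ N \<le> 421875 * ?\<beta> ^ (2 * N)"
  proof -
    \<comment> \<open>Half of the nonabelian gap pays for the rate of the slow mode, the other half for the factor \<open>m ^ 3\<close>.\<close>
    define h where "h = 2 / (25 * (real m + 2))"
    have h: "0 \<le> h" "h \<le> 1" by (auto simp: h_def field_simps)
    have mN: "real m ^ 2 \<le> real N" using N by (metis of_nat_le_iff of_nat_power)
    have "1 - 4 / (25 * (real m + 2)) = 1 - 2 * h" by (simp add: h_def)
    also have "\<dots> \<le> (1 - h) * (1 - h)" by (simp add: algebra_simps)
    also have "1 - h \<le> ?\<beta>\<^sup>2"
    proof -
      have "16 / real m ^ 2 \<le> h"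
      proof -
        have lin: "400 * (x + 2) \<le> 2 * y" if "400 * x \<le> y" "400 \<le> x" for x y :: real
          using that by argo
        have "400 * real m \<le> real m * real m" using m400 by (intro mult_right_mono) auto
        then have "400 * (real m + 2) \<le> 2 * real m ^ 2"
          unfolding power2_eq_square using m400 by (intro lin) auto
        then show ?thesis using m_pos by (simp add: h_def field_simps)
      qed
      then have "2 * slow_gap m \<le> h" using slow_gap_le[of m] by simp
      moreover have "?\<beta>\<^sup>2 = 1 - 2 * slow_gap m + (slow_gap m)\<^sup>2" by (simp add: power2_diff)
      moreover have "0 \<le> (slow_gap m)\<^sup>2" by simp
      ultimately show ?thesis by argo
    qed
    then have "(1 - h) * (1 - h) \<le> ?\<beta>\<^sup>2 * (1 - h)" using h by (intro mult_right_mono) auto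
    finally have base: "1 - 4 / (25 * (real m + 2)) \<le> ?\<beta>\<^sup>2 * (1 - h)" .
    have "(1 - 4 / (25 * (real m + 2))) ^ N \<le> (?\<beta>\<^sup>2 * (1 - h)) ^ N"
      by (intro power_mono base) (simp add: field_simps)
    also have "\<dots> = ?\<beta> ^ (2 * N) * (1 - h) ^ N" by (simp add: power_mult_distrib power_mult)
    also have "\<dots> \<le> ?\<beta> ^ (2 * N) * exp (- (real m / 25))"
    proof (rule mult_left_mono)
      have "(1 - h) ^ N \<le> exp (- (real N * h))" using h by (intro power_le_exp) auto
      also have "\<dots> \<le> exp (- (real m / 25))"
      proof -
        have "real m / 25 \<le> real m ^ 2 * h"
          using m3 by (simp add: h_def field_simps power2_eq_square)
        also have "\<dots> \<le> real N * h" using mN h by (intro mult_right_mono) auto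
        finally show ?thesis by simp
      qed
      finally show "(1 - h) ^ N \<le> exp (- (real m / 25))" .
    qed (use \<beta> in simp)
    finally have "real m ^ 3 * (1 - 4 / (25 * (real m + 2))) ^ N
        \<le> real m ^ 3 * (?\<beta> ^ (2 * N) * exp (- (real m / 25)))" by (rule mult_left_mono) simp
    also have "\<dots> = real m ^ 3 * exp (- (real m / 25)) * ?\<beta> ^ (2 * N)" by simp
    also have "\<dots> \<le> 421875 * ?\<beta> ^ (2 * N)"
      using \<beta> by (intro mult_right_mono cube_exp_le) auto
    finally show ?thesis .
  qed
  show ?thesis
    using l2_excess_heisenberg[of N] abelian nonabelian by (simp add: distrib_right add.commute)
qed

end

section \<open>Cutoff from a profile\<close>

lemma tv_mixing_time_le: "tv_dist W m \<le> \<epsilon> \<Longrightarrow> tv_mixing_time W \<epsilon> \<le> m"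
  unfolding tv_mixing_time_def by (rule Least_le)

lemma tv_mixing_time_attained: "tv_dist W m \<le> \<epsilon> \<Longrightarrow> tv_dist W (tv_mixing_time W \<epsilon>) \<le> \<epsilon>"
  unfolding tv_mixing_time_def by (rule LeastI)

text \<open>A mixing time is the first time at which the level is reached, so the lower bound has to exclude all
  times up to \<open>a * t n\<close>. The upper bound also shows that the levels are reached at all, which makes
  the least such time meaningful.\<close>

lemma has_tv_cutoffI:
  fixes t :: "nat \<Rightarrow> real"
  assumes t: "filterlim t at_top sequentially"
    and up: "\<And>a. 1 < a \<Longrightarrow> (\<lambda>n. tv_dist (F n) (nat \<lceil>a * t n\<rceil>)) \<longlonglongrightarrow> 0"
    and low: "\<And>a \<epsilon>. 0 < a \<Longrightarrow> a < 1 \<Longrightarrow> \<epsilon> < 1 \<Longrightarrow>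
      eventually (\<lambda>n. \<forall>m. real m \<le> a * t n \<longrightarrow> \<epsilon> < tv_dist (F n) m) sequentially"
  shows "has_tv_cutoff F"
proof -
  have t_ev: "eventually (\<lambda>n. c < t n) sequentially" for c
    using t by (simp add: filterlim_at_top_dense)
  have lower: "eventually (\<lambda>n. a * t n < tv_mixing_time (F n) \<epsilon>) sequentially"
    if \<epsilon>: "\<epsilon> \<in> {0<..<1}" and a: "0 < a" "a < 1" for \<epsilon> a
  proof -
    have "eventually (\<lambda>n. tv_dist (F n) (nat \<lceil>2 * t n\<rceil>) < \<epsilon>) sequentially"
      using order_tendstoD(2)[OF up[of 2]] \<epsilon> by simp
    moreover have "eventually (\<lambda>n. \<forall>m. real m \<le> a * t n \<longrightarrow> \<epsilon> < tv_dist (F n) m) sequentially"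
      using low[OF a, of \<epsilon>] \<epsilon> by simp
    ultimately show ?thesis
    proof eventually_elim
      case (elim n)
      then have "tv_dist (F n) (tv_mixing_time (F n) \<epsilon>) \<le> \<epsilon>"
        by (intro tv_mixing_time_attained[of _ "nat \<lceil>2 * t n\<rceil>"]) auto
      with elim show ?case by (meson not_less)
    qed
  qed
  have upper: "eventually (\<lambda>n. real (tv_mixing_time (F n) \<epsilon>) < a * t n) sequentially"
    if \<epsilon>: "\<epsilon> \<in> {0<..<1}" and a: "1 < a" for \<epsilon> a
  proof -
    define b where "b = (1 + a) / 2"
    have b: "1 < b" "b < a" using a by (auto simp: b_def)
    have "eventually (\<lambda>n. tv_dist (F n) (nat \<lceil>b * t n\<rceil>) < \<epsilon>) sequentially"
      using order_tendstoD(2)[OF up[OF b(1)]] \<epsilon> by simp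
    moreover have "eventually (\<lambda>n. 1 / (a - b) < t n) sequentially" by (rule t_ev)
    moreover have "eventually (\<lambda>n. 0 < t n) sequentially" by (rule t_ev)
    ultimately show ?thesis
    proof eventually_elim
      case (elim n)
      have "tv_mixing_time (F n) \<epsilon> \<le> nat \<lceil>b * t n\<rceil>"
        using elim by (intro tv_mixing_time_le) auto
      then have "real (tv_mixing_time (F n) \<epsilon>) \<le> real (nat \<lceil>b * t n\<rceil>)" by simp
      also have "0 < b * t n" using elim b by simp
      then have "real (nat \<lceil>b * t n\<rceil>) < b * t n + 1" by linarith
      also have "b * t n + 1 \<le> a * t n"
        using elim b by (simp add: field_simps)
      finally show ?case .
    qed
  qed
  have lim: "(\<lambda>n. real (tv_mixing_time (F n) \<epsilon>) / t n) \<longlonglongrightarrow> 1" if \<epsilon>: "\<epsilon> \<in> {0<..<1}" for \<epsilon>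
  proof (rule order_tendstoI)
    fix c :: real assume c: "c < 1"
    define a where "a = max c (1/2)"
    have a: "0 < a" "a < 1" "c \<le> a" using c by (auto simp: a_def)
    show "eventually (\<lambda>n. c < real (tv_mixing_time (F n) \<epsilon>) / t n) sequentially"
      using lower[OF \<epsilon> a(1,2)] t_ev[of 0]
    proof eventually_elim
      case (elim n)
      then have "a < real (tv_mixing_time (F n) \<epsilon>) / t n" by (simp add: field_simps)
      then show ?case using a by simp
    qed
  next
    fix c :: real assume c: "1 < c"
    show "eventually (\<lambda>n. real (tv_mixing_time (F n) \<epsilon>) / t n < c) sequentially"
      using upper[OF \<epsilon> c] t_ev[of 0] by eventually_elim (simp add: field_simps)
  qed
  show ?thesis unfolding has_tv_cutoff_def
  proof (intro conjI ballI)
    show "\<exists>\<epsilon>\<^sub>0\<in>{0<..<1}. filterlim (\<lambda>n. tv_mixing_time (F n) \<epsilon>\<^sub>0) at_top sequentially"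
    proof (rule bexI[of _ "1/2"])
      show "filterlim (\<lambda>n. tv_mixing_time (F n) (1/2)) at_top sequentially"
        unfolding filterlim_at_top
      proof
        fix Z :: nat
        show "eventually (\<lambda>n. Z \<le> tv_mixing_time (F n) (1/2)) sequentially"
          using lower[of "1/2" "1/2"] t_ev[of "2 * real Z"] by (auto elim: eventually_elim2)
      qed
    qed simp
  next
    fix \<epsilon> \<delta> :: real assume "\<epsilon> \<in> {0<..<1}" "\<delta> \<in> {0<..<1}"
    then have "(\<lambda>n. (real (tv_mixing_time (F n) \<epsilon>) / t n) / (real (tv_mixing_time (F n) \<delta>) / t n)) \<longlonglongrightarrow> 1 / 1"
      by (intro tendsto_divide lim) auto
    then have "(\<lambda>n. (real (tv_mixing_time (F n) \<epsilon>) / t n) / (real (tv_mixing_time (F n) \<delta>) / t n)) \<longlonglongrightarrow> 1"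
      by (simp only: div_by_1)
    moreover have "eventually (\<lambda>n. (real (tv_mixing_time (F n) \<epsilon>) / t n) / (real (tv_mixing_time (F n) \<delta>) / t n)
        = real (tv_mixing_time (F n) \<epsilon>) / real (tv_mixing_time (F n) \<delta>)) sequentially"
      using t_ev[of 0] by eventually_elim simp
    ultimately show "(\<lambda>n. real (tv_mixing_time (F n) \<epsilon>) / real (tv_mixing_time (F n) \<delta>)) \<longlonglongrightarrow> 1"
      by (rule Lim_transform_eventually)
  qed
qed

section \<open>The product of the Heisenberg walks\<close>

lemma exp_minus_mult_tendsto_0:
  fixes c :: real assumes "0 < c"
  shows "((\<lambda>x. exp (- (c * x))) \<longlongrightarrow> 0) at_top"
  using assms by real_asymp

locale heisenberg_products =
  fixes \<gamma> :: real
  assumes \<gamma>_pos: "0 < \<gamma>"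
begin

text \<open>The relaxation time of coordinate \<open>i\<close> is \<open>scale i\<close> up to bounded factors.\<close>

definition scale :: "nat \<Rightarrow> real" where
  "scale n = exp (real n powr \<gamma>)"

definition weight :: "nat \<Rightarrow> real" where
  "weight n = (real n)\<^sup>2 * exp (- (real n powr \<gamma>))"

definition rate :: "nat \<Rightarrow> nat \<Rightarrow> real" where
  "rate n i = weight i / (\<Sum>j=1..n. weight j)"

definition walk :: "nat \<Rightarrow> (int^3^3) random_walk" where
  "walk n = heisenberg_walk (n + 2)"

definition product :: "nat \<Rightarrow> (nat \<Rightarrow> int^3^3) random_walk" where
  "product n = product_walk {1..n} walk (rate n)"

definition total_weight :: real where
  "total_weight = (\<Sum>n. weight n)"

lemma scale_pos: "0 < scale n"
  by (simp add: scale_def)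

lemma scale_mono: "i \<le> n \<Longrightarrow> scale i \<le> scale n"
  using \<gamma>_pos by (simp add: scale_def powr_mono2)

lemma weight_nonneg: "0 \<le> weight n"
  by (simp add: weight_def)

lemma weight_eq: "weight n = (real n)\<^sup>2 / scale n"
  by (simp add: weight_def scale_def exp_minus divide_inverse)

lemma summable_weight: "summable weight"
proof (rule summable_comparison_test_ev)
  have "(\<lambda>n::nat. (real n) ^ 4 * exp (- (real n powr \<gamma>))) \<longlonglongrightarrow> 0"
    using \<gamma>_pos by real_asymp
  then have "eventually (\<lambda>n::nat. (real n) ^ 4 * exp (- (real n powr \<gamma>)) < 1) sequentially"
    by (rule order_tendstoD(2)) simp
  then show "eventually (\<lambda>n. norm (weight n) \<le> inverse (real n ^ 2)) sequentially"
    using eventually_gt_at_top[of 0]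
  proof eventually_elim
    case (elim n)
    have "weight n * real n ^ 2 \<le> 1"
      using elim by (simp add: weight_def power2_eq_square eval_nat_numeral mult_ac)
    then show ?case using elim weight_nonneg[of n] by (simp add: field_simps)
  qed
  show "summable (\<lambda>n. inverse (real n ^ 2))" by (rule inverse_power_summable) simp
qed

lemma sum_weight_le: "(\<Sum>j=1..n. weight j) \<le> total_weight"
  unfolding total_weight_def by (rule sum_le_suminf[OF summable_weight]) (auto simp: weight_nonneg)

lemma sum_weight_ge:
  assumes "1 \<le> n" shows "exp (- 1) \<le> (\<Sum>j=1..n. weight j)"
proof -
  have "weight 1 \<le> (\<Sum>j=1..n. weight j)"
    using assms by (intro member_le_sum) (auto simp: weight_nonneg)
  then show ?thesis by (simp add: weight_def)
qed

lemma total_weight_pos: "0 < total_weight"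
  using order.strict_trans2[OF exp_gt_zero order.trans[OF sum_weight_ge sum_weight_le]] by blast

lemma rate_ge:
  assumes i: "i \<in> {1..n}"
  shows "(real i)\<^sup>2 / (total_weight * scale i) \<le> rate n i"
proof -
  have pos: "0 < (\<Sum>j=1..n. weight j)"
    using sum_weight_ge[of n] i less_le_trans[OF exp_gt_zero[of "-1::real"]] by auto
  have "weight i / total_weight \<le> weight i / (\<Sum>j=1..n. weight j)"
    using sum_weight_le[of n] weight_nonneg[of i] pos by (intro divide_left_mono) (auto intro: mult_pos_pos total_weight_pos)
  then show ?thesis by (simp add: rate_def weight_eq mult.commute)
qed

lemma rate_pos: "i \<in> {1..n} \<Longrightarrow> 0 < rate n i"
proof -
  assume i: "i \<in> {1..n}"
  then have "0 < (real i)\<^sup>2 / (total_weight * scale i)" using total_weight_pos scale_pos[of i] by simp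
  then show ?thesis using rate_ge[OF i] by linarith
qed

lemma rate_le:
  assumes i: "i \<in> {1..n}"
  shows "rate n i \<le> (real i)\<^sup>2 * exp 1 / scale i"
proof -
  have "weight i / (\<Sum>j=1..n. weight j) \<le> weight i / exp (- 1)"
    using sum_weight_ge[of n] weight_nonneg[of i] i
      less_le_trans[OF exp_gt_zero[of "-1::real"] sum_weight_ge[of n]]
    by (intro divide_left_mono) auto
  then show ?thesis by (simp add: rate_def weight_eq exp_minus divide_inverse mult_ac)
qed

lemma sum_rate:
  assumes "1 \<le> n" shows "sum (rate n) {1..n} = 1"
proof -
  have "(\<Sum>j=1..n. weight j) \<noteq> 0"
    using sum_weight_ge[OF assms] less_le_trans[OF exp_gt_zero[of "-1::real"]] by fastforce
  then show ?thesis by (simp add: rate_def flip: sum_divide_distrib)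
qed

lemma heisenberg: "1 \<le> i \<Longrightarrow> heisenberg (i + 2)"
  by unfold_locales simp

lemma walk_product:
  assumes "1 \<le> n" shows "walk_product {1..n} walk (rate n)"
proof -
  have "group (fst (walk i)) \<and> finite (carrier (fst (walk i))) \<and> prob_on (carrier (fst (walk i))) (snd (walk i))"
    if "i \<in> {1..n}" for i
    using that heisenberg[of i] heisenberg.group_H heisenberg.finite_H heisenberg.prob_step
    by (auto simp: walk_def heisenberg_walk_def)
  then show ?thesis
    by (intro walk_product.intro) (use assms rate_pos sum_rate in auto)
qed

lemma modulus_le: "i \<in> {1..n} \<Longrightarrow> (real (i + 2))\<^sup>2 \<le> 9 * (real i)\<^sup>2"
proof -
  assume "i \<in> {1..n}"
  then have "(real (i + 2))\<^sup>2 \<le> (3 * real i)\<^sup>2" by (intro power_mono) auto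
  then show ?thesis by (simp add: power_mult_distrib)
qed

lemma rate_gap_ge:
  assumes i: "i \<in> {1..n}"
  shows "1 / (9 * total_weight * scale i) \<le> rate n i * slow_gap (i + 2)"
proof -
  interpret heisenberg "i + 2" using i by (intro heisenberg) simp
  have i1: "1 \<le> real i" using i by simp
  have "1 / (9 * total_weight * scale i) = (real i)\<^sup>2 / (total_weight * scale i) * (1 / (9 * (real i)\<^sup>2))"
    using i1 by simp
  also have "\<dots> \<le> rate n i * (1 / (real (i + 2))\<^sup>2)"
    using rate_ge[OF i] rate_pos[OF i] modulus_le[OF i] i1
    by (intro mult_mono divide_left_mono) auto
  also have "\<dots> \<le> rate n i * slow_gap (i + 2)"
    using slow_gap_ge rate_pos[OF i] by (intro mult_left_mono) auto
  finally show ?thesis .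
qed

lemma rate_gap_le:
  assumes i: "i \<in> {1..n}"
  shows "rate n i * slow_gap (i + 2) \<le> 8 * exp 1 / scale i"
proof -
  interpret heisenberg "i + 2" using i by (intro heisenberg) simp
  have i1: "1 \<le> real i" using i by simp
  have "rate n i * slow_gap (i + 2) \<le> (real i)\<^sup>2 * exp 1 / scale i * (8 / (real (i + 2))\<^sup>2)"
    using rate_le[OF i] slow_gap_le[of "i + 2"] slow_gap_range rate_pos[OF i] scale_pos[of i]
    by (intro mult_mono) (auto intro: less_imp_le)
  also have "\<dots> \<le> (real i)\<^sup>2 * exp 1 / scale i * (8 / (real i)\<^sup>2)"
    using i1 scale_pos[of i] by (intro mult_left_mono divide_left_mono power_mono) (auto intro: less_imp_le)
  also have "\<dots> = 8 * exp 1 / scale i" using i1 by simp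
  finally show ?thesis .
qed

lemma slow_mode_walk:
  assumes "i \<in> {1..n}"
  shows "x \<in> carrier (fst (walk i)) \<Longrightarrow> (\<Sum>y\<in>carrier (fst (walk i)). snd (walk i) y *
      slow_mode (i + 2) (x \<otimes>\<^bsub>fst (walk i)\<^esub> y)) = (1 - slow_gap (i + 2)) * slow_mode (i + 2) x"
    and "slow_mode (i + 2) \<one>\<^bsub>fst (walk i)\<^esub> = 1"
    and "0 < slow_gap (i + 2)" "slow_gap (i + 2) < 1"
proof -
  interpret heisenberg "i + 2" using assms by (intro heisenberg) simp
  show "x \<in> carrier (fst (walk i)) \<Longrightarrow> (\<Sum>y\<in>carrier (fst (walk i)). snd (walk i) y *
      slow_mode (i + 2) (x \<otimes>\<^bsub>fst (walk i)\<^esub> y)) = (1 - slow_gap (i + 2)) * slow_mode (i + 2) x"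
    unfolding walk_def heisenberg_walk_def fst_conv snd_conv by (rule slow_mode_eigenfunction)
  show "slow_mode (i + 2) \<one>\<^bsub>fst (walk i)\<^esub> = 1"
    unfolding walk_def heisenberg_walk_def fst_conv by (rule slow_mode_one)
  show "0 < slow_gap (i + 2)" "slow_gap (i + 2) < 1" using slow_gap_range by auto
qed

lemma abs_slow_mode_le: "\<bar>slow_mode m x\<bar> \<le> 1"
  by (simp add: slow_mode_def)

lemma product_ge_second_moment:
  assumes n: "1 \<le> n"
  shows "1 - 8 / (\<Sum>i=1..n. (1 - rate n i * slow_gap (i + 2)) ^ (2 * m)) \<le> tv_dist (product n) m"
  unfolding product_def
  by (rule walk_product.tv_dist_product_ge_second_moment[OF walk_product[OF n],
        where \<phi> = "\<lambda>i. slow_mode (i + 2)"])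
    (use n slow_mode_walk abs_slow_mode_le in auto)

lemma product_ge_coordinate:
  assumes i: "i \<in> {1..n}"
  shows "(1 - rate n i * slow_gap (i + 2)) ^ m / 2 \<le> tv_dist (product n) m"
  unfolding product_def
  by (rule walk_product.tv_dist_product_ge_coordinate[OF walk_product,
        where \<phi> = "\<lambda>i. slow_mode (i + 2)"])
    (use i slow_mode_walk abs_slow_mode_le in auto)


text \<open>The number of moves \<open>k\<close> is measured by \<open>y\<close> in units of \<open>i\<^sup>2\<close>; since \<open>(i + 2)\<^sup>2 \<le> 9 * i\<^sup>2\<close>, the bounds for
  the single walk are available from \<open>y = 9\<close> on.\<close>

lemma walk_l2_excess_crude:
  assumes i: "i \<in> {1..n}" and y: "9 \<le> y" "(real i)\<^sup>2 * y \<le> real k"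
  shows "l2_excess (walk i) k \<le> (mode_bound + 421875) * exp (- (y / 225))"
proof -
  interpret heisenberg "i + 2" using i by (intro heisenberg) simp
  have i1: "1 \<le> real i" using i by simp
  have "(real (i + 2))\<^sup>2 \<le> (real i)\<^sup>2 * 9" using modulus_le[OF i] by simp
  also have "\<dots> \<le> (real i)\<^sup>2 * y" using y by (intro mult_left_mono) auto
  finally have "(real (i + 2))\<^sup>2 \<le> real k" using y by linarith
  then have k: "(i + 2)\<^sup>2 \<le> k" by (metis of_nat_le_iff of_nat_power)
  have "y / 225 = (real i)\<^sup>2 * y / (25 * (9 * (real i)\<^sup>2))" using i1 by simp
  also have "\<dots> \<le> real k / (25 * (real (i + 2))\<^sup>2)"
    using y modulus_le[OF i] i1 by (intro frac_le) auto
  finally have "exp (- (real k / (25 * (real (i + 2))\<^sup>2))) \<le> exp (- (y / 225))" by simp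
  then have "(mode_bound + 421875) * exp (- (real k / (25 * (real (i + 2))\<^sup>2)))
      \<le> (mode_bound + 421875) * exp (- (y / 225))"
    by (rule mult_left_mono) (simp add: mode_bound_def)
  with l2_excess_le_crude[OF k] show ?thesis by (simp only: walk_def)
qed

subsection \<open>Separated time scales\<close>

text \<open>For \<open>\<gamma> \<ge> 1\<close> the function \<open>x powr \<gamma> - x\<close> is increasing on \<open>x \<ge> 1\<close>, so the ratios of the time scales
  are dominated by those of \<open>exp i\<close>.\<close>

lemma sum_scale_le:
  assumes "1 \<le> \<gamma>"
  shows "(\<Sum>i=1..n. scale i / scale n) \<le> 2"
proof -
  have q: "exp (- 1) \<le> (1 / 2 :: real)" using exp_ge_add_one_self[of 1] by (simp add: exp_minus field_simps)
  have term_le: "scale i / scale n \<le> exp (- 1) ^ (n - i)" if i: "i \<in> {1..n}" for i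
  proof -
    have split: "x powr \<gamma> - x = x * (x powr (\<gamma> - 1) - 1)" if "0 < x" for x
      using that by (simp add: powr_diff right_diff_distrib)
    have "1 powr (\<gamma> - 1) \<le> real i powr (\<gamma> - 1)" using i assms by (intro powr_mono2) auto
    moreover have "real i powr (\<gamma> - 1) \<le> real n powr (\<gamma> - 1)" using i assms by (intro powr_mono2) auto
    ultimately have "real i * (real i powr (\<gamma> - 1) - 1) \<le> real n * (real n powr (\<gamma> - 1) - 1)"
      using i by (intro mult_mono) auto
    then have "real i powr \<gamma> - real i \<le> real n powr \<gamma> - real n" using i by (simp add: split)
    then have "real i powr \<gamma> - real n powr \<gamma> \<le> real (n - i) * (- 1)" using i by (simp add: of_nat_diff)
    then have "exp (real i powr \<gamma> - real n powr \<gamma>) \<le> exp (real (n - i) * (- 1))"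
      by (simp only: exp_le_cancel_iff)
    then show ?thesis by (simp only: exp_of_nat_mult scale_def exp_diff)
  qed
  have "(\<Sum>i=1..n. scale i / scale n) \<le> (\<Sum>i=1..n. exp (- 1) ^ (n - i))"
    by (intro sum_mono term_le)
  also have "\<dots> \<le> 2"
  proof (induction n)
    case (Suc n)
    have "(\<Sum>i=1..Suc n. exp (- 1) ^ (Suc n - i)) = exp (- 1) * (\<Sum>i=1..n. exp (- 1) ^ (n - i)) + (1::real)"
      by (simp add: sum_distrib_left Suc_diff_le)
    also have "\<dots> \<le> 1 / 2 * 2 + 1" using q Suc by (intro add_right_mono mult_mono) (auto intro: sum_nonneg)
    finally show ?case by simp
  qed simp
  finally show ?thesis .
qed

definition upper_const :: real where
  "upper_const = 8 * total_weight + 900 * total_weight * (mode_bound + 421875)"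

lemma mode_bound_nonneg: "0 \<le> mode_bound"
  by (simp add: mode_bound_def)

lemma upper_const_pos: "0 < upper_const"
  using total_weight_pos mode_bound_nonneg by (simp add: upper_const_def add_pos_nonneg)

text \<open>Both error terms of \<open>tv_dist_product_le\<close> are bounded by \<open>1 / c\<close> times the sum of the ratios of the
  time scales: the first because coordinate \<open>i\<close> is expected to move at least of the order of \<open>c * scale n / scale i\<close>
  times, the second by \<open>exp (- x) \<le> 1 / x\<close>.\<close>

lemma product_upper_separated:
  assumes \<gamma>: "1 \<le> \<gamma>" and n: "1 \<le> n" and c: "18 * total_weight \<le> c" and m: "c * scale n \<le> real m"
  shows "tv_dist (product n) m \<le> upper_const / c + sqrt (exp (upper_const / c) - 1)"
proof -
  interpret wp: walk_product "{1..n}" walk "rate n" by (rule walk_product[OF n])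
  let ?C = "mode_bound + 421875"
  have c0: "0 < c" using c total_weight_pos by linarith
  have "0 < c * scale n" using c0 scale_pos by simp
  then have m0: "0 < m" using m by (cases m) auto
  have C0: "0 \<le> ?C" using mode_bound_nonneg by simp
  define A where "A i = ?C * (450 * total_weight / c) * (scale i / scale n)" for i
  have time: "(real i)\<^sup>2 * (c * scale n / (total_weight * scale i)) \<le> rate n i * real m" if i: "i \<in> {1..n}" for i
  proof -
    have "(real i)\<^sup>2 / (total_weight * scale i) * (c * scale n) \<le> rate n i * real m"
      using rate_ge[OF i] m rate_pos[OF i] c0 scale_pos[of n]
      by (intro mult_mono) (auto intro: less_imp_le)
    then show ?thesis by simp
  qed
  have "tv_dist (product_walk {1..n} walk (rate n)) m
      \<le> (\<Sum>i\<in>{1..n}. 1 / ((1/2)\<^sup>2 * rate n i * real m)) + sqrt (exp (sum A {1..n}) - 1)"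
  proof (rule wp.tv_dist_product_le)
    show "0 \<le> A i" for i
      using C0 c0 total_weight_pos scale_pos[of i] scale_pos[of n] by (simp add: A_def)
    fix i k assume i: "i \<in> {1..n}" and k: "(1 - 1/2) * rate n i * real m \<le> real k"
    define y where "y = c * scale n / (2 * total_weight * scale i)"
    have "9 \<le> y"
    proof -
      have "9 * (2 * total_weight * scale i) \<le> c * scale i" using c scale_pos[of i] by simp
      also have "\<dots> \<le> c * scale n" using c0 i scale_mono[of i n] by (intro mult_left_mono) auto
      finally show ?thesis using total_weight_pos scale_pos[of i] by (simp add: y_def field_simps)
    qed
    moreover have "(real i)\<^sup>2 * y \<le> real k"
    proof -
      have "(real i)\<^sup>2 * y = (real i)\<^sup>2 * (c * scale n / (total_weight * scale i)) / 2"
        by (simp add: y_def)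
      moreover have "rate n i * real m \<le> 2 * real k" using k by simp
      ultimately show ?thesis using time[OF i] by argo
    qed
    ultimately have "l2_excess (walk i) k \<le> ?C * exp (- (y / 225))" by (intro walk_l2_excess_crude[OF i])
    also have "\<dots> \<le> ?C * (225 / y)"
    proof (rule mult_left_mono[OF _ C0])
      have "y / 225 \<le> exp (y / 225)" using exp_ge_add_one_self[of "y / 225"] by linarith
      then show "exp (- (y / 225)) \<le> 225 / y" using \<open>9 \<le> y\<close> by (simp add: exp_minus field_simps)
    qed
    also have "\<dots> = A i" using c0 by (simp add: y_def A_def)
    finally show "l2_excess (walk i) k \<le> A i" .
  qed (use m0 in auto)
  moreover have "(\<Sum>i\<in>{1..n}. 1 / ((1/2)\<^sup>2 * rate n i * real m)) \<le> upper_const / c"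
  proof -
    have "(\<Sum>i\<in>{1..n}. 1 / ((1/2)\<^sup>2 * rate n i * real m)) \<le> (\<Sum>i\<in>{1..n}. 4 * total_weight / c * (scale i / scale n))"
    proof (rule sum_mono)
      fix i assume i: "i \<in> {1..n}"
      have "1 * (c * scale n / (total_weight * scale i)) \<le> (real i)\<^sup>2 * (c * scale n / (total_weight * scale i))"
        using i c0 scale_pos[of i] scale_pos[of n] total_weight_pos
        by (intro mult_right_mono) (auto simp: one_le_power)
      then have "c * scale n / (total_weight * scale i) \<le> rate n i * real m" using time[OF i] by simp
      moreover have "0 < c * scale n / (total_weight * scale i)"
        using c0 scale_pos[of i] scale_pos[of n] total_weight_pos by simp
      moreover have "4 / x \<le> 4 / y" if "0 < y" "y \<le> x" for x y :: real
        using that by (intro divide_left_mono) auto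
      ultimately have "4 / (rate n i * real m) \<le> 4 / (c * scale n / (total_weight * scale i))"
        by blast
      then show "1 / ((1/2)\<^sup>2 * rate n i * real m) \<le> 4 * total_weight / c * (scale i / scale n)"
        by (simp add: power2_eq_square)
    qed
    also have "\<dots> = 4 * total_weight / c * (\<Sum>i=1..n. scale i / scale n)" by (simp only: sum_distrib_left)
    also have "\<dots> \<le> 4 * total_weight / c * 2"
      using c0 total_weight_pos by (intro mult_left_mono sum_scale_le \<gamma>) auto
    also have "\<dots> \<le> upper_const / c"
      using c0 total_weight_pos C0 by (simp add: upper_const_def divide_right_mono)
    finally show ?thesis .
  qed
  moreover have S: "sum A {1..n} \<le> upper_const / c"
  proof -
    have "sum A {1..n} = ?C * (450 * total_weight / c) * (\<Sum>i=1..n. scale i / scale n)"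
      unfolding sum_distrib_left by (rule sum.cong[OF refl]) (simp only: A_def)
    also have "\<dots> \<le> ?C * (450 * total_weight / c) * 2"
      using c0 total_weight_pos C0 by (intro mult_left_mono sum_scale_le \<gamma>) auto
    also have "\<dots> \<le> upper_const / c"
      using c0 total_weight_pos by (simp add: upper_const_def divide_right_mono)
    finally show ?thesis .
  qed
  moreover have "sqrt (exp u - 1) \<le> sqrt (exp v - 1)" if "u \<le> v" for u v :: real
    using that by simp
  from this[OF S] have "sqrt (exp (sum A {1..n}) - 1) \<le> sqrt (exp (upper_const / c) - 1)" .
  ultimately show ?thesis unfolding product_def by linarith
qed

text \<open>The last coordinate alone keeps the distance away from \<open>0\<close>.\<close>

lemma product_lower_separated:
  assumes n: "1 \<le> n" and large: "16 * exp 1 \<le> scale n" and m: "real m \<le> M * scale n"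
  shows "exp (- (16 * exp 1 * M)) / 2 \<le> tv_dist (product n) m"
proof -
  have nn: "n \<in> {1..n}" using n by simp
  define x where "x = rate n n * slow_gap (n + 2)"
  have x_le: "x \<le> 8 * exp 1 / scale n" unfolding x_def by (rule rate_gap_le[OF nn])
  have x0: "0 \<le> x"
    using rate_pos[OF nn] slow_mode_walk(3)[OF nn] by (simp add: x_def)
  have "8 * exp 1 / scale n \<le> 1 / 2" using large scale_pos[of n] by (simp add: field_simps)
  then have x_half: "x \<le> 1 / 2" using x_le by linarith
  have "real m * (2 * x) \<le> (M * scale n) * (2 * (8 * exp 1 / scale n))"
    using m x_le x0 by (intro mult_mono) auto
  also have "\<dots> = 16 * exp 1 * M" using scale_pos[of n] by simp
  finally have "exp (- (16 * exp 1 * M)) \<le> exp (real m * - (2 * x))" by simp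
  also have "\<dots> = exp (- (2 * x)) ^ m" by (rule exp_of_nat_mult)
  also have "\<dots> \<le> (1 - x) ^ m" using x0 x_half by (intro power_mono exp_le_one_minus) auto
  finally show ?thesis using product_ge_coordinate[OF nn, of m] by (simp add: x_def)
qed

lemma scale_at_top: "filterlim scale at_top sequentially"
  unfolding scale_def using \<gamma>_pos by real_asymp

text \<open>The level \<open>1 / 2\<close> is reached before a fixed multiple of \<open>scale n\<close>, whereas a sufficiently small level
  \<open>\<delta>\<close> is not reached before twice that time; so the ratio of the two mixing times cannot tend to \<open>1\<close>.\<close>

theorem no_cutoff_separated:
  assumes \<gamma>: "1 \<le> \<gamma>"
  shows "\<not> has_tv_cutoff product"
proof
  assume cutoff: "has_tv_cutoff product"
  have upper: "\<exists>c>0. \<forall>n\<ge>1. tv_dist (product n) (nat \<lceil>c * scale n\<rceil>) \<le> \<delta>" if \<delta>: "0 < \<delta>" for \<delta>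
  proof -
    have "((\<lambda>c. upper_const / c + sqrt (exp (upper_const / c) - 1)) \<longlongrightarrow> 0) at_top"
      using upper_const_pos by real_asymp
    then have "eventually (\<lambda>c. upper_const / c + sqrt (exp (upper_const / c) - 1) < \<delta>) at_top"
      using \<delta> by (rule order_tendstoD(2))
    moreover have "eventually (\<lambda>c. 18 * total_weight \<le> c) at_top" by (rule eventually_ge_at_top)
    ultimately have "eventually (\<lambda>c. upper_const / c + sqrt (exp (upper_const / c) - 1) < \<delta> \<and> 18 * total_weight \<le> c) at_top"
      by (rule eventually_conj)
    then obtain c where c: "upper_const / c + sqrt (exp (upper_const / c) - 1) < \<delta>" "18 * total_weight \<le> c"
      by (auto simp: eventually_at_top_linorder)
    have "tv_dist (product n) (nat \<lceil>c * scale n\<rceil>) \<le> \<delta>" if n: "1 \<le> n" for n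
      using product_upper_separated[OF \<gamma> n c(2), of "nat \<lceil>c * scale n\<rceil>"] c(1)
        real_nat_ceiling_ge[of "c * scale n"] by linarith
    moreover have "0 < c" using c(2) total_weight_pos by linarith
    ultimately show ?thesis by blast
  qed
  obtain c where c: "0 < c" "\<And>n. 1 \<le> n \<Longrightarrow> tv_dist (product n) (nat \<lceil>c * scale n\<rceil>) \<le> 1 / 2"
    using upper[of "1/2"] by auto
  define M where "M = 2 * (c + 1)"
  define \<delta> where "\<delta> = exp (- (16 * exp 1 * M)) / 4"
  have \<delta>: "0 < \<delta>" "\<delta> < 1" "\<delta> < exp (- (16 * exp 1 * M)) / 2"
  proof -
    have "0 < M" using c by (simp add: M_def)
    then have "exp (- (16 * exp 1 * M)) \<le> 1" by simp
    then show "0 < \<delta>" "\<delta> < 1" "\<delta> < exp (- (16 * exp 1 * M)) / 2" 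
      unfolding \<delta>_def using exp_gt_zero[of "- (16 * exp 1 * M)"] by argo+
  qed
  obtain c' where c': "\<And>n. 1 \<le> n \<Longrightarrow> tv_dist (product n) (nat \<lceil>c' * scale n\<rceil>) \<le> \<delta>"
    using upper[OF \<delta>(1)] by auto
  have twice: "eventually (\<lambda>n. 2 * real (tv_mixing_time (product n) (1/2)) < real (tv_mixing_time (product n) \<delta>)) sequentially"
    using filterlim_at_top[THEN iffD1, OF scale_at_top, rule_format, of "16 * exp 1"] eventually_ge_at_top[of 1]
  proof eventually_elim
    case (elim n)
    have "tv_dist (product n) (tv_mixing_time (product n) \<delta>) \<le> \<delta>"
      by (rule tv_mixing_time_attained[OF c'[OF elim(2)]])
    then have lower: "M * scale n < real (tv_mixing_time (product n) \<delta>)"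
      using product_lower_separated[OF elim(2,1), of "tv_mixing_time (product n) \<delta>" M] \<delta>(3) by linarith
    have "tv_mixing_time (product n) (1/2) \<le> nat \<lceil>c * scale n\<rceil>"
      by (rule tv_mixing_time_le[OF c(2)[OF elim(2)]])
    moreover have "0 < c * scale n" using c scale_pos by simp
    ultimately have "real (tv_mixing_time (product n) (1/2)) < c * scale n + 1" by linarith
    moreover have "1 \<le> scale n" by (simp add: scale_def)
    ultimately have "2 * real (tv_mixing_time (product n) (1/2)) \<le> M * scale n"
      by (simp add: M_def algebra_simps)
    with lower show ?case by linarith
  qed
  have lim: "(\<lambda>n. real (tv_mixing_time (product n) \<delta>) / real (tv_mixing_time (product n) (1/2))) \<longlonglongrightarrow> 1"
    using cutoff \<delta> unfolding has_tv_cutoff_def by auto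
  have "eventually (\<lambda>n. real (tv_mixing_time (product n) \<delta>) / real (tv_mixing_time (product n) (1/2)) < 2) sequentially"
    "eventually (\<lambda>n. 0 < real (tv_mixing_time (product n) \<delta>) / real (tv_mixing_time (product n) (1/2))) sequentially"
    using order_tendstoD[OF lim] by auto
  then have "eventually (\<lambda>n::nat. False) sequentially"
    using twice
  proof eventually_elim
    case (elim n)
    then show ?case by (cases "tv_mixing_time (product n) (1/2) = 0") (auto simp: field_simps)
  qed
  then show False by simp
qed

subsection \<open>Clustered time scales\<close>

text \<open>The decay is that of \<open>(1 - slow_gap (i + 2)) powr (rate n i * t)\<close>, the slow mode of coordinate \<open>i\<close>
  after its expected number of moves up to time \<open>t\<close>.\<close>

definition decay :: "nat \<Rightarrow> nat \<Rightarrow> real" where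
  "decay n i = - (rate n i * ln (1 - slow_gap (i + 2)))"

definition mode_sum :: "nat \<Rightarrow> real \<Rightarrow> real" where
  "mode_sum n t = (\<Sum>i=1..n. exp (- (2 * decay n i * t)))"

definition cutoff_time :: "nat \<Rightarrow> real" where
  "cutoff_time n = (SOME t. 0 \<le> t \<and> mode_sum n t = 1)"

lemma slow_gap_le_4_5: "i \<in> {1..n} \<Longrightarrow> slow_gap (i + 2) \<le> 4 / 5"
  using heisenberg.slow_gap_range(2)[OF heisenberg[of i]] by simp

lemma decay_ge:
  assumes i: "i \<in> {1..n}"
  shows "1 / (9 * total_weight * scale i) \<le> decay n i"
proof -
  have "ln (1 - slow_gap (i + 2)) \<le> - slow_gap (i + 2)"
    using ln_le_minus_one[of "1 - slow_gap (i + 2)"] slow_gap_le_4_5[OF i] by simp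
  then have "rate n i * slow_gap (i + 2) \<le> rate n i * - ln (1 - slow_gap (i + 2))"
    using rate_pos[OF i] by (intro mult_left_mono) auto
  then show ?thesis using rate_gap_ge[OF i] by (simp add: decay_def)
qed

lemma decay_ge_scale:
  assumes i: "i \<in> {1..n}"
  shows "1 / (9 * total_weight * scale n) \<le> decay n i"
proof -
  have "1 / (9 * total_weight * scale n) \<le> 1 / (9 * total_weight * scale i)"
    using total_weight_pos scale_pos[of i] scale_pos[of n] scale_mono[of i n] i
    by (intro divide_left_mono mult_left_mono mult_pos_pos) auto
  then show ?thesis using decay_ge[OF i] by linarith
qed

lemma decay_le:
  assumes i: "i \<in> {1..n}"
  shows "decay n i \<le> 40 * exp 1 / scale i"
proof -
  let ?x = "slow_gap (i + 2)"
  have x: "0 < ?x" "?x \<le> 4 / 5" using slow_mode_walk(3)[OF i] slow_gap_le_4_5[OF i] by auto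
  have "- ln (1 - ?x) = ln (1 / (1 - ?x))" using x by (simp add: ln_div)
  also have "\<dots> \<le> 1 / (1 - ?x) - 1" using x by (intro ln_le_minus_one) auto
  also have "\<dots> \<le> 5 * ?x"
  proof -
    have "1 / (1 - ?x) - 1 = ?x / (1 - ?x)" using x by (simp add: field_simps)
    also have "\<dots> \<le> ?x / (1 / 5)" using x by (intro divide_left_mono) auto
    finally show ?thesis by simp
  qed
  finally have "rate n i * - ln (1 - ?x) \<le> rate n i * (5 * ?x)"
    using rate_pos[OF i] by (intro mult_left_mono) auto
  also have "\<dots> = 5 * (rate n i * ?x)" by simp
  also have "\<dots> \<le> 5 * (8 * exp 1 / scale i)" using rate_gap_le[OF i] by (rule mult_left_mono) simp
  finally show ?thesis by (simp add: decay_def)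
qed

text \<open>Convexity of \<open>exp\<close>, that is \<open>(1 - g) powr r \<le> 1 - r * g\<close>: the mean of the slow mode, with its random
  number of moves, is at least its value at the expected number of moves.\<close>

lemma exp_decay_le:
  assumes i: "i \<in> {1..n}"
  shows "exp (- decay n i) \<le> 1 - rate n i * slow_gap (i + 2)"
proof -
  have "sum (rate n) {1..n} = 1" using i by (intro sum_rate) auto
  then have r: "0 \<le> rate n i" "rate n i \<le> 1"
    using member_le_sum[of i "{1..n}" "rate n"] i rate_pos by (auto intro: less_imp_le)
  have g: "slow_gap (i + 2) < 1" using slow_mode_walk(4)[OF i] .
  have "exp ((1 - rate n i) *\<^sub>R 0 + rate n i *\<^sub>R ln (1 - slow_gap (i + 2)))
      \<le> (1 - rate n i) * exp 0 + rate n i * exp (ln (1 - slow_gap (i + 2)))"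
    by (rule convex_onD[OF exp_convex r]) auto
  also have "\<dots> = 1 - rate n i * slow_gap (i + 2)" using g by (simp add: algebra_simps)
  finally show ?thesis by (simp add: decay_def)
qed

text \<open>The sum of the modes decreases continuously from \<open>n\<close> to \<open>0\<close>.\<close>

lemma cutoff_time:
  assumes n: "1 \<le> n" shows "0 \<le> cutoff_time n" "mode_sum n (cutoff_time n) = 1"
proof -
  define b where "b = 9 * total_weight * scale n * ln n / 2"
  have b0: "0 \<le> b" using n total_weight_pos scale_pos[of n] by (simp add: b_def)
  have "mode_sum n b \<le> (\<Sum>i=1..n. 1 / real n)"
    unfolding mode_sum_def
  proof (rule sum_mono)
    fix i assume i: "i \<in> {1..n}"
    have "1 / (9 * total_weight * scale n) * b \<le> decay n i * b"
      using decay_ge_scale[OF i] b0 by (rule mult_right_mono)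
    moreover have "1 / (9 * total_weight * scale n) * b = ln n / 2"
      using total_weight_pos scale_pos[of n] by (simp add: b_def)
    ultimately have "exp (- (2 * decay n i * b)) \<le> exp (- ln n)" by simp
    also have "\<dots> = 1 / real n" using n by (simp add: exp_minus divide_inverse)
    finally show "exp (- (2 * decay n i * b)) \<le> 1 / real n" .
  qed
  then have "mode_sum n b \<le> 1" using n by simp
  moreover have "1 \<le> mode_sum n 0" using n by (simp add: mode_sum_def)
  moreover have "continuous_on {0..b} (mode_sum n)"
    unfolding mode_sum_def[abs_def] by (intro continuous_intros)
  ultimately have "\<exists>t\<ge>0. t \<le> b \<and> mode_sum n t = 1" using b0 by (intro IVT2') auto
  then have "\<exists>t. 0 \<le> t \<and> mode_sum n t = 1" by blast
  from someI_ex[OF this] show "0 \<le> cutoff_time n" "mode_sum n (cutoff_time n) = 1"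
    by (auto simp: cutoff_time_def)
qed

text \<open>For fixed \<open>K\<close> the last \<open>K\<close> coordinates eventually have time scales within a factor \<open>exp 1\<close> of
  \<open>scale n\<close>, so that at the cutoff time \<open>K * exp (- c * t / scale n) \<le> 1\<close> with a constant \<open>c\<close>; hence
  \<open>t / scale n\<close> is at least \<open>ln K / c\<close>.\<close>

lemma cutoff_ratio_at_top:
  assumes \<gamma>: "\<gamma> < 1"
  shows "filterlim (\<lambda>n. cutoff_time n / scale n) at_top sequentially"
  unfolding filterlim_at_top
proof
  fix R :: real
  define K where "K = nat \<lceil>exp (80 * exp 1 * exp 1 * R)\<rceil> + 1"
  have "(\<lambda>n::nat. real n powr \<gamma> - (real n - real K) powr \<gamma>) \<longlonglongrightarrow> 0"
    using \<gamma> \<gamma>_pos by real_asymp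
  then have "eventually (\<lambda>n. real n powr \<gamma> - (real n - real K) powr \<gamma> < 1) sequentially"
    by (rule order_tendstoD(2)) simp
  then show "eventually (\<lambda>n. R \<le> cutoff_time n / scale n) sequentially"
    using eventually_gt_at_top[of K]
  proof eventually_elim
    case (elim n)
    let ?t = "cutoff_time n"
    define L where "L = 80 * exp 1 * exp 1 * (?t / scale n)"
    have n1: "1 \<le> n" using elim by simp
    note t = cutoff_time[OF n1]
    have "real n powr \<gamma> \<le> 1 + real (n - K) powr \<gamma>" using elim by (simp add: of_nat_diff)
    then have shift: "scale n \<le> exp 1 * scale (n - K)"
      unfolding scale_def exp_add[symmetric] exp_le_cancel_iff .
    have close: "scale n \<le> exp 1 * scale i" if "n - K \<le> i" for i
      by (rule order.trans[OF shift mult_left_mono[OF scale_mono[OF that]]]) simp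
    have "K * exp (- L) = (\<Sum>i\<in>{Suc (n - K)..n}. exp (- L))" using elim by simp
    also have "\<dots> \<le> (\<Sum>i\<in>{Suc (n - K)..n}. exp (- (2 * decay n i * ?t)))"
    proof (rule sum_mono)
      fix i assume i: "i \<in> {Suc (n - K)..n}"
      have "decay n i \<le> 40 * exp 1 / scale i" using i by (intro decay_le) auto
      also have "\<dots> \<le> 40 * exp 1 * (exp 1 / scale n)"
        using close[of i] i scale_pos[of i] scale_pos[of n] by (simp add: field_simps)
      finally have "decay n i * ?t \<le> 40 * exp 1 * (exp 1 / scale n) * ?t"
        using t(1) by (rule mult_right_mono)
      moreover have "L = 2 * (40 * exp 1 * (exp 1 / scale n) * ?t)" by (simp add: L_def)
      ultimately show "exp (- L) \<le> exp (- (2 * decay n i * ?t))" by simp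
    qed
    also have "\<dots> \<le> mode_sum n ?t"
      unfolding mode_sum_def by (rule sum_mono2) auto
    finally have "real K \<le> exp L" by (simp add: t(2) exp_minus field_simps)
    moreover have "exp (80 * exp 1 * exp 1 * R) < real K" unfolding K_def by linarith
    ultimately have "80 * exp 1 * exp 1 * R < L"
      by (metis exp_less_cancel_iff order_less_le_trans)
    then have "R < ?t / scale n" unfolding L_def by (rule mult_left_less_imp_less) simp
    then show ?case by simp
  qed
qed

definition sharp_const :: real where
  "sharp_const = mode_bound * exp 32 + 421875"

lemma sharp_const_nonneg: "0 \<le> sharp_const"
  unfolding sharp_const_def using mode_bound_nonneg
  by (intro add_nonneg_nonneg mult_nonneg_nonneg exp_ge_zero) auto

lemma walk_l2_excess_sharp:
  assumes i: "i \<in> {1..n}" "398 \<le> i" and y: "9 \<le> y" "(real i)\<^sup>2 * y \<le> real k"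
    and k: "rate n i * s \<le> real k"
  shows "l2_excess (walk i) k \<le> sharp_const * exp (- (2 * decay n i * s))"
proof -
  interpret heisenberg "i + 2" using i by (intro heisenberg) simp
  have "(real (i + 2))\<^sup>2 \<le> (real i)\<^sup>2 * 9" using modulus_le[OF i(1)] by simp
  also have "\<dots> \<le> (real i)\<^sup>2 * y" using y by (intro mult_left_mono) auto
  finally have "(real (i + 2))\<^sup>2 \<le> real k" using y by linarith
  then have k': "(i + 2)\<^sup>2 \<le> k" by (metis of_nat_le_iff of_nat_power)
  let ?b = "1 - slow_gap (i + 2)"
  have b: "0 < ?b" "?b \<le> 1" using slow_gap_range by auto
  have "ln ?b \<le> 0" using b by simp
  then have "real k * ln ?b \<le> rate n i * s * ln ?b" using k by (rule mult_right_mono_neg[rotated])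
  then have "2 * (real k * ln ?b) \<le> 2 * (rate n i * s * ln ?b)" by (rule mult_left_mono) simp
  moreover have "real (2 * k) * ln ?b = 2 * (real k * ln ?b)" by simp
  moreover have "- (2 * decay n i * s) = 2 * (rate n i * s * ln ?b)" by (simp add: decay_def mult_ac)
  ultimately have "real (2 * k) * ln ?b \<le> - (2 * decay n i * s)" by (simp only:)
  then have "exp (real (2 * k) * ln ?b) \<le> exp (- (2 * decay n i * s))" by (simp only: exp_le_cancel_iff)
  moreover have "exp (real (2 * k) * ln ?b) = ?b ^ (2 * k)" using b by (simp only: exp_of_nat_mult exp_ln)
  ultimately have "?b ^ (2 * k) \<le> exp (- (2 * decay n i * s))" by (simp only:)
  then have "sharp_const * ?b ^ (2 * k)
      \<le> sharp_const * exp (- (2 * decay n i * s))"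
    by (rule mult_left_mono) (rule sharp_const_nonneg)
  moreover have "l2_excess (walk i) k \<le> sharp_const * ?b ^ (2 * k)"
    unfolding walk_def sharp_const_def using i(2) by (intro l2_excess_le_sharp k') simp
  ultimately show ?thesis by (rule order.trans[rotated])
qed

definition inverse_square_sum :: real where
  "inverse_square_sum = (\<Sum>n. inverse (real n ^ 2))"

lemma sum_inverse_square_le: "(\<Sum>i=1..n. 1 / (real i)\<^sup>2) \<le> inverse_square_sum"
  unfolding inverse_square_sum_def inverse_eq_divide[symmetric]
  by (rule sum_le_suminf) (auto intro: inverse_power_summable)

text \<open>The coordinates with modulus at least \<open>400\<close> are bounded by their slow modes, which sum to \<open>1\<close> at the
  cutoff time and gain a factor \<open>exp (- ((a - 1) * R / (9 * total_weight)))\<close> from the extra time.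
  The remaining coordinates are fewer than \<open>398\<close>, and for them the crude bound is enough. The
  choice of \<open>\<eta>\<close> gives \<open>(1 - \<eta>) * a = (a + 1) / 2\<close>, so half of the extra time is left after allowing for
  fluctuations of the numbers of moves.\<close>

lemma product_upper_clustered:
  assumes n: "1 \<le> n" and a: "1 < a" and m: "a * cutoff_time n \<le> real m"
    and R: "R = cutoff_time n / scale n" "9 * total_weight \<le> R"
  shows "tv_dist (product n) m \<le> total_weight * inverse_square_sum * (2 * a / (a - 1))\<^sup>2 / R
    + sqrt (exp (sharp_const * exp (- ((a - 1) * R / (9 * total_weight)))
        + 398 * (mode_bound + 421875) * exp (- (R / (225 * total_weight)))) - 1)"
proof -
  interpret wp: walk_product "{1..n}" walk "rate n" by (rule walk_product[OF n])
  let ?t = "cutoff_time n" and ?C0 = "mode_bound + 421875" and ?C1 = sharp_const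
  define \<eta> where "\<eta> = (a - 1) / (2 * a)"
  have \<eta>: "0 < \<eta>" "0 < 1 - \<eta>" "(1 - \<eta>) * a = (a + 1) / 2" "1 \<le> (1 - \<eta>) * a"
    using a by (auto simp: \<eta>_def field_simps)
  have C0: "0 \<le> ?C0" and C1: "0 \<le> ?C1" using mode_bound_nonneg sharp_const_nonneg by simp_all
  have R0: "0 < R" using R(2) total_weight_pos by linarith
  have t_eq: "?t = R * scale n" using R scale_pos[of n] by simp
  have t0: "0 < ?t" using R0 scale_pos[of n] by (simp add: t_eq)
  have m0: "0 < m"
  proof -
    have "0 < a * ?t" using a t0 by simp
    then show ?thesis using m by (cases m) auto
  qed
  have time: "(real i)\<^sup>2 * (R / total_weight) \<le> rate n i * ?t" if i: "i \<in> {1..n}" for i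
  proof -
    have "(real i)\<^sup>2 * (R / total_weight) = (real i)\<^sup>2 / (total_weight * scale n) * ?t"
      using scale_pos[of n] by (simp add: t_eq)
    also have "\<dots> \<le> (real i)\<^sup>2 / (total_weight * scale i) * ?t"
      using scale_pos[of n] scale_pos[of i] total_weight_pos scale_mono[of i n] i t0
      by (intro mult_right_mono divide_left_mono mult_left_mono mult_pos_pos) auto
    also have "\<dots> \<le> rate n i * ?t" using rate_ge[OF i] t0 by (intro mult_right_mono) auto
    finally show ?thesis .
  qed
  have rm: "rate n i * ?t \<le> rate n i * real m" if i: "i \<in> {1..n}" for i
  proof -
    have "1 * ?t \<le> a * ?t" using a t0 by (intro mult_right_mono) auto
    then show ?thesis using m rate_pos[OF i] by (intro mult_left_mono) auto
  qed
  define A1 where "A1 i = ?C1 * exp (- ((a - 1) * R / (9 * total_weight))) * exp (- (2 * decay n i * ?t))" for i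
  define A2 where "A2 i = (if i < 398 then ?C0 * exp (- (R / (225 * total_weight))) else 0)" for i :: nat
  have A_nonneg: "0 \<le> A1 i" "0 \<le> A2 i" for i
    using C0 C1 by (auto simp: A1_def A2_def)
  have main: "tv_dist (product_walk {1..n} walk (rate n)) m
      \<le> (\<Sum>i\<in>{1..n}. 1 / (\<eta>\<^sup>2 * rate n i * real m)) + sqrt (exp (\<Sum>i\<in>{1..n}. A1 i + A2 i) - 1)"
  proof (rule wp.tv_dist_product_le)
    show "0 \<le> A1 i + A2 i" for i using A_nonneg[of i] by simp
    fix i k assume i: "i \<in> {1..n}" and k: "(1 - \<eta>) * rate n i * real m \<le> real k"
    have "rate n i * ((1 - \<eta>) * a * ?t) \<le> rate n i * ((1 - \<eta>) * real m)"
      using m rate_pos[OF i] \<eta>(2) by (intro mult_left_mono) (auto simp: mult.assoc)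
    also have "\<dots> \<le> real k" using k by (simp add: mult_ac)
    finally have k1: "rate n i * ((1 - \<eta>) * a * ?t) \<le> real k" .
    have "rate n i * (1 * ?t) \<le> rate n i * ((1 - \<eta>) * a * ?t)"
      using rate_pos[OF i] \<eta>(4) t0 by (intro mult_left_mono mult_right_mono) auto
    then have k2: "(real i)\<^sup>2 * (R / total_weight) \<le> real k" using time[OF i] k1 by simp
    have y: "9 \<le> R / total_weight" using R(2) total_weight_pos by (simp add: field_simps)
    show "l2_excess (walk i) k \<le> A1 i + A2 i"
    proof (cases "i < 398")
      case True
      then show ?thesis
        using walk_l2_excess_crude[OF i y k2] A_nonneg(1)[of i] by (simp add: A2_def mult.commute)
    next
      case False
      have "R / (9 * total_weight) = 1 / (9 * total_weight * scale n) * ?t"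
        using scale_pos[of n] by (simp add: t_eq)
      also have "\<dots> \<le> decay n i * ?t" using decay_ge_scale[OF i] t0 by (intro mult_right_mono) auto
      finally have "(a - 1) * (R / (9 * total_weight)) \<le> (a - 1) * (decay n i * ?t)"
        using a by (intro mult_left_mono) auto
      moreover have "2 * decay n i * ((1 - \<eta>) * a * ?t) = 2 * decay n i * ?t + (a - 1) * (decay n i * ?t)"
        unfolding \<eta>(3) by (simp add: field_simps)
      ultimately have "exp (- (2 * decay n i * ((1 - \<eta>) * a * ?t)))
          \<le> exp (- ((a - 1) * R / (9 * total_weight)) + - (2 * decay n i * ?t))" by simp
      then have "?C1 * exp (- (2 * decay n i * ((1 - \<eta>) * a * ?t))) \<le> A1 i"
        unfolding A1_def exp_add mult.assoc using C1 by (intro mult_left_mono) auto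
      then show ?thesis
        using walk_l2_excess_sharp[OF i _ y k2 k1] False A_nonneg(2)[of i] by simp
    qed
  qed (use \<eta> m0 in auto)
  have T: "(\<Sum>i\<in>{1..n}. 1 / (\<eta>\<^sup>2 * rate n i * real m)) \<le> total_weight * inverse_square_sum * (2 * a / (a - 1))\<^sup>2 / R"
  proof -
    have "(\<Sum>i\<in>{1..n}. 1 / (\<eta>\<^sup>2 * rate n i * real m)) \<le> (\<Sum>i=1..n. total_weight / (\<eta>\<^sup>2 * R) * (1 / (real i)\<^sup>2))"
    proof (rule sum_mono)
      fix i assume i: "i \<in> {1..n}"
      have "0 < (real i)\<^sup>2 * (R / total_weight)" using i R0 total_weight_pos by simp
      moreover have "(real i)\<^sup>2 * (R / total_weight) \<le> rate n i * real m"
        using time[OF i] rm[OF i] by linarith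
      moreover have "1 / (\<eta>\<^sup>2 * x) \<le> 1 / (\<eta>\<^sup>2 * y)" if "0 < y" "y \<le> x" for x y
        using that \<eta>(1) by (intro divide_left_mono mult_left_mono) auto
      ultimately have "1 / (\<eta>\<^sup>2 * (rate n i * real m)) \<le> 1 / (\<eta>\<^sup>2 * ((real i)\<^sup>2 * (R / total_weight)))"
        by blast
      then show "1 / (\<eta>\<^sup>2 * rate n i * real m) \<le> total_weight / (\<eta>\<^sup>2 * R) * (1 / (real i)\<^sup>2)"
        by (simp add: mult_ac)
    qed
    also have "\<dots> = total_weight / (\<eta>\<^sup>2 * R) * (\<Sum>i=1..n. 1 / (real i)\<^sup>2)" by (simp only: sum_distrib_left)
    also have "\<dots> \<le> total_weight / (\<eta>\<^sup>2 * R) * inverse_square_sum"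
      using R0 total_weight_pos by (intro mult_left_mono sum_inverse_square_le) auto
    also have "\<dots> = total_weight * inverse_square_sum * (2 * a / (a - 1))\<^sup>2 / R"
      using a R0 by (simp add: \<eta>_def power_divide)
    finally show ?thesis .
  qed
  have S: "(\<Sum>i\<in>{1..n}. A1 i + A2 i) \<le> ?C1 * exp (- ((a - 1) * R / (9 * total_weight)))
      + 398 * ?C0 * exp (- (R / (225 * total_weight)))"
  proof -
    have "sum A1 {1..n} = ?C1 * exp (- ((a - 1) * R / (9 * total_weight))) * mode_sum n ?t"
      unfolding mode_sum_def sum_distrib_left by (rule sum.cong[OF refl]) (simp only: A1_def)
    also have "\<dots> = ?C1 * exp (- ((a - 1) * R / (9 * total_weight)))" by (simp only: cutoff_time(2)[OF n] mult_1_right)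
    finally have s1: "sum A1 {1..n} = ?C1 * exp (- ((a - 1) * R / (9 * total_weight)))" .
    have "sum A2 {1..n} \<le> sum A2 ({1..n} \<union> {..<398})"
      by (rule sum_mono2) (auto simp: A_nonneg)
    also have "\<dots> = sum A2 {..<398}"
      by (rule sum.mono_neutral_right) (auto simp: A2_def)
    also have "\<dots> = 398 * ?C0 * exp (- (R / (225 * total_weight)))"
      by (simp add: A2_def)
    finally show ?thesis using s1 by (simp add: sum.distrib)
  qed
  have "sqrt (exp u - 1) \<le> sqrt (exp v - 1)" if "u \<le> v" for u v :: real
    using that by simp
  from order.trans[OF main add_mono[OF T this[OF S]]] show ?thesis unfolding product_def .
qed

text \<open>Going back from the cutoff time to \<open>a\<close> times it increases the sum of the squared modes from \<open>1\<close> to at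
  least \<open>exp (2 * (1 - a) * R / (9 * total_weight))\<close>.\<close>

lemma product_lower_clustered:
  assumes n: "1 \<le> n" and a: "0 < a" "a < 1" and m: "real m \<le> a * cutoff_time n"
    and R: "R = cutoff_time n / scale n"
  shows "1 - 8 * exp (- (2 * (1 - a) * R / (9 * total_weight))) \<le> tv_dist (product n) m"
proof -
  let ?t = "cutoff_time n"
  let ?S = "\<Sum>i=1..n. (1 - rate n i * slow_gap (i + 2)) ^ (2 * m)"
  note t = cutoff_time[OF n]
  define E where "E = exp (2 * (1 - a) * R / (9 * total_weight))"
  have "E = E * mode_sum n ?t" by (simp add: t)
  also have "\<dots> = (\<Sum>i=1..n. E * exp (- (2 * decay n i * ?t)))"
    by (simp only: mode_sum_def sum_distrib_left)
  also have "\<dots> \<le> ?S"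
  proof (rule sum_mono)
    fix i assume i: "i \<in> {1..n}"
    have "1 / (9 * total_weight * scale n) * ?t \<le> decay n i * ?t"
      using decay_ge_scale[OF i] t(1) by (rule mult_right_mono)
    then have "(2 * (1 - a)) * (R / (9 * total_weight)) \<le> (2 * (1 - a)) * (decay n i * ?t)"
      using a by (intro mult_left_mono) (auto simp: R mult_ac)
    moreover have "0 \<le> 1 / (9 * total_weight * scale n)" using total_weight_pos scale_pos[of n] by simp
    then have "0 \<le> decay n i" using decay_ge_scale[OF i] by linarith
    then have "2 * decay n i * real m \<le> 2 * decay n i * (a * ?t)" using m by (intro mult_left_mono) auto
    ultimately have "2 * (1 - a) * R / (9 * total_weight) + - (2 * decay n i * ?t) \<le> real (2 * m) * - decay n i"
      by (simp add: algebra_simps)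
    then have "E * exp (- (2 * decay n i * ?t)) \<le> exp (real (2 * m) * - decay n i)"
      unfolding E_def exp_add[symmetric] exp_le_cancel_iff .
    also have "\<dots> = exp (- decay n i) ^ (2 * m)" by (rule exp_of_nat_mult)
    also have "\<dots> \<le> (1 - rate n i * slow_gap (i + 2)) ^ (2 * m)"
      by (intro power_mono exp_decay_le i) simp
    finally show "E * exp (- (2 * decay n i * ?t)) \<le> (1 - rate n i * slow_gap (i + 2)) ^ (2 * m)" .
  qed
  finally have "8 / ?S \<le> 8 / E"
  proof (intro divide_left_mono mult_pos_pos)
    assume "E \<le> ?S"
    moreover show "0 < E" by (simp add: E_def)
    ultimately show "0 < ?S" by linarith
  qed auto
  then have "1 - 8 / E \<le> 1 - 8 / ?S" by (rule diff_left_mono)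
  also have "\<dots> \<le> tv_dist (product n) m" by (rule product_ge_second_moment[OF n])
  finally show ?thesis unfolding E_def exp_minus divide_inverse .
qed

theorem cutoff_clustered:
  assumes \<gamma>: "\<gamma> < 1"
  shows "has_tv_cutoff product"
proof (rule has_tv_cutoffI)
  let ?R = "\<lambda>n. cutoff_time n / scale n"
  note R_lim = cutoff_ratio_at_top[OF \<gamma>]
  have R_ev: "eventually (\<lambda>n. c \<le> ?R n) sequentially" for c
    using R_lim by (simp add: filterlim_at_top)
  have n_ev: "eventually (\<lambda>n::nat. 1 \<le> n) sequentially" by (rule eventually_ge_at_top)
  show "filterlim cutoff_time at_top sequentially"
  proof (rule filterlim_at_top_mono[OF R_lim])
    show "eventually (\<lambda>n. ?R n \<le> cutoff_time n) sequentially"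
      using n_ev
    proof eventually_elim
      case (elim n)
      have "1 \<le> scale n" by (simp add: scale_def)
      then have "cutoff_time n / scale n \<le> cutoff_time n / 1"
        using cutoff_time(1)[OF elim] by (intro divide_left_mono) auto
      then show ?case by simp
    qed
  qed
  show "(\<lambda>n. tv_dist (product n) (nat \<lceil>a * cutoff_time n\<rceil>)) \<longlonglongrightarrow> 0" if a: "1 < a" for a
  proof (rule tendsto_sandwich[OF _ _ tendsto_const])
    let ?g = "\<lambda>R. total_weight * inverse_square_sum * (2 * a / (a - 1))\<^sup>2 / R
      + sqrt (exp (sharp_const * exp (- ((a - 1) * R / (9 * total_weight)))
        + 398 * (mode_bound + 421875) * exp (- (R / (225 * total_weight)))) - 1)"
    have "(?g \<longlongrightarrow> 0 + sqrt (exp (sharp_const * 0 + 398 * (mode_bound + 421875) * 0) - 1)) at_top"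
    proof (intro tendsto_intros)
      show "((\<lambda>R. exp (- ((a - 1) * R / (9 * total_weight)))) \<longlongrightarrow> 0) at_top"
        using exp_minus_mult_tendsto_0[of "(a - 1) / (9 * total_weight)"] a total_weight_pos by simp
      show "((\<lambda>R. exp (- (R / (225 * total_weight)))) \<longlongrightarrow> 0) at_top"
        using exp_minus_mult_tendsto_0[of "1 / (225 * total_weight)"] total_weight_pos by simp
      show "((\<lambda>R. total_weight * inverse_square_sum * (2 * a / (a - 1))\<^sup>2 / R) \<longlongrightarrow> 0) at_top"
        by (rule real_tendsto_divide_at_top[OF tendsto_const filterlim_ident])
    qed
    then have "(?g \<longlongrightarrow> 0) at_top" by simp
    then show "(\<lambda>n. ?g (?R n)) \<longlonglongrightarrow> 0" by (rule filterlim_compose[OF _ R_lim])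
    show "eventually (\<lambda>n. tv_dist (product n) (nat \<lceil>a * cutoff_time n\<rceil>) \<le> ?g (?R n)) sequentially"
      using n_ev R_ev[of "9 * total_weight"]
      by eventually_elim (rule product_upper_clustered[OF _ a real_nat_ceiling_ge refl])
    show "eventually (\<lambda>n. 0 \<le> tv_dist (product n) (nat \<lceil>a * cutoff_time n\<rceil>)) sequentially"
      using n_ev
    proof eventually_elim
      case (elim n)
      interpret wp: walk_product "{1..n}" walk "rate n" by (rule walk_product[OF elim])
      show ?case
        unfolding product_def
        by (subst wp.product_walk_eq) (use tv_dist_ge_event[OF wp.finite_PG, of "{}"] in simp)
    qed
  qed
  show "eventually (\<lambda>n. \<forall>m. real m \<le> a * cutoff_time n \<longrightarrow> \<epsilon> < tv_dist (product n) m) sequentially"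
    if a: "0 < a" "a < 1" and \<epsilon>: "\<epsilon> < 1" for a \<epsilon>
  proof -
    have "0 < 2 * (1 - a) / (9 * total_weight)" using a total_weight_pos by simp
    from exp_minus_mult_tendsto_0[OF this]
    have "((\<lambda>R. 1 - 8 * exp (- (2 * (1 - a) * R / (9 * total_weight)))) \<longlongrightarrow> 1 - 8 * 0) at_top"
      by (intro tendsto_intros) simp
    then have "((\<lambda>R. 1 - 8 * exp (- (2 * (1 - a) * R / (9 * total_weight)))) \<longlongrightarrow> 1) at_top" by simp
    then have "(\<lambda>n. 1 - 8 * exp (- (2 * (1 - a) * ?R n / (9 * total_weight)))) \<longlonglongrightarrow> 1"
      by (rule filterlim_compose[OF _ R_lim])
    from order_tendstoD(1)[OF this \<epsilon>] n_ev show ?thesis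
    proof eventually_elim
      case (elim n)
      then show ?case using product_lower_clustered[OF elim(2) a _ refl] by (meson order_less_le_trans)
    qed
  qed
qed

end

theorem proposition1p2:
  fixes \<gamma> :: real
  assumes "\<gamma> > 0"
  shows "has_tv_cutoff
           (product_family (\<lambda>n. heisenberg_walk (n + 2))
                           (\<lambda>n. (real n)^2 * exp (- (real n powr \<gamma>))))
         \<longleftrightarrow> 0 < \<gamma> \<and> \<gamma> < 1"
proof -
  interpret heisenberg_products \<gamma> by standard (rule assms)
  have "product_family (\<lambda>n. heisenberg_walk (n + 2)) (\<lambda>n. (real n)^2 * exp (- (real n powr \<gamma>))) = product"
    by (simp add: fun_eq_iff product_family_def product_def walk_def[abs_def] rate_def[abs_def] weight_def[abs_def])
  then show ?thesis using cutoff_clustered no_cutoff_separated assms by fastforce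
qed

end
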